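(* Assume $\mathsf{ZFC}$ holds, and let $\lambda$ be an infinite cardinal. Suppose that $\langle\mathbb{P},\mathscr{G},\mathscr{F}\rangle$ is a symmetric system such that $\mathbb{P}$ has the $\lambda$-c.c. and $\mathscr{F}$ is $\lambda$-complete. Then $\Vdash^{\mathsf{HS}}\mathsf{DC}_{<\lambda}$, i.e., $\mathsf{DC}_{<\lambda}$ holds in the symmetric extension given by $\langle\mathbb{P},\mathscr{G},\mathscr{F}\rangle$.
   Context: Dependent choice: a tree is $\kappa$-closed if every chain of length less than $\kappa$ has an upper bound in the tree. $\mathsf{DC}_\kappa$ is the statement "every $\kappa$-closed tree has a chain of length $\kappa$ or a maximal element". $\mathsf{DC}_{<\lambda}$ abbreviates "for all infinite cardinals $\kappa<\lambda$, $\mathsf{DC}_\kappa$". Symmetric systems: Let $\mathbb{P}$ be a forcing notion. An automorphism $\pi$ of $\mathbb{P}$ acts on $\mathbb{P}$-names recursively by $\pi\dot x=\{\langle\pi p,\pi\dot y\rangle\mid\langle p,\dot y\rangle\in\dot x\}$. Let $\mathscr{G}\leq\mathrm{Aut}(\mathbb{P})$ be a group of automorphisms. A normal filter of subgroups of $\mathscr{G}$ is a filter $\mathscr{F}$ on the lattice of subgroups of $\mathscr{G}$ (closed under supergroups within $\mathscr{G}$ and under finite intersections) such that if $\pi\in\mathscr{G}$ and $H\in\mathscr{F}$ then $\pi H\pi^{-1}\in\mathscr{F}$. Then $\langle\mathbb{P},\mathscr{G},\mathscr{F}\rangle$ is called a symmetric system. The filter $\mathscr{F}$ is $\lambda$-complete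 if it is closed under intersections of fewer than $\lambda$ of its members. A name $\dot y$ appears in $\dot x$ if $\langle p,\dot y\rangle\in\dot x$ for some $p$. A $\mathbb{P}$-name $\dot x$ is $\mathscr{F}$-symmetric if $\{\pi\in\mathscr{G}\mid\pi\dot x=\dot x\}\in\mathscr{F}$, and hereditarily $\mathscr{F}$-symmetric if this also holds hereditarily for the names which appear in $\dot x$. $\mathsf{HS}$ denotes the class of hereditarily $\mathscr{F}$-symmetric names. For a $V$-generic filter $G\subseteq\mathbb{P}$, $\mathsf{HS}^G=\{\dot x^G\mid\dot x\in\mathsf{HS}\}$ is the symmetric extension; it is a transitive class model of $\mathsf{ZF}$ with $V\subseteq\mathsf{HS}^G\subseteq V[G]$. The relation $\Vdash^{\mathsf{HS}}$ is the forcing relation relativized to the symmetric extension; $\Vdash^{\mathsf{HS}}\varphi$ means that $\varphi$ holds in $\mathsf{HS}^G$ for every $V$-generic $G$. *)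

theory Defs
  imports "HOL-Algebra.Bij"
begin

section \<open>First-order formulas of set theory\<close>

text \<open>De Bruijn indices: in the scope of a quantifier, index 0 is the quantified variable and
  the outer variables are shifted by one. An environment is a function from indices to objects.\<close>

datatype fm = Mem nat nat | Eq nat nat | Neg fm | Conj fm fm (infixr "\<^bold>\<and>" 35) | All fm

abbreviation Disj (infixr "\<^bold>\<or>" 30) where "Disj \<phi> \<psi> \<equiv> Neg (Neg \<phi> \<^bold>\<and> Neg \<psi>)"
abbreviation Imp (infixr "\<^bold>\<longrightarrow>" 25) where "Imp \<phi> \<psi> \<equiv> Neg (\<phi> \<^bold>\<and> Neg \<psi>)"
abbreviation Iff (infixr "\<^bold>\<longleftrightarrow>" 24) where "Iff \<phi> \<psi> \<equiv> (\<phi> \<^bold>\<longrightarrow> \<psi>) \<^bold>\<and> (\<psi> \<^bold>\<longrightarrow> \<phi>)"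
abbreviation Ex where "Ex \<phi> \<equiv> Neg (All (Neg \<phi>))"

text \<open>Bounded quantifiers; the bound \<open>a\<close> is an index of the outer context.\<close>
abbreviation BAll where "BAll a \<phi> \<equiv> All (Mem 0 (a + 1) \<^bold>\<longrightarrow> \<phi>)"
abbreviation BEx where "BEx a \<phi> \<equiv> Ex (Mem 0 (a + 1) \<^bold>\<and> \<phi>)"

primrec sat :: "'a set \<Rightarrow> ('a \<Rightarrow> 'a \<Rightarrow> bool) \<Rightarrow> (nat \<Rightarrow> 'a) \<Rightarrow> fm \<Rightarrow> bool" where
  "sat A R e (Mem i j) \<longleftrightarrow> R (e i) (e j)"
| "sat A R e (Eq i j) \<longleftrightarrow> e i = e j"
| "sat A R e (Neg \<phi>) \<longleftrightarrow> \<not> sat A R e \<phi>"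
| "sat A R e (Conj \<phi> \<psi>) \<longleftrightarrow> sat A R e \<phi> \<and> sat A R e \<psi>"
| "sat A R e (All \<phi>) \<longleftrightarrow> (\<forall>x\<in>A. sat A R (case_nat x e) \<phi>)"

text \<open>\<open>c = {a, b}\<close>, \<open>c = \<langle>a, b\<rangle>\<close> (Kuratowski), \<open>\<langle>a, b\<rangle> \<in> r\<close>, \<open>f : a \<rightarrow> b\<close>, and
  \<open>f : a \<rightarrow> b\<close> is a bijection.\<close>

definition Upair_fm :: "nat \<Rightarrow> nat \<Rightarrow> nat \<Rightarrow> fm" where
  "Upair_fm a b c = All (Mem 0 (c + 1) \<^bold>\<longleftrightarrow> (Eq 0 (a + 1) \<^bold>\<or> Eq 0 (b + 1)))"

definition Pair_fm :: "nat \<Rightarrow> nat \<Rightarrow> nat \<Rightarrow> fm" where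
  "Pair_fm a b c = Ex (Ex (Upair_fm (a + 2) (a + 2) 1 \<^bold>\<and> Upair_fm (a + 2) (b + 2) 0 \<^bold>\<and>
     Upair_fm 1 0 (c + 2)))"

definition Rel_fm :: "nat \<Rightarrow> nat \<Rightarrow> nat \<Rightarrow> fm" where
  "Rel_fm a b r = BEx r (Pair_fm (a + 1) (b + 1) 0)"

definition Fun_fm :: "nat \<Rightarrow> nat \<Rightarrow> nat \<Rightarrow> fm" where
  "Fun_fm f a b =
     (BAll f (BEx (a + 1) (BEx (b + 2) (Pair_fm 1 0 2))) \<^bold>\<and>
      BAll a (Ex (Rel_fm 1 0 (f + 2) \<^bold>\<and> All (Rel_fm 2 0 (f + 3) \<^bold>\<longrightarrow> Eq 0 1))))"

definition Bij_fm :: "nat \<Rightarrow> nat \<Rightarrow> nat \<Rightarrow> fm" where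
  "Bij_fm f a b =
     (Fun_fm f a b \<^bold>\<and>
      BAll b (Ex (Rel_fm 0 1 (f + 2) \<^bold>\<and> All (Rel_fm 0 2 (f + 3) \<^bold>\<longrightarrow> Eq 0 1))))"

text \<open>Ordinals are the transitive sets of transitive sets, cardinals are the initial ordinals,
  and an ordinal is infinite if some nonzero limit ordinal is less than or equal to it.\<close>

definition Trans_fm :: "nat \<Rightarrow> fm" where
  "Trans_fm a = BAll a (BAll 0 (Mem 0 (a + 2)))"

definition Ord_fm :: "nat \<Rightarrow> fm" where
  "Ord_fm a = (Trans_fm a \<^bold>\<and> BAll a (Trans_fm 0))"

definition Limit_fm :: "nat \<Rightarrow> fm" where
  "Limit_fm a = (Ord_fm a \<^bold>\<and> Ex (Mem 0 (a + 1)) \<^bold>\<and> BAll a (BEx (a + 1) (Mem 1 0)))"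

definition InfCard_fm :: "nat \<Rightarrow> fm" where
  "InfCard_fm k =
     (Ord_fm k \<^bold>\<and> BAll k (Neg (Ex (Bij_fm 0 1 (k + 2)))) \<^bold>\<and>
      Ex (Limit_fm 0 \<^bold>\<and> (Mem 0 (k + 1) \<^bold>\<or> Eq 0 (k + 1))))"

text \<open>\<open>(T, r)\<close> is a tree: \<open>r\<close> is a strict partial order on \<open>T\<close>, and the set of predecessors of
  each element is well-ordered by \<open>r\<close> (linearly ordered, and each nonempty subset of it has a
  minimal element).\<close>

definition Tree_fm :: "nat \<Rightarrow> nat \<Rightarrow> fm" where
  "Tree_fm T r =
     (BAll T (Neg (Rel_fm 0 0 (r + 1))) \<^bold>\<and>
      BAll T (BAll (T + 1) (BAll (T + 2)
        (Rel_fm 2 1 (r + 3) \<^bold>\<and> Rel_fm 1 0 (r + 3) \<^bold>\<longrightarrow> Rel_fm 2 0 (r + 3)))) \<^bold>\<and>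
      BAll T (BAll (T + 1) (BAll (T + 2)
        (Rel_fm 1 2 (r + 3) \<^bold>\<and> Rel_fm 0 2 (r + 3) \<^bold>\<longrightarrow>
         Rel_fm 1 0 (r + 3) \<^bold>\<or> Eq 1 0 \<^bold>\<or> Rel_fm 0 1 (r + 3)))) \<^bold>\<and>
      BAll T (All
        (Ex (Mem 0 1) \<^bold>\<and> BAll 0 (Mem 0 (T + 3) \<^bold>\<and> Rel_fm 0 2 (r + 3)) \<^bold>\<longrightarrow>
         BEx 0 (BAll 1 (Neg (Rel_fm 0 1 (r + 4)))))))"

text \<open>A chain in a tree is well-ordered, so it is given by its increasing enumeration: \<open>f\<close> is a
  chain of length (order type) \<open>a\<close>.\<close>

definition Chain_fm :: "nat \<Rightarrow> nat \<Rightarrow> nat \<Rightarrow> nat \<Rightarrow> fm" where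
  "Chain_fm f a T r =
     (Fun_fm f a T \<^bold>\<and>
      BAll a (BAll 0 (All (All
        (Rel_fm 2 1 (f + 4) \<^bold>\<and> Rel_fm 3 0 (f + 4) \<^bold>\<longrightarrow> Rel_fm 1 0 (r + 4))))))"

text \<open>Every chain in \<open>(T, r)\<close> of length less than \<open>k\<close> has an upper bound.\<close>

definition Closed_fm :: "nat \<Rightarrow> nat \<Rightarrow> nat \<Rightarrow> fm" where
  "Closed_fm k T r =
     BAll k (All (Chain_fm 0 1 (T + 2) (r + 2) \<^bold>\<longrightarrow>
       BEx (T + 2) (All (All (Rel_fm 1 0 3 \<^bold>\<longrightarrow> Eq 0 2 \<^bold>\<or> Rel_fm 0 2 (r + 5))))))"

definition DC_fm :: "nat \<Rightarrow> fm" where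
  "DC_fm k =
     All (All (Tree_fm 1 0 \<^bold>\<and> Closed_fm (k + 2) 1 0 \<^bold>\<longrightarrow>
       Ex (Chain_fm 0 (k + 3) 2 1) \<^bold>\<or> BEx 1 (BAll 2 (Neg (Rel_fm 1 0 2)))))"

definition DC_less_fm :: "nat \<Rightarrow> fm" where
  "DC_less_fm l = BAll l (InfCard_fm 0 \<^bold>\<longrightarrow> DC_fm 0)"


section \<open>Models of ZFC\<close>

text \<open>The universe \<open>V\<close> is an arbitrary first-order model of ZFC: the type \<open>'v\<close> with the relation
  \<open>\<in>\<^sub>V\<close>, which need be neither well-founded nor countable. Separation and replacement are the
  first-order schemes with parameters.\<close>

locale set_universe =
  fixes mem :: "'v \<Rightarrow> 'v \<Rightarrow> bool" (infix "\<in>\<^sub>V" 50)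
begin

definition ZFC :: bool where
  "ZFC \<longleftrightarrow>
    \<comment> \<open>extensionality\<close>
    (\<forall>a b. (\<forall>x. x \<in>\<^sub>V a \<longleftrightarrow> x \<in>\<^sub>V b) \<longrightarrow> a = b) \<and>
    \<comment> \<open>foundation\<close>
    (\<forall>a. (\<exists>x. x \<in>\<^sub>V a) \<longrightarrow> (\<exists>x. x \<in>\<^sub>V a \<and> \<not> (\<exists>y. y \<in>\<^sub>V x \<and> y \<in>\<^sub>V a))) \<and>
    \<comment> \<open>pairing\<close>
    (\<forall>a b. \<exists>c. \<forall>x. x \<in>\<^sub>V c \<longleftrightarrow> x = a \<or> x = b) \<and>
    \<comment> \<open>union\<close>
    (\<forall>a. \<exists>b. \<forall>x. x \<in>\<^sub>V b \<longleftrightarrow> (\<exists>y. y \<in>\<^sub>V a \<and> x \<in>\<^sub>V y)) \<and>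
    \<comment> \<open>power set\<close>
    (\<forall>a. \<exists>b. \<forall>x. x \<in>\<^sub>V b \<longleftrightarrow> (\<forall>y. y \<in>\<^sub>V x \<longrightarrow> y \<in>\<^sub>V a)) \<and>
    \<comment> \<open>infinity\<close>
    (\<exists>a. (\<exists>z. z \<in>\<^sub>V a \<and> (\<forall>x. \<not> x \<in>\<^sub>V z)) \<and>
       (\<forall>x. x \<in>\<^sub>V a \<longrightarrow> (\<exists>y. y \<in>\<^sub>V a \<and> (\<forall>z. z \<in>\<^sub>V y \<longleftrightarrow> z \<in>\<^sub>V x \<or> z = x)))) \<and>
    \<comment> \<open>separation\<close>
    (\<forall>\<phi> e a. \<exists>b. \<forall>x. x \<in>\<^sub>V b \<longleftrightarrow> x \<in>\<^sub>V a \<and> sat UNIV (\<in>\<^sub>V) (case_nat x e) \<phi>) \<and>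
    \<comment> \<open>replacement\<close>
    (\<forall>\<phi> e a. (\<forall>x. x \<in>\<^sub>V a \<longrightarrow> (\<exists>!y. sat UNIV (\<in>\<^sub>V) (case_nat y (case_nat x e)) \<phi>)) \<longrightarrow>
       (\<exists>b. \<forall>y. y \<in>\<^sub>V b \<longleftrightarrow> (\<exists>x. x \<in>\<^sub>V a \<and> sat UNIV (\<in>\<^sub>V) (case_nat y (case_nat x e)) \<phi>))) \<and>
    \<comment> \<open>choice\<close>
    (\<forall>a. (\<forall>x. x \<in>\<^sub>V a \<longrightarrow> (\<exists>y. y \<in>\<^sub>V x)) \<and>
       (\<forall>x y z. x \<in>\<^sub>V a \<and> y \<in>\<^sub>V a \<and> z \<in>\<^sub>V x \<and> z \<in>\<^sub>V y \<longrightarrow> x = y) \<longrightarrow>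
       (\<exists>c. \<forall>x. x \<in>\<^sub>V a \<longrightarrow> (\<exists>!y. y \<in>\<^sub>V x \<and> y \<in>\<^sub>V c)))"

definition elts :: "'v \<Rightarrow> 'v set" where
  "elts a = {x. x \<in>\<^sub>V a}"

definition upair :: "'v \<Rightarrow> 'v \<Rightarrow> 'v" where
  "upair a b = (THE c. elts c = {a, b})"

definition opair :: "'v \<Rightarrow> 'v \<Rightarrow> 'v" ("\<langle>_,/ _\<rangle>") where
  "\<langle>a, b\<rangle> = upair (upair a a) (upair a b)"

definition fun_on :: "'v \<Rightarrow> 'v \<Rightarrow> bool" where
  "fun_on f a \<longleftrightarrow> (\<forall>z\<in>elts f. \<exists>x\<in>elts a. \<exists>y. z = \<langle>x, y\<rangle>) \<and> (\<forall>x\<in>elts a. \<exists>!y. \<langle>x, y\<rangle> \<in>\<^sub>V f)"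

definition app :: "'v \<Rightarrow> 'v \<Rightarrow> 'v" where
  "app f x = (THE y. \<langle>x, y\<rangle> \<in>\<^sub>V f)"

definition bijection :: "'v \<Rightarrow> 'v \<Rightarrow> 'v \<Rightarrow> bool" where
  "bijection f a b \<longleftrightarrow> fun_on f a \<and> bij_betw (app f) (elts a) (elts b)"

definition infinite_cardinal :: "'v \<Rightarrow> bool" where
  "infinite_cardinal k \<longleftrightarrow> sat UNIV (\<in>\<^sub>V) (\<lambda>_. k) (InfCard_fm 0)"

text \<open>\<open>|a| < k\<close> for a cardinal \<open>k\<close>, all notions being those of the model.\<close>
definition card_less :: "'v \<Rightarrow> 'v \<Rightarrow> bool" where
  "card_less a k \<longleftrightarrow> (\<exists>b\<in>elts k. \<exists>f. bijection f a b)"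

end


section \<open>Symmetric systems\<close>

locale forcing_data = set_universe mem for mem :: "'v \<Rightarrow> 'v \<Rightarrow> bool" (infix "\<in>\<^sub>V" 50) +
  fixes P le Gr Fl :: 'v
    \<comment> \<open>the set of conditions, its order (a set of pairs), the group, and the filter\<close>
begin

definition leq :: "'v \<Rightarrow> 'v \<Rightarrow> bool" (infix "\<preceq>" 50) where
  "p \<preceq> q \<longleftrightarrow> \<langle>p, q\<rangle> \<in>\<^sub>V le"

definition forcing_notion :: bool where
  "forcing_notion \<longleftrightarrow> elts P \<noteq> {} \<and>
     (\<forall>p\<in>elts P. p \<preceq> p) \<and>
     (\<forall>p\<in>elts P. \<forall>q\<in>elts P. \<forall>r\<in>elts P. p \<preceq> q \<and> q \<preceq> r \<longrightarrow> p \<preceq> r)"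

definition compatible :: "'v \<Rightarrow> 'v \<Rightarrow> bool" where
  "compatible p q \<longleftrightarrow> (\<exists>r\<in>elts P. r \<preceq> p \<and> r \<preceq> q)"

definition antichain :: "'v \<Rightarrow> bool" where
  "antichain A \<longleftrightarrow> elts A \<subseteq> elts P \<and>
     (\<forall>p\<in>elts A. \<forall>q\<in>elts A. p \<noteq> q \<longrightarrow> \<not> compatible p q)"

definition chain_condition :: "'v \<Rightarrow> bool" where
  "chain_condition k \<longleftrightarrow> (\<forall>A. antichain A \<longrightarrow> card_less A k)"

definition automorphism :: "'v \<Rightarrow> bool" where
  "automorphism \<pi> \<longleftrightarrow> bijection \<pi> P P \<and>
     (\<forall>p\<in>elts P. \<forall>q\<in>elts P. app \<pi> p \<preceq> app \<pi> q \<longleftrightarrow> p \<preceq> q)"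

text \<open>The permutation of the conditions given by an automorphism; composition and inverses of
  automorphisms are those of the group of permutations.\<close>

definition perm :: "'v \<Rightarrow> 'v \<Rightarrow> 'v" where
  "perm \<pi> = restrict (app \<pi>) (elts P)"

definition automorphism_group :: "'v \<Rightarrow> bool" where
  "automorphism_group H \<longleftrightarrow> (\<forall>\<pi>\<in>elts H. automorphism \<pi>) \<and>
     subgroup (perm ` elts H) (BijGroup (elts P))"

definition subgrp :: "'v \<Rightarrow> bool" where
  "subgrp H \<longleftrightarrow> elts H \<subseteq> elts Gr \<and> automorphism_group H"

text \<open>\<open>K = \<pi> H \<pi>\<inverse>\<close>\<close>
definition conjugate :: "'v \<Rightarrow> 'v \<Rightarrow> 'v \<Rightarrow> bool" where
  "conjugate \<pi> H K \<longleftrightarrow> perm ` elts K =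
     (\<lambda>\<sigma>. perm \<pi> \<otimes>\<^bsub>BijGroup (elts P)\<^esub> perm \<sigma> \<otimes>\<^bsub>BijGroup (elts P)\<^esub> inv\<^bsub>BijGroup (elts P)\<^esub> perm \<pi>) ` elts H"

text \<open>Properness of the filter is not required.\<close>
definition normal_filter :: bool where
  "normal_filter \<longleftrightarrow> Gr \<in>\<^sub>V Fl \<and> (\<forall>H\<in>elts Fl. subgrp H) \<and>
     (\<forall>H\<in>elts Fl. \<forall>K. subgrp K \<and> elts H \<subseteq> elts K \<longrightarrow> K \<in>\<^sub>V Fl) \<and>
     (\<forall>H\<in>elts Fl. \<forall>K\<in>elts Fl. \<exists>L\<in>elts Fl. elts L = elts H \<inter> elts K) \<and>
     (\<forall>\<pi>\<in>elts Gr. \<forall>H\<in>elts Fl. \<exists>K\<in>elts Fl. conjugate \<pi> H K)"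

definition symmetric_system :: bool where
  "symmetric_system \<longleftrightarrow> forcing_notion \<and> automorphism_group Gr \<and> normal_filter"

definition complete_filter :: "'v \<Rightarrow> bool" where
  "complete_filter k \<longleftrightarrow> (\<forall>X. elts X \<noteq> {} \<and> elts X \<subseteq> elts Fl \<and> card_less X k \<longrightarrow>
     (\<exists>L\<in>elts Fl. elts L = (\<Inter>H\<in>elts X. elts H)))"


section \<open>Hereditarily symmetric names\<close>

text \<open>Since \<open>\<in>\<^sub>V\<close> may be ill-founded, recursion on names cannot be recursion in HOL. Each recursive
  notion is instead given, inside the model, by a set solving the recursion on a set of names that
  is closed under appearing; the model's axiom of foundation makes the solution unique.\<close>

definition name_closed :: "'v \<Rightarrow> bool" where
  "name_closed N \<longleftrightarrow> (\<forall>x\<in>elts N. \<forall>z\<in>elts x. \<exists>p\<in>elts P. \<exists>y\<in>elts N. z = \<langle>p, y\<rangle>)"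

definition name :: "'v \<Rightarrow> bool" where
  "name x \<longleftrightarrow> (\<exists>N. name_closed N \<and> x \<in>\<^sub>V N)"

text \<open>\<open>\<pi> x = {\<langle>\<pi> p, \<pi> y\<rangle> | \<langle>p, y\<rangle> \<in> x}\<close>\<close>
definition act :: "'v \<Rightarrow> 'v \<Rightarrow> 'v" where
  "act \<pi> x = (THE x'. \<exists>N f. name_closed N \<and> x \<in>\<^sub>V N \<and> fun_on f N \<and>
     (\<forall>y\<in>elts N. elts (app f y) = {\<langle>app \<pi> p, app f z\<rangle> | p z. \<langle>p, z\<rangle> \<in>\<^sub>V y}) \<and>
     x' = app f x)"

definition symmetric :: "'v \<Rightarrow> bool" where
  "symmetric x \<longleftrightarrow> (\<exists>H\<in>elts Fl. elts H = {\<pi> \<in> elts Gr. act \<pi> x = x})"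

definition HS :: "'v set" where
  "HS = {x. \<exists>N. name_closed N \<and> x \<in>\<^sub>V N \<and> (\<forall>y\<in>elts N. symmetric y)}"

text \<open>The canonical name \<open>{\<langle>p, check y\<rangle> | p \<in> P, y \<in> x}\<close> of \<open>x\<close>; no maximum of \<open>P\<close> is assumed.\<close>
definition check :: "'v \<Rightarrow> 'v" where
  "check x = (THE x'. \<exists>t f. (\<forall>y\<in>elts t. elts y \<subseteq> elts t) \<and> x \<in>\<^sub>V t \<and> fun_on f t \<and>
     (\<forall>y\<in>elts t. elts (app f y) = {\<langle>p, app f z\<rangle> | p z. p \<in>\<^sub>V P \<and> z \<in>\<^sub>V y}) \<and>
     x' = app f x)"


section \<open>The symmetric forcing relation\<close>

text \<open>The recursion for \<open>p \<tturnstile> x = y\<close>: below \<open>p\<close>, for each \<open>\<langle>r, z\<rangle> \<in> x\<close> it is dense below \<open>r\<close> that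
  \<open>z\<close> is forced equal to some \<open>w\<close> with \<open>\<langle>t, w\<rangle> \<in> y\<close> for a \<open>t\<close> above the condition, and vice versa.\<close>

definition dense_below :: "'v \<Rightarrow> 'v set \<Rightarrow> bool" where
  "dense_below p D \<longleftrightarrow> (\<forall>q\<in>elts P. q \<preceq> p \<longrightarrow> (\<exists>s\<in>elts P. s \<preceq> q \<and> s \<in> D))"

definition forces_mem_by :: "('v \<Rightarrow> 'v \<Rightarrow> 'v \<Rightarrow> bool) \<Rightarrow> 'v \<Rightarrow> 'v \<Rightarrow> 'v \<Rightarrow> bool" where
  "forces_mem_by E p x y \<longleftrightarrow> dense_below p {s. \<exists>t w. \<langle>t, w\<rangle> \<in>\<^sub>V y \<and> s \<preceq> t \<and> E s x w}"

definition forces_sub_by :: "('v \<Rightarrow> 'v \<Rightarrow> 'v \<Rightarrow> bool) \<Rightarrow> 'v \<Rightarrow> 'v \<Rightarrow> 'v \<Rightarrow> bool" where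
  "forces_sub_by E p x y \<longleftrightarrow>
     (\<forall>r z. \<langle>r, z\<rangle> \<in>\<^sub>V x \<longrightarrow> (\<forall>q\<in>elts P. q \<preceq> p \<and> q \<preceq> r \<longrightarrow> forces_mem_by E q z y))"

definition forces_eq :: "'v \<Rightarrow> 'v \<Rightarrow> 'v \<Rightarrow> bool" where
  "forces_eq p x y \<longleftrightarrow> (\<exists>N F. name_closed N \<and> x \<in>\<^sub>V N \<and> y \<in>\<^sub>V N \<and>
     (let E = (\<lambda>q u v. \<langle>q, \<langle>u, v\<rangle>\<rangle> \<in>\<^sub>V F) in
       (\<forall>q\<in>elts P. \<forall>u\<in>elts N. \<forall>v\<in>elts N.
          E q u v \<longleftrightarrow> forces_sub_by E q u v \<and> forces_sub_by E q v u) \<and>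
       E p x y))"

text \<open>The forcing relation with quantifiers relativized to the hereditarily symmetric names.\<close>

primrec forces_HS :: "'v \<Rightarrow> (nat \<Rightarrow> 'v) \<Rightarrow> fm \<Rightarrow> bool" where
  "forces_HS p e (Mem i j) \<longleftrightarrow> forces_mem_by forces_eq p (e i) (e j)"
| "forces_HS p e (Eq i j) \<longleftrightarrow> forces_eq p (e i) (e j)"
| "forces_HS p e (Neg \<phi>) \<longleftrightarrow> (\<forall>q\<in>elts P. q \<preceq> p \<longrightarrow> \<not> forces_HS q e \<phi>)"
| "forces_HS p e (Conj \<phi> \<psi>) \<longleftrightarrow> forces_HS p e \<phi> \<and> forces_HS p e \<psi>"
| "forces_HS p e (All \<phi>) \<longleftrightarrow> (\<forall>x\<in>HS. forces_HS p (case_nat x e) \<phi>)"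

definition forced_HS :: "(nat \<Rightarrow> 'v) \<Rightarrow> fm \<Rightarrow> bool" where
  "forced_HS e \<phi> \<longleftrightarrow> (\<forall>p\<in>elts P. forces_HS p e \<phi>)"


section \<open>Symmetric extensions\<close>

definition dense :: "'v \<Rightarrow> bool" where
  "dense D \<longleftrightarrow> elts D \<subseteq> elts P \<and> (\<forall>p\<in>elts P. \<exists>d\<in>elts D. d \<preceq> p)"

definition generic :: "'v set \<Rightarrow> bool" where
  "generic G \<longleftrightarrow> G \<subseteq> elts P \<and> G \<noteq> {} \<and>
     (\<forall>p\<in>G. \<forall>q\<in>elts P. p \<preceq> q \<longrightarrow> q \<in> G) \<and>
     (\<forall>p\<in>G. \<forall>q\<in>G. \<exists>r\<in>G. r \<preceq> p \<and> r \<preceq> q) \<and>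
     (\<forall>D. dense D \<longrightarrow> G \<inter> elts D \<noteq> {})"

text \<open>\<open>val\<close> is the interpretation \<open>x\<^sup>G = {y\<^sup>G | \<exists>p \<in> G. \<langle>p, y\<rangle> \<in> x}\<close> of the names by \<open>G\<close>, with values
  in an extensional structure with membership relation \<open>R\<close>. If \<open>\<in>\<^sub>V\<close> is well-founded, it is unique
  up to isomorphism.\<close>

definition interpretation_by :: "'v set \<Rightarrow> ('w \<Rightarrow> 'w \<Rightarrow> bool) \<Rightarrow> ('v \<Rightarrow> 'w) \<Rightarrow> bool" where
  "interpretation_by G R val \<longleftrightarrow>
     (\<forall>x. name x \<longrightarrow> {a. R a (val x)} = {val y | y. \<exists>p\<in>G. \<langle>p, y\<rangle> \<in>\<^sub>V x}) \<and>
     (\<forall>x y. name x \<and> name y \<and> {a. R a (val x)} = {a. R a (val y)} \<longrightarrow> val x = val y)"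

end

end

theory Submission
  imports Defs
begin

text \<open>Let \<open>\<alpha> < \<lambda>\<close>, and let a condition \<open>p\<close> force that \<open>(T, r)\<close> is an \<open>\<alpha>\<close>-closed tree without
  maximal elements, where \<open>T\<close> and \<open>r\<close> are hereditarily symmetric names. In the ground model,
  hereditarily symmetric names \<open>x i\<close> for \<open>i < \<alpha>\<close> are constructed by recursion so that \<open>p\<close> forces them to
  be a strictly increasing sequence in \<open>T\<close> (\<open>forces_chain\<close>). Two facts keep the construction inside
  the symmetric extension.

  First, a sequence of fewer than \<open>\<lambda>\<close> hereditarily symmetric names that lies in the ground model has a
  hereditarily symmetric name, since \<open>\<lambda>\<close>-completeness provides one group in the filter that fixes all
  of its entries (\<open>family_support\<close>, \<open>seq_name_HS\<close>). So the closure of the tree applies to the initial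
  segments of the construction and yields that \<open>p\<close> forces the existence of a next element
  (\<open>extend_chain\<close>).

  Second, this existence statement has one witnessing hereditarily symmetric name (\<open>fullness\<close>). The
  usual mixture of names along an antichain of conditions is not symmetric, because no group in the
  filter need fix a condition. What a group in the filter does fix is the truth value of a statement
  about hereditarily symmetric names, that is, the open set of the conditions forcing it. By the chain
  condition fewer than \<open>\<lambda>\<close> such truth values suffice to cover the given one
  (\<open>maximal_antichain\<close>), and the names are mixed along their successive differences.

  The universe is an arbitrary model of ZFC whose axiom schemes speak of first-order formulas. Each set
  formed below therefore needs a proof that its defining property is definable, and each recursion
  along ordinals or names is one inside the model (\<open>recursion\<close>). For the symmetric extension given by
  a generic filter, the statement follows from the forcing relation by the truth lemma
  (\<open>truth\<close>).\<close>


section \<open>Definability over the model\<close>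

text \<open>De Bruijn formulas have to be renamed when the free variables of two formulas are
  merged, and when a free variable becomes a bound one.\<close>

primrec rename_fm :: "(nat \<Rightarrow> nat) \<Rightarrow> fm \<Rightarrow> fm" where
  "rename_fm \<rho> (Mem i j) = Mem (\<rho> i) (\<rho> j)"
| "rename_fm \<rho> (Eq i j) = Eq (\<rho> i) (\<rho> j)"
| "rename_fm \<rho> (Neg \<phi>) = Neg (rename_fm \<rho> \<phi>)"
| "rename_fm \<rho> (Conj \<phi> \<psi>) = Conj (rename_fm \<rho> \<phi>) (rename_fm \<rho> \<psi>)"
| "rename_fm \<rho> (All \<phi>) = All (rename_fm (case_nat 0 (\<lambda>i. Suc (\<rho> i))) \<phi>)"

lemma sat_rename_fm: "sat A R e (rename_fm \<rho> \<phi>) \<longleftrightarrow> sat A R (\<lambda>i. e (\<rho> i)) \<phi>"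
proof (induction \<phi> arbitrary: e \<rho>)
  case (All \<phi>)
  have "(\<lambda>i. case_nat x e (case_nat 0 (\<lambda>i. Suc (\<rho> i)) i)) = case_nat x (\<lambda>i. e (\<rho> i))" for x
    by (auto split: nat.split)
  then show ?case using All by simp
qed auto

named_theorems dfn

context set_universe
begin

text \<open>The axiom schemes speak of formulas, but formulas are never written down below: a property
  of an environment is definable if it is given by some formula in which every free variable is either
  a variable of the environment or a constant of the universe. The closure properties collected
  in \<open>dfn\<close> then prove definability by following the shape of the HOL term.\<close>

definition definable :: "((nat \<Rightarrow> 'v) \<Rightarrow> bool) \<Rightarrow> bool" where
  "definable Q \<longleftrightarrow> (\<exists>\<phi> \<sigma>. \<forall>e. Q e \<longleftrightarrow> sat UNIV (\<in>\<^sub>V) (\<lambda>i. case_sum e id (\<sigma> i)) \<phi>)"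

definition definable_term :: "((nat \<Rightarrow> 'v) \<Rightarrow> 'v) \<Rightarrow> bool" where
  "definable_term t \<longleftrightarrow> definable (\<lambda>e. e 0 = t (\<lambda>i. e (Suc i)))"

abbreviation (input) "definable1 Q \<equiv> definable (\<lambda>e. Q (e 0))"
abbreviation (input) "definable2 Q \<equiv> definable (\<lambda>e. Q (e 0) (e 1))"
abbreviation (input) "definable3 Q \<equiv> definable (\<lambda>e. Q (e 0) (e 1) (e 2))"
abbreviation (input) "definable_fun1 f \<equiv> definable_term (\<lambda>e. f (e 0))"
abbreviation (input) "definable_fun2 f \<equiv> definable_term (\<lambda>e. f (e 0) (e 1))"

lemma definableI: "(\<And>e. Q e \<longleftrightarrow> sat UNIV (\<in>\<^sub>V) (\<lambda>i. case_sum e id (\<sigma> i)) \<phi>) \<Longrightarrow> definable Q"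
  unfolding definable_def by blast

lemma definable_subst_vars:
  assumes "definable Q" shows "definable (\<lambda>e. Q (\<lambda>i. case_sum e id (\<tau> i)))"
proof -
  obtain \<phi> \<sigma> where *: "\<And>e. Q e \<longleftrightarrow> sat UNIV (\<in>\<^sub>V) (\<lambda>i. case_sum e id (\<sigma> i)) \<phi>"
    using assms unfolding definable_def by blast
  have "(\<lambda>i. case_sum (\<lambda>i. case_sum e id (\<tau> i)) id (\<sigma> i)) =
     (\<lambda>i. case_sum e id (case_sum \<tau> Inr (\<sigma> i)))" for e :: "nat \<Rightarrow> 'v"
    by (auto split: sum.split)
  then show ?thesis by (intro definableI[of _ "\<lambda>i. case_sum \<tau> Inr (\<sigma> i)" \<phi>]) (simp add: *)
qed

lemma definable_rename: "definable Q \<Longrightarrow> definable (\<lambda>e. Q (\<lambda>i. e (\<rho> i)))"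
  using definable_subst_vars[of Q "\<lambda>i. Inl (\<rho> i)"] by simp

lemma definable_mem_vars: "definable (\<lambda>e. e i \<in>\<^sub>V e j)"
  by (rule definableI[of _ "case_nat (Inl i) (\<lambda>_. Inl j)" "Mem 0 1"]) simp

lemma definable_eq_vars: "definable (\<lambda>e. e i = e j)"
  by (rule definableI[of _ "case_nat (Inl i) (\<lambda>_. Inl j)" "Eq 0 1"]) simp

lemma definable_eq_const: "definable (\<lambda>e. e i = c)"
  by (rule definableI[of _ "case_nat (Inl i) (\<lambda>_. Inr c)" "Eq 0 1"]) simp

lemma definable_True: "definable (\<lambda>e. True)"
  by (rule definableI[of _ "\<lambda>_. Inl 0" "Eq 0 0"]) simp

lemma definable_not [dfn]: "definable Q \<Longrightarrow> definable (\<lambda>e. \<not> Q e)"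
  unfolding definable_def by (metis sat.simps(3))

lemma definable_conj [dfn]:
  assumes "definable Q" "definable Q'" shows "definable (\<lambda>e. Q e \<and> Q' e)"
proof -
  obtain \<phi> \<sigma> where 1: "\<And>e. Q e \<longleftrightarrow> sat UNIV (\<in>\<^sub>V) (\<lambda>i. case_sum e id (\<sigma> i)) \<phi>"
    using assms unfolding definable_def by blast
  obtain \<phi>' \<sigma>' where 2: "\<And>e. Q' e \<longleftrightarrow> sat UNIV (\<in>\<^sub>V) (\<lambda>i. case_sum e id (\<sigma>' i)) \<phi>'"
    using assms unfolding definable_def by blast
  show ?thesis
    \<comment> \<open>the two assignments of the free variables are interleaved\<close>
    by (rule definableI[of _ "\<lambda>i. if even i then \<sigma> (i div 2) else \<sigma>' (i div 2)"
          "Conj (rename_fm (\<lambda>i. 2 * i) \<phi>) (rename_fm (\<lambda>i. 2 * i + 1) \<phi>')"])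
       (simp add: 1 2 sat_rename_fm)
qed

lemma definable_all [dfn]:
  assumes "definable (\<lambda>e. Q (e 0) (\<lambda>i. e (Suc i)))" shows "definable (\<lambda>e. \<forall>x. Q x e)"
proof -
  obtain \<phi> \<sigma> where
    1: "\<And>e. Q (e 0) (\<lambda>i. e (Suc i)) \<longleftrightarrow> sat UNIV (\<in>\<^sub>V) (\<lambda>i. case_sum e id (\<sigma> i)) \<phi>"
    using assms unfolding definable_def by blast
  \<comment> \<open>All the free variables of the formula that stand for \<open>e 0\<close> become the bound variable.\<close>
  define \<rho> where "\<rho> = (\<lambda>i. if \<sigma> i = Inl 0 then 0 else Suc i)"
  define \<sigma>' where "\<sigma>' = (\<lambda>i. case \<sigma> i of Inl j \<Rightarrow> Inl (j - 1) | Inr c \<Rightarrow> Inr c)"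
  have "(\<lambda>i. case_nat x (\<lambda>i. case_sum e id (\<sigma>' i)) (\<rho> i)) =
      (\<lambda>i. case_sum (case_nat x e) id (\<sigma> i))" for x and e :: "nat \<Rightarrow> 'v"
    by (rule ext) (auto simp: \<rho>_def \<sigma>'_def split: sum.split nat.split)
  moreover have "Q x e \<longleftrightarrow> sat UNIV (\<in>\<^sub>V) (\<lambda>i. case_sum (case_nat x e) id (\<sigma> i)) \<phi>" for x e
    using 1[of "case_nat x e"] by simp
  ultimately show ?thesis
    by (intro definableI[of _ \<sigma>' "All (rename_fm \<rho> \<phi>)"]) (simp add: sat_rename_fm)
qed

lemma definable_const [dfn]: "definable (\<lambda>e. b)"
  using definable_True definable_not[OF definable_True] by (cases b) auto

lemma definable_disj [dfn]:
  assumes "definable Q" "definable Q'" shows "definable (\<lambda>e. Q e \<or> Q' e)"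
proof -
  have "definable (\<lambda>e. \<not> (\<not> Q e \<and> \<not> Q' e))" by (intro dfn assms)
  then show ?thesis by simp
qed

lemma definable_imp [dfn]:
  assumes "definable Q" "definable Q'" shows "definable (\<lambda>e. Q e \<longrightarrow> Q' e)"
proof -
  have "definable (\<lambda>e. \<not> (Q e \<and> \<not> Q' e))" by (intro dfn assms)
  then show ?thesis by simp
qed

lemma definable_iff [dfn]:
  assumes "definable Q" "definable Q'" shows "definable (\<lambda>e. Q e \<longleftrightarrow> Q' e)"
proof -
  have "definable (\<lambda>e. (Q e \<longrightarrow> Q' e) \<and> (Q' e \<longrightarrow> Q e))" by (intro dfn assms)
  then show ?thesis by (simp add: iff_conv_conj_imp)
qed

lemma definable_ex [dfn]:
  assumes "definable (\<lambda>e. Q (e 0) (\<lambda>i. e (Suc i)))" shows "definable (\<lambda>e. \<exists>x. Q x e)"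
proof -
  have "definable (\<lambda>e. \<not> (\<forall>x. \<not> Q x e))" by (intro dfn assms)
  then show ?thesis by simp
qed

lemma definable_term_var [dfn]: "definable_term (\<lambda>e. e i)"
  unfolding definable_term_def by (rule definable_eq_vars)

lemma definable_term_const [dfn]: "definable_term (\<lambda>e. c)"
  unfolding definable_term_def by (rule definable_eq_const)

lemma definable_term_rename: "definable_term t \<Longrightarrow> definable_term (\<lambda>e. t (\<lambda>i. e (\<rho> i)))"
  unfolding definable_term_def
  by (drule definable_rename[of _ "case_nat 0 (\<lambda>i. Suc (\<rho> i))"]) simp

lemma definable_subst:
  assumes "definable (\<lambda>e. Q (e 0) (\<lambda>i. e (Suc i)))" "definable_term s"
  shows "definable (\<lambda>e. Q (s e) e)"
proof -
  have "definable (\<lambda>e. \<exists>x. x = s e \<and> Q x e)"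
    by (intro dfn assms(1) assms(2)[unfolded definable_term_def])
  then show ?thesis by simp
qed

text \<open>The variables are replaced one at a time. While variable \<open>n\<close> waits to be replaced it is
  variable 0 of the environment, so the terms for the earlier variables are shifted then, and the
  induction generalizes over the terms.\<close>

lemma definable_subst_terms:
  assumes "definable Q" "\<And>i. definable_term (t i)"
  shows "definable (\<lambda>e. Q (\<lambda>i. if i < n then t i e else e (i - n)))"
  using assms(2)
proof (induction n arbitrary: t)
  case 0
  then show ?case using assms(1) by simp
next
  case (Suc n)
  define Q' where "Q' x e = Q (\<lambda>i. if i < n then t i e else case_nat x e (i - n))" for x e
  have "definable (\<lambda>e. Q (\<lambda>i. if i < n then t i (\<lambda>i. e (Suc i)) else e (i - n)))"
    by (rule Suc.IH) (rule definable_term_rename[OF Suc.prems])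
  moreover have "case_nat (e 0) (\<lambda>i. e (Suc i)) k = e k" for e :: "nat \<Rightarrow> 'v" and k
    by (auto split: nat.split)
  ultimately have "definable (\<lambda>e. Q' (e 0) (\<lambda>i. e (Suc i)))" unfolding Q'_def by (simp cong: if_cong)
  then have "definable (\<lambda>e. Q' (t n e) e)" by (rule definable_subst) (rule Suc.prems)
  moreover have "(\<lambda>i. if i < n then t i e else case_nat (t n e) e (i - n)) =
      (\<lambda>i. if i < Suc n then t i e else e (i - Suc n))" for e
  proof (rule ext)
    fix i show "(if i < n then t i e else case_nat (t n e) e (i - n)) =
        (if i < Suc n then t i e else e (i - Suc n))"
      by (cases "n < i") (auto simp: less_Suc_eq dest!: less_imp_Suc_add)
  qed
  ultimately show ?case unfolding Q'_def by (simp only:)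
qed

lemma definable1_app:
  assumes "definable1 Q" "definable_term s" shows "definable (\<lambda>e. Q (s e))"
  using definable_subst[of "\<lambda>x e. Q x", OF assms] .

lemma definable2_app:
  assumes "definable2 Q" "definable_term s" "definable_term t" shows "definable (\<lambda>e. Q (s e) (t e))"
proof -
  have "definable (\<lambda>e. (\<lambda>e. Q (e 0) (e 1)) (\<lambda>i. if i < 2 then (if i = 0 then s else t) e else e (i - 2)))"
    by (rule definable_subst_terms[OF assms(1)]) (simp add: assms(2,3))
  then show ?thesis by simp
qed

lemma definable3_app:
  assumes "definable3 Q" "definable_term s" "definable_term t" "definable_term u"
  shows "definable (\<lambda>e. Q (s e) (t e) (u e))"
proof -
  have "definable (\<lambda>e. (\<lambda>e. Q (e 0) (e 1) (e 2)) (\<lambda>i. if i < 3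
      then (if i = 0 then s else if i = 1 then t else u) e else e (i - 3)))"
    by (rule definable_subst_terms[OF assms(1)]) (simp add: assms(2-))
  then show ?thesis by simp
qed

text \<open>Composition of terms. In \<open>definable_term\<close> variable 0 is the value, hence the renaming by \<open>Suc\<close>
  of the terms that are substituted.\<close>

lemma definable_fun1_app:
  assumes "definable_fun1 f" "definable_term s" shows "definable_term (\<lambda>e. f (s e))"
proof -
  have "definable2 (\<lambda>z x. z = f x)" using assms(1) unfolding definable_term_def One_nat_def .
  then show ?thesis unfolding definable_term_def
    by (rule definable2_app[OF _ definable_term_var[of 0] definable_term_rename[OF assms(2), of Suc]])
qed

lemma definable_fun2_app:
  assumes "definable_fun2 f" "definable_term s" "definable_term t"
  shows "definable_term (\<lambda>e. f (s e) (t e))"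
proof -
  have "definable3 (\<lambda>z x y. z = f x y)"
    using assms(1) unfolding definable_term_def One_nat_def numeral_2_eq_2 .
  then show ?thesis unfolding definable_term_def
    by (rule definable3_app[OF _ definable_term_var[of 0] definable_term_rename[OF assms(2), of Suc]
          definable_term_rename[OF assms(3), of Suc]])
qed

lemma definable_mem [dfn]:
  "definable_term s \<Longrightarrow> definable_term t \<Longrightarrow> definable (\<lambda>e. s e \<in>\<^sub>V t e)"
  by (rule definable2_app[of "(\<in>\<^sub>V)"]) (rule definable_mem_vars)

lemma definable_eq [dfn]:
  "definable_term s \<Longrightarrow> definable_term t \<Longrightarrow> definable (\<lambda>e. s e = t e)"
  by (rule definable2_app[of "(=)"]) (rule definable_eq_vars)

lemma definable_elts [dfn]:
  "definable_term s \<Longrightarrow> definable_term t \<Longrightarrow> definable (\<lambda>e. s e \<in> elts (t e))"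
  unfolding elts_def mem_Collect_eq by (rule definable_mem)

lemma definable_Collect [dfn]:
  "definable (\<lambda>e. Q (t e) e) \<Longrightarrow> definable (\<lambda>e. t e \<in> {x. Q x e})"
  by simp

lemma definable_ball [dfn]:
  assumes "definable (\<lambda>e. e 0 \<in> A (\<lambda>i. e (Suc i)))" "definable (\<lambda>e. Q (e 0) (\<lambda>i. e (Suc i)))"
  shows "definable (\<lambda>e. \<forall>x\<in>A e. Q x e)"
  unfolding Ball_def by (intro dfn assms)

lemma definable_bex [dfn]:
  assumes "definable (\<lambda>e. e 0 \<in> A (\<lambda>i. e (Suc i)))" "definable (\<lambda>e. Q (e 0) (\<lambda>i. e (Suc i)))"
  shows "definable (\<lambda>e. \<exists>x\<in>A e. Q x e)"
  unfolding Bex_def by (intro dfn assms)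

lemma definable_seteq [dfn]:
  fixes A B :: "(nat \<Rightarrow> 'v) \<Rightarrow> 'v set"
  assumes "definable (\<lambda>e. e 0 \<in> A (\<lambda>i. e (Suc i)))" "definable (\<lambda>e. e 0 \<in> B (\<lambda>i. e (Suc i)))"
  shows "definable (\<lambda>e. A e = B e)"
  unfolding set_eq_iff by (intro dfn assms)

lemma definable_insert [dfn]:
  "definable_term t \<Longrightarrow> definable_term s \<Longrightarrow> definable (\<lambda>e. t e \<in> B e) \<Longrightarrow>
   definable (\<lambda>e. t e \<in> insert (s e) (B e))"
  by (simp add: definable_disj definable_eq)

lemma definable_empty [dfn]: "definable (\<lambda>e. t e \<in> {})"
  by (simp add: definable_const)

text \<open>A definite description whose value is fixed even where the description fails; unlike
  \<open>THE\<close>, it is definable.\<close>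

definition the_one :: "('v \<Rightarrow> bool) \<Rightarrow> 'v" where
  "the_one Q = (if \<exists>!y. Q y then THE y. Q y else undefined)"

lemma the_oneI: "\<exists>!y. Q y \<Longrightarrow> Q (the_one Q)"
  unfolding the_one_def by (simp only: if_True) (rule theI')

lemma the_one_eq: "Q y \<Longrightarrow> (\<And>z. Q z \<Longrightarrow> z = y) \<Longrightarrow> the_one Q = y"
  by (metis the_oneI)

lemma definable_the_one [dfn]:
  assumes "definable (\<lambda>e. Q (e 0) (\<lambda>i. e (Suc i)))"
  shows "definable_term (\<lambda>e. the_one (\<lambda>y. Q y e))"
proof -
  have *: "z = the_one (\<lambda>y. Q y e) \<longleftrightarrow>
     (Q z e \<and> (\<forall>y. Q y e \<longrightarrow> y = z)) \<or>
     (\<not> (\<exists>y. Q y e \<and> (\<forall>z. Q z e \<longrightarrow> z = y)) \<and> z = undefined)" for z e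
  proof (cases "\<exists>!y. Q y e")
    case True
    then have "Q (the_one (\<lambda>y. Q y e)) e" by (rule the_oneI)
    with True show ?thesis by metis
  next
    case False
    then have "the_one (\<lambda>y. Q y e) = undefined" unfolding the_one_def by (rule if_not_P)
    with False show ?thesis by metis
  qed
  have q: "definable (\<lambda>e. Q (e i) (\<lambda>k. e (\<rho> k)))" for i \<rho>
    using definable_rename[OF assms, of "case_nat i \<rho>"] by simp
  show ?thesis
    unfolding definable_term_def * by (intro dfn q)
qed

lemma definable_if [dfn]:
  assumes "definable Q" "definable_term s" "definable_term t"
  shows "definable_term (\<lambda>e. if Q e then s e else t e)"
proof -
  have "z = (if b then x else y) \<longleftrightarrow> (b \<and> z = x) \<or> (\<not> b \<and> z = y)" for z x y :: 'v and b by simp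
  moreover note q = definable_rename[OF assms(1), of Suc] definable_term_rename[OF assms(2), of Suc]
    definable_term_rename[OF assms(3), of Suc]
  ultimately show ?thesis unfolding definable_term_def
    by (simp only:) (intro definable_conj definable_disj definable_not definable_eq definable_term_var q)
qed

definition isset :: "'v set \<Rightarrow> bool" where
  "isset A \<longleftrightarrow> (\<exists>b. elts b = A)"

definition vset :: "'v set \<Rightarrow> 'v" where
  "vset A = the_one (\<lambda>b. elts b = A)"

lemma definable_vset [dfn]:
  assumes "definable (\<lambda>e. e 0 \<in> A (\<lambda>i. e (Suc i)))"
  shows "definable_term (\<lambda>e. vset (A e))"
proof -
  have q: "definable (\<lambda>e. e i \<in> A (\<lambda>k. e (\<rho> k)))" for i \<rho>
    using definable_rename[OF assms, of "case_nat i \<rho>"] by simp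
  show ?thesis unfolding vset_def by (intro dfn q)
qed

text \<open>Application of a set of pairs, with a fixed value outside of the domain.\<close>

definition ap :: "'v \<Rightarrow> 'v \<Rightarrow> 'v" where
  "ap f x = the_one (\<lambda>y. \<langle>x, y\<rangle> \<in>\<^sub>V f)"

lemma app_eq_ap: assumes "fun_on f a" "x \<in> elts a" shows "app f x = ap f x"
proof -
  have "\<exists>!y. \<langle>x, y\<rangle> \<in>\<^sub>V f" using assms unfolding fun_on_def by blast
  then show ?thesis unfolding app_def ap_def the_one_def by (simp only: if_True)
qed

end


section \<open>Sets in the model\<close>

locale zfc_model = set_universe mem for mem :: "'v \<Rightarrow> 'v \<Rightarrow> bool" (infix "\<in>\<^sub>V" 50) +
  assumes ZFC: ZFC
begin

lemma elts_iff [simp]: "x \<in> elts a \<longleftrightarrow> x \<in>\<^sub>V a"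
  by (simp add: elts_def)

lemma ball_elts [simp]: "(\<forall>x\<in>elts a. Q x) \<longleftrightarrow> (\<forall>x. x \<in>\<^sub>V a \<longrightarrow> Q x)"
  and bex_elts [simp]: "(\<exists>x\<in>elts a. Q x) \<longleftrightarrow> (\<exists>x. x \<in>\<^sub>V a \<and> Q x)"
  and elts_subset [simp]: "elts a \<subseteq> A \<longleftrightarrow> (\<forall>x. x \<in>\<^sub>V a \<longrightarrow> x \<in> A)"
  and elts_eq_empty [simp]: "elts a = {} \<longleftrightarrow> (\<forall>x. \<not> x \<in>\<^sub>V a)"
  unfolding elts_def by auto

lemma elts_inject: "elts a = elts b \<Longrightarrow> a = b"
proof -
  have "\<forall>a b. (\<forall>x. x \<in>\<^sub>V a \<longleftrightarrow> x \<in>\<^sub>V b) \<longrightarrow> a = b" using ZFC unfolding ZFC_def by (elim conjE)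
  then show "elts a = elts b \<Longrightarrow> a = b" unfolding elts_def by blast
qed

lemma elts_vset: assumes "isset A" shows "elts (vset A) = A"
proof -
  obtain b where "elts b = A" using assms unfolding isset_def by blast
  then show ?thesis unfolding vset_def by (intro the_oneI[of "\<lambda>b. elts b = A"]) (blast intro: elts_inject)
qed

lemma mem_vset: "isset A \<Longrightarrow> x \<in>\<^sub>V vset A \<longleftrightarrow> x \<in> A"
  using elts_vset elts_iff by blast

lemma isset_elts: "isset (elts a)"
  unfolding isset_def by blast

lemma foundation: assumes "elts a \<noteq> {}" shows "\<exists>x\<in>elts a. \<forall>y\<in>elts x. y \<notin> elts a"
proof -
  have "\<forall>a. (\<exists>x. x \<in>\<^sub>V a) \<longrightarrow> (\<exists>x. x \<in>\<^sub>V a \<and> \<not> (\<exists>y. y \<in>\<^sub>V x \<and> y \<in>\<^sub>V a))"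
    using ZFC unfolding ZFC_def by (elim conjE)
  then have "(\<exists>x. x \<in>\<^sub>V a) \<longrightarrow> (\<exists>x. x \<in>\<^sub>V a \<and> \<not> (\<exists>y. y \<in>\<^sub>V x \<and> y \<in>\<^sub>V a))" ..
  then show ?thesis using assms unfolding elts_def by blast
qed

lemma isset_pair: "isset {a, b}"
proof -
  have "\<forall>a b. \<exists>c. \<forall>x. x \<in>\<^sub>V c \<longleftrightarrow> x = a \<or> x = b" using ZFC unfolding ZFC_def by (elim conjE)
  from spec[OF spec[OF this, of a], of b] obtain c where "\<forall>x. x \<in>\<^sub>V c \<longleftrightarrow> x = a \<or> x = b" ..
  then have "elts c = {a, b}" by (simp add: set_eq_iff)
  then show ?thesis unfolding isset_def ..
qed

lemma isset_Union: "isset (\<Union>y\<in>elts a. elts y)"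
proof -
  have "\<forall>a. \<exists>b. \<forall>x. x \<in>\<^sub>V b \<longleftrightarrow> (\<exists>y. y \<in>\<^sub>V a \<and> x \<in>\<^sub>V y)" using ZFC unfolding ZFC_def by (elim conjE)
  from spec[OF this, of a] obtain c where "\<forall>x. x \<in>\<^sub>V c \<longleftrightarrow> (\<exists>y. y \<in>\<^sub>V a \<and> x \<in>\<^sub>V y)" ..
  then have "elts c = (\<Union>y\<in>elts a. elts y)" by (simp add: set_eq_iff)
  then show ?thesis unfolding isset_def ..
qed

lemma isset_Pow: "isset {x. elts x \<subseteq> elts a}"
proof -
  have "\<forall>a. \<exists>b. \<forall>x. x \<in>\<^sub>V b \<longleftrightarrow> (\<forall>y. y \<in>\<^sub>V x \<longrightarrow> y \<in>\<^sub>V a)" using ZFC unfolding ZFC_def by (elim conjE)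
  from spec[OF this, of a] obtain c where "\<forall>x. x \<in>\<^sub>V c \<longleftrightarrow> (\<forall>y. y \<in>\<^sub>V x \<longrightarrow> y \<in>\<^sub>V a)" ..
  then have "elts c = {x. elts x \<subseteq> elts a}" by (simp add: set_eq_iff)
  then show ?thesis unfolding isset_def ..
qed

lemma separation: assumes "definable1 Q" shows "isset {x \<in> elts a. Q x}"
proof -
  obtain \<phi> \<sigma> where "\<forall>e :: nat \<Rightarrow> 'v. Q (e 0) \<longleftrightarrow> sat UNIV (\<in>\<^sub>V) (\<lambda>i. case_sum e id (\<sigma> i)) \<phi>"
    using assms unfolding definable_def by (elim exE)
  note 1 = this[rule_format]
  define \<rho> where "\<rho> = (\<lambda>i. if \<sigma> i = Inl 0 then 0 else Suc i)"
  \<comment> \<open>\<open>Q (e 0)\<close> depends on variable 0 only, so any value, here \<open>a\<close>, serves for the others.\<close>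
  define e0 where "e0 = (\<lambda>i. case \<sigma> i of Inl j \<Rightarrow> a | Inr c \<Rightarrow> c)"
  have "(\<lambda>i. case_nat x e0 (\<rho> i)) = (\<lambda>i. case_sum (case_nat x (\<lambda>_. a)) id (\<sigma> i))" for x
    by (rule ext) (auto simp: \<rho>_def e0_def split: sum.split nat.split)
  then have Q: "sat UNIV (\<in>\<^sub>V) (case_nat x e0) (rename_fm \<rho> \<phi>) \<longleftrightarrow> Q x" for x
    using 1[of "case_nat x (\<lambda>_. a)"] by (simp add: sat_rename_fm)
  have "\<forall>\<phi> e a. \<exists>b. \<forall>x. x \<in>\<^sub>V b \<longleftrightarrow> x \<in>\<^sub>V a \<and> sat UNIV (\<in>\<^sub>V) (case_nat x e) \<phi>"
    using ZFC unfolding ZFC_def by (elim conjE)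
  from spec[OF spec[OF spec[OF this, of "rename_fm \<rho> \<phi>"], of e0], of a, unfolded Q]
  obtain b where "\<forall>x. x \<in>\<^sub>V b \<longleftrightarrow> x \<in>\<^sub>V a \<and> Q x" ..
  then have "elts b = {x \<in> elts a. Q x}" by (simp add: set_eq_iff)
  then show ?thesis unfolding isset_def ..
qed

lemma isset_subset: assumes "definable1 (\<lambda>x. x \<in> A)" "A \<subseteq> elts a" shows "isset A"
proof -
  have "{x \<in> elts a. x \<in> A} = A" using assms(2) by blast
  then show ?thesis using separation[OF assms(1), of a] by metis
qed

lemma replacement: assumes "definable_fun1 f" shows "isset (f ` elts a)"
proof -
  have "definable (\<lambda>e. e 0 = f (e 1))" using assms unfolding definable_term_def One_nat_def .
  then obtain \<phi> \<sigma> where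
    "\<forall>e :: nat \<Rightarrow> 'v. e 0 = f (e 1) \<longleftrightarrow> sat UNIV (\<in>\<^sub>V) (\<lambda>i. case_sum e id (\<sigma> i)) \<phi>"
    unfolding definable_def by (elim exE)
  note 1 = this[rule_format]
  define \<rho> where "\<rho> = (\<lambda>i. if \<sigma> i = Inl 0 then 0 else if \<sigma> i = Inl 1 then 1 else Suc (Suc i))"
  define e0 where "e0 = (\<lambda>i. case \<sigma> i of Inl j \<Rightarrow> a | Inr c \<Rightarrow> c)"
  have "(\<lambda>i. case_nat y (case_nat x e0) (\<rho> i)) = (\<lambda>i. case_sum (case_nat y (case_nat x (\<lambda>_. a))) id (\<sigma> i))"
    for x y
  proof
    fix i
    show "case_nat y (case_nat x e0) (\<rho> i) = case_sum (case_nat y (case_nat x (\<lambda>_. a))) id (\<sigma> i)"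
    proof (cases "\<sigma> i")
      case (Inl j)
      then show ?thesis by (cases j; cases "j - 1") (simp_all add: \<rho>_def e0_def)
    qed (simp add: \<rho>_def e0_def)
  qed
  then have Q: "sat UNIV (\<in>\<^sub>V) (case_nat y (case_nat x e0)) (rename_fm \<rho> \<phi>) \<longleftrightarrow> y = f x" for x y
    using 1[of "case_nat y (case_nat x (\<lambda>_. a))"] by (simp add: sat_rename_fm)
  have "\<forall>\<phi> e a. (\<forall>x. x \<in>\<^sub>V a \<longrightarrow> (\<exists>!y. sat UNIV (\<in>\<^sub>V) (case_nat y (case_nat x e)) \<phi>)) \<longrightarrow>
       (\<exists>b. \<forall>y. y \<in>\<^sub>V b \<longleftrightarrow> (\<exists>x. x \<in>\<^sub>V a \<and> sat UNIV (\<in>\<^sub>V) (case_nat y (case_nat x e)) \<phi>))"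
    using ZFC unfolding ZFC_def by (elim conjE)
  from spec[OF spec[OF spec[OF this, of "rename_fm \<rho> \<phi>"], of e0], of a, unfolded Q]
  have "\<exists>b. \<forall>y. y \<in>\<^sub>V b \<longleftrightarrow> (\<exists>x. x \<in>\<^sub>V a \<and> y = f x)" by simp
  then obtain b where "\<forall>y. y \<in>\<^sub>V b \<longleftrightarrow> (\<exists>x. x \<in>\<^sub>V a \<and> y = f x)" ..
  then have "elts b = f ` elts a" by (simp add: set_eq_iff image_iff)
  then show ?thesis unfolding isset_def ..
qed

lemma isset_image: assumes "definable_fun1 f" "isset A" shows "isset (f ` A)"
  using replacement[OF assms(1), of "vset A"] unfolding elts_vset[OF assms(2)] .

lemma isset_UN: assumes "definable_fun1 f" shows "isset (\<Union>x\<in>elts a. elts (f x))"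
  using isset_Union[of "vset (f ` elts a)"] by (simp add: elts_vset replacement[OF assms])

lemma isset_Un: assumes "isset A" "isset B" shows "isset (A \<union> B)"
  using isset_Union[of "vset {vset A, vset B}"] assms by (simp add: elts_vset isset_pair)

lemma isset_single: "isset {a}"
  using isset_pair[of a a] by simp

lemma isset_insert: "isset A \<Longrightarrow> isset (insert a A)"
  using isset_Un[OF isset_single] by simp

lemma elts_upair: "elts (upair a b) = {a, b}"
proof -
  obtain c where c: "elts c = {a, b}" using isset_pair isset_def by metis
  then have "upair a b = c" unfolding upair_def by (intro the_equality) (auto intro: elts_inject)
  with c show ?thesis by simp
qed

lemma mem_upair: "x \<in>\<^sub>V upair a b \<longleftrightarrow> x = a \<or> x = b"
  using elts_upair[of a b] elts_iff[of x "upair a b"] by simp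

lemma upair_eqI: "(\<And>x. x \<in>\<^sub>V c \<longleftrightarrow> x = a \<or> x = b) \<Longrightarrow> c = upair a b"
  by (rule elts_inject) (auto simp: mem_upair)

lemma upair_vset: "upair a b = vset {a, b}"
  by (rule elts_inject) (simp add: elts_upair elts_vset isset_pair)

lemma definable_upair [dfn]:
  assumes "definable_term s" "definable_term t" shows "definable_term (\<lambda>e. upair (s e) (t e))"
  by (rule definable_fun2_app[OF _ assms]) (unfold upair_vset, intro dfn)

lemma definable_opair [dfn]:
  assumes "definable_term s" "definable_term t" shows "definable_term (\<lambda>e. \<langle>s e, t e\<rangle>)"
  unfolding opair_def by (intro dfn assms)

lemma definable_ap [dfn]:
  assumes "definable_term s" "definable_term t" shows "definable_term (\<lambda>e. ap (s e) (t e))"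
  by (rule definable_fun2_app[OF _ assms]) (unfold ap_def, intro dfn)

lemma upair_eq: "upair a b = upair c d \<longleftrightarrow> (a = c \<and> b = d) \<or> (a = d \<and> b = c)"
proof -
  have "upair a b = upair c d \<longleftrightarrow> elts (upair a b) = elts (upair c d)" by (auto dest: elts_inject)
  then show ?thesis by (simp only: elts_upair doubleton_eq_iff)
qed

lemma opair_eq [simp]: "\<langle>a, b\<rangle> = \<langle>c, d\<rangle> \<longleftrightarrow> a = c \<and> b = d"
  unfolding opair_def upair_eq by auto

text \<open>By the Kuratowski encoding, second components are elements of elements of elements
  of \<open>x\<close>.\<close>

lemma isset_snd: "isset {y. \<exists>p. \<langle>p, y\<rangle> \<in>\<^sub>V x}"
proof -
  define u where "u = vset (\<Union>y\<in>elts x. elts y)"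
  have u: "elts u = (\<Union>y\<in>elts x. elts y)" unfolding u_def by (rule elts_vset) (rule isset_Union)
  have sub: "{y. \<exists>p. \<langle>p, y\<rangle> \<in>\<^sub>V x} \<subseteq> (\<Union>y\<in>elts u. elts y)"
    unfolding u by (auto simp: opair_def) (metis mem_upair)
  have eq: "elts (vset (\<Union>y\<in>elts u. elts y)) = (\<Union>y\<in>elts u. elts y)"
    by (rule elts_vset) (rule isset_Union)
  show ?thesis
    by (rule isset_subset[of _ "vset (\<Union>y\<in>elts u. elts y)"]) (intro dfn, simp only: eq sub)
qed

lemma isset_Times: "isset {\<langle>x, y\<rangle> | x y. x \<in>\<^sub>V a \<and> y \<in>\<^sub>V b}"
proof -
  have 1: "elts (vset ((\<lambda>y. \<langle>x, y\<rangle>) ` elts b)) = (\<lambda>y. \<langle>x, y\<rangle>) ` elts b" for x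
    by (rule elts_vset) (intro replacement dfn)
  have "isset (\<Union>x\<in>elts a. elts (vset {z. \<exists>y\<in>elts b. z = \<langle>x, y\<rangle>}))"
    by (intro isset_UN dfn)
  moreover have "{z. \<exists>y\<in>elts b. z = \<langle>x, y\<rangle>} = (\<lambda>y. \<langle>x, y\<rangle>) ` elts b" for x by auto
  ultimately have "isset (\<Union>x\<in>elts a. (\<lambda>y. \<langle>x, y\<rangle>) ` elts b)" by (simp only: 1)
  moreover have "(\<Union>x\<in>elts a. (\<lambda>y. \<langle>x, y\<rangle>) ` elts b) = {\<langle>x, y\<rangle> | x y. x \<in>\<^sub>V a \<and> y \<in>\<^sub>V b}" by auto
  ultimately show ?thesis by (simp only:)
qed

definition Times :: "'v \<Rightarrow> 'v \<Rightarrow> 'v" where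
  "Times a b = vset {\<langle>x, y\<rangle> | x y. x \<in>\<^sub>V a \<and> y \<in>\<^sub>V b}"

lemma elts_Times: "elts (Times a b) = {\<langle>x, y\<rangle> | x y. x \<in>\<^sub>V a \<and> y \<in>\<^sub>V b}"
  unfolding Times_def by (rule elts_vset) (rule isset_Times)

lemma opair_mem_Times [simp]: "\<langle>x, y\<rangle> \<in>\<^sub>V Times a b \<longleftrightarrow> x \<in>\<^sub>V a \<and> y \<in>\<^sub>V b"
  using elts_Times[of a b] elts_iff[of "\<langle>x, y\<rangle>" "Times a b"] by auto

lemma mem_Times: "z \<in>\<^sub>V Times a b \<longleftrightarrow> (\<exists>x y. x \<in>\<^sub>V a \<and> y \<in>\<^sub>V b \<and> z = \<langle>x, y\<rangle>)"
  using elts_Times[of a b] elts_iff[of z "Times a b"] by auto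

definition graph :: "('v \<Rightarrow> 'v) \<Rightarrow> 'v set \<Rightarrow> 'v" where
  "graph F A = vset {z. \<exists>x\<in>A. z = \<langle>x, F x\<rangle>}"

lemma elts_graph:
  assumes "definable_fun1 F" "isset A" shows "elts (graph F A) = {z. \<exists>x\<in>A. z = \<langle>x, F x\<rangle>}"
proof -
  have "isset ((\<lambda>x. \<langle>x, F x\<rangle>) ` elts (vset A))"
    by (intro replacement dfn definable_fun1_app[OF assms(1)])
  moreover have "(\<lambda>x. \<langle>x, F x\<rangle>) ` elts (vset A) = {z. \<exists>x\<in>A. z = \<langle>x, F x\<rangle>}"
    by (auto simp: mem_vset assms(2))
  ultimately show ?thesis unfolding graph_def by (metis elts_vset)
qed

lemma mem_graph:
  assumes "definable_fun1 F" "isset A" shows "z \<in>\<^sub>V graph F A \<longleftrightarrow> (\<exists>x\<in>A. z = \<langle>x, F x\<rangle>)"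
  using elts_graph[OF assms] elts_iff by blast

lemma opair_mem_graph:
  assumes "definable_fun1 F" "isset A" shows "\<langle>x, y\<rangle> \<in>\<^sub>V graph F A \<longleftrightarrow> x \<in> A \<and> y = F x"
  using mem_graph[OF assms] by auto

lemma ap_graph:
  assumes "definable_fun1 F" "isset A" "x \<in> A" shows "ap (graph F A) x = F x"
  unfolding ap_def using assms by (intro the_one_eq) (auto simp: opair_mem_graph)

lemma fun_on_graph:
  assumes "definable_fun1 F" shows "fun_on (graph F (elts N)) N"
  unfolding fun_on_def by (auto simp: mem_graph[OF assms isset_elts])

lemma app_graph:
  assumes "definable_fun1 F" "x \<in>\<^sub>V N" shows "app (graph F (elts N)) x = F x"
  using app_eq_ap[OF fun_on_graph[OF assms(1)]] ap_graph[OF assms(1) isset_elts] assms(2) by simp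


section \<open>Induction and recursion inside the model\<close>

text \<open>Well-foundedness as seen from inside the model: the relation may have infinite descending
  sequences that are not in the model.\<close>

definition wf_set :: "'v \<Rightarrow> ('v \<Rightarrow> 'v \<Rightarrow> bool) \<Rightarrow> bool" where
  "wf_set N R \<longleftrightarrow> (\<forall>A. elts A \<subseteq> elts N \<and> elts A \<noteq> {} \<longrightarrow> (\<exists>x\<in>elts A. \<forall>y\<in>elts A. \<not> R y x))"

lemma wf_set_mem: "wf_set N (\<in>\<^sub>V)"
  unfolding wf_set_def using foundation by (metis elts_iff)

lemma wf_set_minimal:
  assumes "wf_set N R" "definable1 Q" "x \<in>\<^sub>V N" "Q x"
  obtains m where "m \<in>\<^sub>V N" "Q m" "\<And>y. y \<in>\<^sub>V N \<Longrightarrow> R y m \<Longrightarrow> \<not> Q y"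
proof -
  define A where "A = vset {x \<in> elts N. Q x}"
  have A: "elts A = {x \<in> elts N. Q x}" unfolding A_def by (rule elts_vset) (rule separation[OF assms(2)])
  then obtain m where "m \<in> elts A" "\<forall>y\<in>elts A. \<not> R y m"
    using assms(1,3,4) unfolding wf_set_def by (metis (mono_tags, lifting) elts_iff empty_Collect_eq mem_Collect_eq subsetI)
  then show ?thesis using that A by auto
qed

lemma wf_set_induct:
  assumes "wf_set N R" "definable1 Q" "x \<in>\<^sub>V N"
    and "\<And>x. x \<in>\<^sub>V N \<Longrightarrow> (\<And>y. y \<in>\<^sub>V N \<Longrightarrow> R y x \<Longrightarrow> Q y) \<Longrightarrow> Q x"
  shows "Q x"
proof (rule ccontr)
  assume "\<not> Q x"
  then show False
    by (rule wf_set_minimal[OF assms(1) definable_not[OF assms(2)] assms(3)]) (use assms(4) in blast)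
qed

lemma mem_irrefl: "\<not> x \<in>\<^sub>V x"
  using foundation[of "vset {x}"] by (auto simp: elts_vset isset_single)

text \<open>Recursion along a definable relation that is well-founded on a set. The recursion
  functional receives the graph of the function below \<open>x\<close>. The function is glued from the attempts,
  any two of which agree on their common domain.\<close>

lemma recursion:
  assumes wf: "wf_set N R" and R: "definable2 R" and H: "definable_fun2 H"
  obtains F where "definable_fun1 F"
    "\<And>x. x \<in>\<^sub>V N \<Longrightarrow> F x = H x (graph F {y \<in> elts N. R y x})"
proof -
  define below where "below f x = vset {z. \<exists>y\<in>{y \<in> elts N. R y x}. z = \<langle>y, ap f y\<rangle>}" for f x
  define attempt where "attempt d g \<longleftrightarrow> (\<forall>x. x \<in>\<^sub>V d \<longrightarrow> x \<in>\<^sub>V N \<and>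
    (\<forall>y. y \<in>\<^sub>V N \<longrightarrow> R y x \<longrightarrow> y \<in>\<^sub>V d) \<and> ap g x = H x (below g x))" for d g
  have sub: "x \<in>\<^sub>V N" and down: "y \<in>\<^sub>V N \<Longrightarrow> R y x \<Longrightarrow> y \<in>\<^sub>V d" and
    eq: "ap g x = H x (below g x)" if "attempt d g" "x \<in>\<^sub>V d" for d g x y
    using that unfolding attempt_def by blast+
  have below_dfn: "definable_fun2 below"
    unfolding below_def by (intro dfn definable2_app[OF R])
  have attempt_dfn: "definable2 attempt" unfolding attempt_def
    by (intro dfn definable2_app[OF R] definable_fun2_app[OF H] definable_fun2_app[OF below_dfn])
  have below_cong: "below g x = below g' x" if "\<And>y. y \<in>\<^sub>V N \<Longrightarrow> R y x \<Longrightarrow> ap g y = ap g' y" for g g' x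
  proof -
    have "{z. \<exists>y\<in>{y \<in> elts N. R y x}. z = \<langle>y, ap g y\<rangle>} = {z. \<exists>y\<in>{y \<in> elts N. R y x}. z = \<langle>y, ap g' y\<rangle>}"
      using that by auto
    then show ?thesis unfolding below_def by (simp only:)
  qed
  have agree: "ap g x = ap g' x" if a: "attempt d g" "attempt d' g'" and x: "x \<in>\<^sub>V d" "x \<in>\<^sub>V d'" for d g d' g' x
  proof -
    have "x \<in>\<^sub>V d \<longrightarrow> x \<in>\<^sub>V d' \<longrightarrow> ap g x = ap g' x"
    proof (rule wf_set_induct[OF wf, where Q = "\<lambda>x. x \<in>\<^sub>V d \<longrightarrow> x \<in>\<^sub>V d' \<longrightarrow> ap g x = ap g' x" and x = x])
      show "definable1 (\<lambda>x. x \<in>\<^sub>V d \<longrightarrow> x \<in>\<^sub>V d' \<longrightarrow> ap g x = ap g' x)" by (intro dfn)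
      show "x \<in>\<^sub>V N" using sub[OF a(1) x(1)] .
      fix x assume x: "x \<in>\<^sub>V N"
        and IH: "\<And>y. y \<in>\<^sub>V N \<Longrightarrow> R y x \<Longrightarrow> y \<in>\<^sub>V d \<longrightarrow> y \<in>\<^sub>V d' \<longrightarrow> ap g y = ap g' y"
      show "x \<in>\<^sub>V d \<longrightarrow> x \<in>\<^sub>V d' \<longrightarrow> ap g x = ap g' x"
      proof (intro impI)
        assume d: "x \<in>\<^sub>V d" "x \<in>\<^sub>V d'"
        have "below g x = below g' x"
          by (rule below_cong) (use d IH down[OF a(1)] down[OF a(2)] in blast)
        then show "ap g x = ap g' x" using eq[OF a(1) d(1)] eq[OF a(2) d(2)] by simp
      qed
    qed
    then show ?thesis using x by blast
  qed
  define F where "F x = the_one (\<lambda>v. \<exists>d g. attempt d g \<and> x \<in>\<^sub>V d \<and> v = ap g x)" for x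
  have F_dfn: "definable_fun1 F" unfolding F_def by (intro dfn definable2_app[OF attempt_dfn])
  have F_eq: "F x = ap g x" if "attempt d g" "x \<in>\<^sub>V d" for d g x
    unfolding F_def by (rule the_one_eq) (use that agree in blast)+
  define below_F where "below_F x = graph F {y \<in> elts N. R y x}" for x
  have pre: "isset {y \<in> elts N. R y x}" for x
    by (rule separation) (intro dfn definable2_app[OF R])
  have below_F: "below g x = below_F x" if "\<And>y. y \<in>\<^sub>V N \<Longrightarrow> R y x \<Longrightarrow> ap g y = F y" for g x
  proof -
    have "{z. \<exists>y\<in>{y \<in> elts N. R y x}. z = \<langle>y, ap g y\<rangle>} = {z. \<exists>y\<in>{y \<in> elts N. R y x}. z = \<langle>y, F y\<rangle>}"
      using that by auto
    then show ?thesis unfolding below_def below_F_def graph_def by (simp only:)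
  qed
  have below_F_dfn: "definable_fun1 below_F" unfolding below_F_def graph_def
    by (intro dfn definable2_app[OF R] definable_fun1_app[OF F_dfn])
  define B where "B = vset {x \<in> elts N. \<exists>d g. attempt d g \<and> x \<in>\<^sub>V d}"
  have B: "x \<in>\<^sub>V B \<longleftrightarrow> x \<in>\<^sub>V N \<and> (\<exists>d g. attempt d g \<and> x \<in>\<^sub>V d)" for x
    unfolding B_def by (subst mem_vset, rule separation, intro dfn definable2_app[OF attempt_dfn]) simp
  have F_rec: "F x = H x (below_F x)" if x: "x \<in>\<^sub>V B" for x
  proof -
    obtain d g where d: "attempt d g" "x \<in>\<^sub>V d" using x B by blast
    have "below g x = below_F x" by (rule below_F) (rule F_eq[OF d(1) down[OF d], symmetric])
    then show ?thesis using F_eq[OF d] eq[OF d] by simp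
  qed
  have B_down: "y \<in>\<^sub>V B" if "x \<in>\<^sub>V B" "y \<in>\<^sub>V N" "R y x" for x y
    using that B down by blast
  have "x \<in>\<^sub>V B" if "x \<in>\<^sub>V N" for x
  proof (rule wf_set_induct[OF wf _ that, where Q = "\<lambda>x. x \<in>\<^sub>V B"])
    show "definable1 (\<lambda>x. x \<in>\<^sub>V B)" by (intro dfn)
    fix x assume x: "x \<in>\<^sub>V N" and IH: "\<And>y. y \<in>\<^sub>V N \<Longrightarrow> R y x \<Longrightarrow> y \<in>\<^sub>V B"
    show "x \<in>\<^sub>V B"
    proof (rule ccontr)
      assume nx: "\<not> x \<in>\<^sub>V B"
      define F' where "F' y = (if y = x then H x (below_F x) else F y)" for y
      have F'_dfn: "definable_fun1 F'" unfolding F'_def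
        by (intro dfn definable_fun1_app[OF F_dfn])
      define d where "d = vset (insert x (elts B))"
      define g where "g = graph F' (elts d)"
      have d: "y \<in>\<^sub>V d \<longleftrightarrow> y \<in>\<^sub>V B \<or> y = x" for y
        unfolding d_def by (auto simp: mem_vset isset_insert isset_elts)
      have g: "ap g y = F' y" if "y \<in>\<^sub>V d" for y
        unfolding g_def by (rule ap_graph[OF F'_dfn isset_elts]) (simp add: that)
      have gB: "ap g y = F y" if "y \<in>\<^sub>V B" for y
        using that g[of y] d nx unfolding F'_def by auto
      have bel: "below g y = below_F y" if "y \<in>\<^sub>V d" for y
        by (rule below_F) (use that d gB IH B_down in blast)
      have "attempt d g"
        unfolding attempt_def
      proof (intro allI impI conjI)
        fix y assume y: "y \<in>\<^sub>V d"
        show "y \<in>\<^sub>V N" using y d x B by blast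
        show "z \<in>\<^sub>V d" if "z \<in>\<^sub>V N" "R z y" for z using y d B_down IH that by blast
        show "ap g y = H y (below g y)"
        proof (cases "y = x")
          case True
          then show ?thesis using g[OF y] bel[OF y] unfolding F'_def by simp
        next
          case False
          then have "y \<in>\<^sub>V B" using y d by blast
          then show ?thesis using gB F_rec bel[OF y] by simp
        qed
      qed
      then show False using nx B d x by blast
    qed
  qed
  then show ?thesis using that[OF F_dfn] F_rec unfolding below_F_def by blast
qed

text \<open>The axiom speaks of disjoint families. The sets \<open>{A} \<times> A\<close> are pairwise disjoint, and a
  selector for them is a choice function for the nonempty subsets \<open>A\<close> of \<open>S\<close>.\<close>

lemma choice:
  obtains ch where "definable_fun1 ch" "\<And>A. elts A \<subseteq> elts S \<Longrightarrow> elts A \<noteq> {} \<Longrightarrow> ch A \<in>\<^sub>V A"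
proof -
  define Po where "Po = vset {x. elts x \<subseteq> elts S}"
  have Po: "elts Po = {x. elts x \<subseteq> elts S}" unfolding Po_def by (rule elts_vset) (rule isset_Pow)
  define tag where "tag A = vset {z. \<exists>x\<in>elts A. z = \<langle>A, x\<rangle>}" for A
  have tag_dfn: "definable_fun1 tag" unfolding tag_def by (intro dfn)
  have tag: "z \<in>\<^sub>V tag A \<longleftrightarrow> (\<exists>x. x \<in>\<^sub>V A \<and> z = \<langle>A, x\<rangle>)" for z A
  proof -
    have "isset ((\<lambda>x. \<langle>A, x\<rangle>) ` elts A)" by (intro replacement dfn)
    moreover have "(\<lambda>x. \<langle>A, x\<rangle>) ` elts A = {z. \<exists>x\<in>elts A. z = \<langle>A, x\<rangle>}" by auto
    ultimately show ?thesis unfolding tag_def using mem_vset by auto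
  qed
  define fam where "fam = vset {B \<in> elts (vset (tag ` elts Po)). \<exists>z. z \<in>\<^sub>V B}"
  have "isset {B \<in> elts (vset (tag ` elts Po)). \<exists>z. z \<in>\<^sub>V B}" by (rule separation) (intro dfn)
  note mem_vset[OF this]
  moreover have "elts (vset (tag ` elts Po)) = tag ` {x. elts x \<subseteq> elts S}"
    using elts_vset[OF replacement[OF tag_dfn, of Po]] unfolding Po .
  ultimately have fam: "B \<in>\<^sub>V fam \<longleftrightarrow> (\<exists>A. elts A \<subseteq> elts S \<and> elts A \<noteq> {} \<and> B = tag A)" for B
    unfolding fam_def by (simp add: image_iff) (use tag in blast)
  have "\<forall>a. (\<forall>x. x \<in>\<^sub>V a \<longrightarrow> (\<exists>y. y \<in>\<^sub>V x)) \<and>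
       (\<forall>x y z. x \<in>\<^sub>V a \<and> y \<in>\<^sub>V a \<and> z \<in>\<^sub>V x \<and> z \<in>\<^sub>V y \<longrightarrow> x = y) \<longrightarrow>
       (\<exists>c. \<forall>x. x \<in>\<^sub>V a \<longrightarrow> (\<exists>!y. y \<in>\<^sub>V x \<and> y \<in>\<^sub>V c))"
    using ZFC unfolding ZFC_def by (elim conjE)
  note spec[OF this, of fam]
  moreover have "\<exists>y. y \<in>\<^sub>V B" if "B \<in>\<^sub>V fam" for B
    using that unfolding fam elts_eq_empty using tag by blast
  moreover have "B = B'" if "B \<in>\<^sub>V fam" "B' \<in>\<^sub>V fam" "z \<in>\<^sub>V B" "z \<in>\<^sub>V B'" for B B' z
    using that unfolding fam by (auto simp: tag)
  ultimately obtain c where c: "\<forall>x. x \<in>\<^sub>V fam \<longrightarrow> (\<exists>!y. y \<in>\<^sub>V x \<and> y \<in>\<^sub>V c)"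
    by blast
  define ch where "ch A = the_one (\<lambda>x. x \<in>\<^sub>V A \<and> \<langle>A, x\<rangle> \<in>\<^sub>V c)" for A
  have "definable_fun1 ch" unfolding ch_def by (intro dfn)
  moreover have "ch A \<in>\<^sub>V A" if "elts A \<subseteq> elts S" "elts A \<noteq> {}" for A
  proof -
    have "tag A \<in>\<^sub>V fam" using fam that by blast
    then have "\<exists>!y. y \<in>\<^sub>V tag A \<and> y \<in>\<^sub>V c" using c by blast
    then have "\<exists>!x. x \<in>\<^sub>V A \<and> \<langle>A, x\<rangle> \<in>\<^sub>V c" unfolding tag using opair_eq by blast
    then show ?thesis unfolding ch_def by (rule the_oneI[THEN conjunct1])
  qed
  ultimately show ?thesis using that by blast
qed

end


section \<open>Ordinals and cardinalities\<close>

context zfc_model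
begin

definition transitive :: "'v \<Rightarrow> bool" where
  "transitive a \<longleftrightarrow> (\<forall>x y. x \<in>\<^sub>V a \<longrightarrow> y \<in>\<^sub>V x \<longrightarrow> y \<in>\<^sub>V a)"

definition ordinal :: "'v \<Rightarrow> bool" where
  "ordinal a \<longleftrightarrow> transitive a \<and> (\<forall>x. x \<in>\<^sub>V a \<longrightarrow> transitive x)"

lemma ordinal_trans: "ordinal a \<Longrightarrow> x \<in>\<^sub>V a \<Longrightarrow> y \<in>\<^sub>V x \<Longrightarrow> y \<in>\<^sub>V a"
  and ordinal_trans': "ordinal a \<Longrightarrow> x \<in>\<^sub>V a \<Longrightarrow> y \<in>\<^sub>V x \<Longrightarrow> z \<in>\<^sub>V y \<Longrightarrow> z \<in>\<^sub>V x"
  unfolding ordinal_def transitive_def by blast+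

lemma ordinal_mem: assumes "ordinal a" "x \<in>\<^sub>V a" shows "ordinal x"
  using assms unfolding ordinal_def transitive_def by blast

text \<open>Let \<open>m\<close> be minimal among the elements that are incomparable with some element, and \<open>n\<close>
  minimal among those incomparable with \<open>m\<close>. Everything below one of them is comparable with, hence
  below, the other, so \<open>m\<close> and \<open>n\<close> have the same elements.\<close>

lemma ordinal_linear:
  assumes k: "ordinal k" and "a \<in>\<^sub>V k" "b \<in>\<^sub>V k" shows "a \<in>\<^sub>V b \<or> a = b \<or> b \<in>\<^sub>V a"
proof (rule ccontr)
  define cmp where "cmp a b \<longleftrightarrow> a \<in>\<^sub>V b \<or> a = b \<or> b \<in>\<^sub>V a" for a b
  have cmp_dfn: "definable2 cmp" unfolding cmp_def by (intro dfn)
  assume "\<not> (a \<in>\<^sub>V b \<or> a = b \<or> b \<in>\<^sub>V a)"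
  then have ex: "\<exists>b. b \<in>\<^sub>V k \<and> \<not> cmp a b" using assms unfolding cmp_def by blast
  obtain m where m: "m \<in>\<^sub>V k" "\<exists>b. b \<in>\<^sub>V k \<and> \<not> cmp m b"
      "\<And>y. y \<in>\<^sub>V k \<Longrightarrow> y \<in>\<^sub>V m \<Longrightarrow> \<not> (\<exists>b. b \<in>\<^sub>V k \<and> \<not> cmp y b)"
    by (rule wf_set_minimal[where Q = "\<lambda>a. \<exists>b. b \<in>\<^sub>V k \<and> \<not> cmp a b", OF wf_set_mem _ assms(2) ex])
      (intro dfn definable2_app[OF cmp_dfn], blast)
  obtain b0 where b0: "b0 \<in>\<^sub>V k" "\<not> cmp m b0" using m(2) by blast
  obtain n where n: "n \<in>\<^sub>V k" "\<not> cmp m n" "\<And>y. y \<in>\<^sub>V k \<Longrightarrow> y \<in>\<^sub>V n \<Longrightarrow> cmp m y"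
    by (rule wf_set_minimal[where Q = "\<lambda>b. \<not> cmp m b", OF wf_set_mem _ b0])
      (intro dfn definable2_app[OF cmp_dfn], blast)
  have "x \<in>\<^sub>V n" if x: "x \<in>\<^sub>V m" for x
  proof -
    have "cmp x n" using m(3)[OF ordinal_trans[OF k m(1) x] x] n(1) by blast
    then show ?thesis using n(2) x ordinal_trans'[OF k m(1) x] unfolding cmp_def by blast
  qed
  moreover have "x \<in>\<^sub>V m" if x: "x \<in>\<^sub>V n" for x
  proof -
    have "cmp m x" using n(3)[OF ordinal_trans[OF k n(1) x] x] .
    then show ?thesis using n(2) x ordinal_trans'[OF k n(1) x] unfolding cmp_def by blast
  qed
  ultimately have "m = n" by (intro elts_inject subset_antisym) simp_all
  then show False using n(2) unfolding cmp_def by blast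
qed

text \<open>If \<open>c\<close> is not all of \<open>b\<close>, it is the least element of \<open>b\<close> outside of \<open>c\<close>.\<close>

lemma transitive_subset_ordinal:
  assumes k: "ordinal k" and b: "b \<in>\<^sub>V k" and c: "transitive c" and sub: "\<And>x. x \<in>\<^sub>V c \<Longrightarrow> x \<in>\<^sub>V b"
  shows "c \<in>\<^sub>V b \<or> c = b"
proof (cases "\<exists>x. x \<in>\<^sub>V b \<and> \<not> x \<in>\<^sub>V c")
  case True
  then obtain x where x: "x \<in>\<^sub>V b" "\<not> x \<in>\<^sub>V c" by blast
  obtain m where m: "m \<in>\<^sub>V b" "\<not> m \<in>\<^sub>V c" "\<And>y. y \<in>\<^sub>V b \<Longrightarrow> y \<in>\<^sub>V m \<Longrightarrow> \<not> \<not> y \<in>\<^sub>V c"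
    by (rule wf_set_minimal[where Q = "\<lambda>x. \<not> x \<in>\<^sub>V c", OF wf_set_mem _ x]) (intro dfn, blast)
  have "y \<in>\<^sub>V c" if "y \<in>\<^sub>V m" for y using m(3) that ordinal_trans'[OF k b m(1)] by blast
  moreover have "y \<in>\<^sub>V m" if y: "y \<in>\<^sub>V c" for y
  proof -
    have "y \<in>\<^sub>V m \<or> y = m \<or> m \<in>\<^sub>V y"
      by (rule ordinal_linear[OF k]) (use sub[OF y] m(1) ordinal_trans[OF k b] in blast)+
    then show ?thesis using m(2) y c unfolding transitive_def by blast
  qed
  ultimately have "c = m" by (intro elts_inject subset_antisym) simp_all
  then show ?thesis using m by blast
next
  case False
  then have "c = b" using sub by (intro elts_inject subset_antisym) auto
  then show ?thesis ..
qed

text \<open>An image of \<open>b\<close> is enumerated by the set \<open>S\<close> of the least preimages, and the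
  collapse \<open>F\<close> maps \<open>S\<close> onto an ordinal below or equal to \<open>b\<close>.\<close>

lemma card_less_image:
  assumes k: "ordinal k" and b: "b \<in>\<^sub>V k" and h: "definable_fun1 h"
  shows "card_less (vset (h ` elts b)) k"
proof -
  define S where "S = vset {x \<in> elts b. \<forall>y\<in>elts x. h y \<noteq> h x}"
  have "isset {x \<in> elts b. \<forall>y\<in>elts x. h y \<noteq> h x}"
    by (rule separation) (intro dfn definable_fun1_app[OF h])
  then have S: "x \<in>\<^sub>V S \<longleftrightarrow> x \<in>\<^sub>V b \<and> (\<forall>y. y \<in>\<^sub>V x \<longrightarrow> h y \<noteq> h x)" for x
    unfolding S_def by (simp add: mem_vset)
  have tr: "x \<in>\<^sub>V b \<Longrightarrow> y \<in>\<^sub>V x \<Longrightarrow> y \<in>\<^sub>V b" for x y using ordinal_mem[OF k b] ordinal_trans by blast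
  define H where "H x g = vset {v. \<exists>y\<in>elts x. y \<in>\<^sub>V S \<and> v = ap g y}" for x g
  have H_dfn: "definable_fun2 H" unfolding H_def by (intro dfn)
  have mem_dfn: "definable2 (\<in>\<^sub>V)" by (intro dfn)
  obtain F where F_dfn: "definable_fun1 F" and
    rec: "\<And>x. x \<in>\<^sub>V b \<Longrightarrow> F x = H x (graph F {y \<in> elts b. y \<in>\<^sub>V x})"
    by (rule recursion[OF wf_set_mem[of b] mem_dfn H_dfn]) blast
  have F: "v \<in>\<^sub>V F x \<longleftrightarrow> (\<exists>y. y \<in>\<^sub>V x \<and> y \<in>\<^sub>V S \<and> v = F y)" if x: "x \<in>\<^sub>V b" for x v
  proof -
    have ss: "isset {y \<in> elts b. y \<in>\<^sub>V x}" by (rule separation) (intro dfn)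
    have "{v. \<exists>y\<in>elts x. y \<in>\<^sub>V S \<and> v = ap (graph F {y \<in> elts b. y \<in>\<^sub>V x}) y} = {v. \<exists>y\<in>elts x. y \<in>\<^sub>V S \<and> v = F y}"
      using ap_graph[OF F_dfn ss] tr[OF x] by auto
    moreover have "isset {y \<in> elts x. y \<in>\<^sub>V S}" by (rule separation) (intro dfn)
    then have "isset (F ` {y \<in> elts x. y \<in>\<^sub>V S})" by (rule isset_image[OF F_dfn])
    moreover have "F ` {y \<in> elts x. y \<in>\<^sub>V S} = {v. \<exists>y\<in>elts x. y \<in>\<^sub>V S \<and> v = F y}" by auto
    ultimately show ?thesis using rec[OF x] unfolding H_def by (simp add: mem_vset)
  qed
  have trF: "transitive (F x)" if x: "x \<in>\<^sub>V b" for x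
    unfolding transitive_def
  proof (intro allI impI)
    fix v w assume "v \<in>\<^sub>V F x" "w \<in>\<^sub>V v"
    then obtain y where y: "y \<in>\<^sub>V x" "v = F y" using F[OF x] by blast
    with \<open>w \<in>\<^sub>V v\<close> obtain z where z: "z \<in>\<^sub>V y" "z \<in>\<^sub>V S" "w = F z" using F[OF tr[OF x y(1)]] by blast
    have "z \<in>\<^sub>V x" using ordinal_trans'[OF ordinal_mem[OF k b] x y(1) z(1)] .
    then show "w \<in>\<^sub>V F x" using F[OF x] z by blast
  qed
  have below: "F x \<in>\<^sub>V x \<or> F x = x" if x0: "x \<in>\<^sub>V b" for x
  proof (rule wf_set_induct[OF wf_set_mem _ x0, where Q = "\<lambda>x. F x \<in>\<^sub>V x \<or> F x = x"])
    show "definable1 (\<lambda>x. F x \<in>\<^sub>V x \<or> F x = x)" by (intro dfn definable_fun1_app[OF F_dfn])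
    fix x assume x: "x \<in>\<^sub>V b" and IH: "\<And>y. y \<in>\<^sub>V b \<Longrightarrow> y \<in>\<^sub>V x \<Longrightarrow> F y \<in>\<^sub>V y \<or> F y = y"
    show "F x \<in>\<^sub>V x \<or> F x = x"
    proof (rule transitive_subset_ordinal[OF ordinal_mem[OF k b] x trF[OF x]])
      fix v assume "v \<in>\<^sub>V F x"
      then obtain y where y: "y \<in>\<^sub>V x" "v = F y" using F[OF x] by blast
      have "F y \<in>\<^sub>V y \<or> F y = y" using IH[OF tr[OF x y(1)] y(1)] .
      then show "v \<in>\<^sub>V x" using y ordinal_trans'[OF ordinal_mem[OF k b] x y(1)] by auto
    qed
  qed
  define c where "c = vset (F ` elts S)"
  have c: "v \<in>\<^sub>V c \<longleftrightarrow> (\<exists>x. x \<in>\<^sub>V S \<and> v = F x)" for v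
    unfolding c_def by (simp add: mem_vset replacement[OF F_dfn] image_iff)
  have "c \<in>\<^sub>V b \<or> c = b"
  proof (rule transitive_subset_ordinal[OF k b])
    show "transitive c" unfolding transitive_def c using F S by blast
    fix v assume "v \<in>\<^sub>V c"
    then obtain x where x: "x \<in>\<^sub>V b" "v = F x" using c S by blast
    then show "v \<in>\<^sub>V b" using below[OF x(1)] tr by auto
  qed
  then have ck: "c \<in>\<^sub>V k" using b ordinal_trans[OF k b] by blast
  have inj: "x = y" if "x \<in>\<^sub>V S" "y \<in>\<^sub>V S" "F x = F y" for x y
  proof (rule ccontr)
    assume "x \<noteq> y"
    then have "x \<in>\<^sub>V y \<or> y \<in>\<^sub>V x" using ordinal_linear[OF ordinal_mem[OF k b], of x y] that S by blast
    then have "F x \<in>\<^sub>V F y \<or> F y \<in>\<^sub>V F x" using F S that by blast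
    then show False using that(3) mem_irrefl by auto
  qed
  have hinj: "x = y" if "x \<in>\<^sub>V S" "y \<in>\<^sub>V S" "h x = h y" for x y
    using ordinal_linear[OF ordinal_mem[OF k b], of x y] that S by metis
  define i where "i v = the_one (\<lambda>x. x \<in>\<^sub>V S \<and> h x = v)" for v
  have i_dfn: "definable_fun1 i" unfolding i_def by (intro dfn definable_fun1_app[OF h])
  have i_h: "i (h x) = x" if "x \<in>\<^sub>V S" for x
    unfolding i_def by (rule the_one_eq) (use that hinj in blast)+
  have surj: "\<exists>y. y \<in>\<^sub>V S \<and> h y = h x" if x: "x \<in>\<^sub>V b" for x
  proof -
    have d: "definable1 (\<lambda>y. h y = h x)" by (intro dfn definable_fun1_app[OF h])
    obtain m where m: "m \<in>\<^sub>V b" "h m = h x" "\<And>y. y \<in>\<^sub>V b \<Longrightarrow> y \<in>\<^sub>V m \<Longrightarrow> h y \<noteq> h x"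
      by (rule wf_set_minimal[where Q = "\<lambda>y. h y = h x", OF wf_set_mem d x refl]) blast
    then have "m \<in>\<^sub>V S" unfolding S using tr by metis
    with m show ?thesis by blast
  qed
  define X where "X = vset (h ` elts b)"
  have X: "elts X = h ` elts b" unfolding X_def by (rule elts_vset[OF replacement[OF h]])
  define f where "f = graph (\<lambda>v. F (i v)) (elts X)"
  have Fi_dfn: "definable_fun1 (\<lambda>v. F (i v))"
    by (intro definable_fun1_app[OF F_dfn] definable_fun1_app[OF i_dfn] dfn)
  have XS: "elts X = h ` elts S"
  proof -
    have "h ` elts b \<subseteq> h ` elts S"
    proof
      fix v assume "v \<in> h ` elts b"
      then obtain x where "x \<in>\<^sub>V b" "v = h x" by auto
      with surj[of x] obtain y where "y \<in>\<^sub>V S" "v = h y" by auto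
      then show "v \<in> h ` elts S" by auto
    qed
    moreover have "h ` elts S \<subseteq> h ` elts b" using S by auto
    ultimately show ?thesis unfolding X by blast
  qed
  have fh: "app f (h x) = F x" if "x \<in>\<^sub>V S" for x
  proof -
    have "h x \<in>\<^sub>V X" using that XS elts_iff[of "h x" X] by auto
    then show ?thesis unfolding f_def using app_graph[OF Fi_dfn] i_h[OF that] by simp
  qed
  have "bij_betw (app f) (elts X) (elts c)"
    unfolding bij_betw_def
  proof
    show "inj_on (app f) (elts X)" unfolding XS inj_on_def by (auto simp: fh dest: inj)
    have "app f ` elts X = F ` elts S" unfolding XS image_image by (rule image_cong) (simp_all add: fh)
    then show "app f ` elts X = elts c" unfolding c_def elts_vset[OF replacement[OF F_dfn]] .
  qed
  moreover have "fun_on f X" unfolding f_def by (rule fun_on_graph[OF Fi_dfn])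
  ultimately show ?thesis unfolding card_less_def bijection_def X_def[symmetric] using ck by auto
qed

lemma sat_Upair_fm: "sat UNIV (\<in>\<^sub>V) e (Upair_fm a b c) \<longleftrightarrow> e c = upair (e a) (e b)"
proof -
  have "sat UNIV (\<in>\<^sub>V) e (Upair_fm a b c) \<longleftrightarrow> (\<forall>x. x \<in>\<^sub>V e c \<longleftrightarrow> x = e a \<or> x = e b)"
    unfolding Upair_fm_def by auto
  also have "\<dots> \<longleftrightarrow> e c = upair (e a) (e b)" using upair_eqI mem_upair by metis
  finally show ?thesis .
qed

lemma sat_Pair_fm: "sat UNIV (\<in>\<^sub>V) e (Pair_fm a b c) \<longleftrightarrow> e c = \<langle>e a, e b\<rangle>"
  unfolding Pair_fm_def opair_def by (simp add: sat_Upair_fm)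

lemma sat_Rel_fm: "sat UNIV (\<in>\<^sub>V) e (Rel_fm a b r) \<longleftrightarrow> \<langle>e a, e b\<rangle> \<in>\<^sub>V e r"
  unfolding Rel_fm_def by (simp add: sat_Pair_fm)

lemma sat_Bij_fm:
  "sat UNIV (\<in>\<^sub>V) e (Bij_fm f a b) \<longleftrightarrow>
   (\<forall>z. z \<in>\<^sub>V e f \<longrightarrow> (\<exists>x. x \<in>\<^sub>V e a \<and> (\<exists>y. y \<in>\<^sub>V e b \<and> z = \<langle>x, y\<rangle>))) \<and>
   (\<forall>x. x \<in>\<^sub>V e a \<longrightarrow> (\<exists>y. \<langle>x, y\<rangle> \<in>\<^sub>V e f \<and> (\<forall>z. \<langle>x, z\<rangle> \<in>\<^sub>V e f \<longrightarrow> z = y))) \<and>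
   (\<forall>y. y \<in>\<^sub>V e b \<longrightarrow> (\<exists>x. \<langle>x, y\<rangle> \<in>\<^sub>V e f \<and> (\<forall>z. \<langle>z, y\<rangle> \<in>\<^sub>V e f \<longrightarrow> z = x)))"
  unfolding Bij_fm_def Fun_fm_def
  by (simp add: sat_Pair_fm sat_Rel_fm numeral_2_eq_2 numeral_3_eq_3)

lemma sat_Ord_fm: "sat UNIV (\<in>\<^sub>V) e (Ord_fm a) \<longleftrightarrow> ordinal (e a)"
  unfolding Ord_fm_def Trans_fm_def ordinal_def transitive_def by (simp add: numeral_2_eq_2)

lemma infinite_cardinal_ordinal: "infinite_cardinal k \<Longrightarrow> ordinal k"
  unfolding infinite_cardinal_def InfCard_fm_def sat.simps(4) sat_Ord_fm by (rule conjunct1)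

text \<open>A cardinal does not inject into a smaller ordinal.\<close>

lemma infinite_cardinal_image:
  assumes k: "infinite_cardinal k" and f: "definable_fun1 f" and inj: "inj_on f (elts k)"
  shows "\<not> card_less (vset (f ` elts k)) k"
proof
  define A where "A = vset (f ` elts k)"
  have A: "elts A = f ` elts k" unfolding A_def by (rule elts_vset[OF replacement[OF f]])
  assume "card_less (vset (f ` elts k)) k"
  then obtain b g where b: "b \<in>\<^sub>V k" and g: "fun_on g A" "bij_betw (app g) (elts A) (elts b)"
    unfolding card_less_def bijection_def A_def by auto
  define F where "F x = ap g (f x)" for x
  have F_dfn: "definable_fun1 F" unfolding F_def by (intro dfn definable_fun1_app[OF f])
  have "bij_betw f (elts k) (elts A)" using inj unfolding bij_betw_def A by simp
  then have "bij_betw (app g \<circ> f) (elts k) (elts b)" using g(2) by (rule bij_betw_trans)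
  moreover have "(app g \<circ> f) x = F x" if "x \<in> elts k" for x
    unfolding F_def comp_def using app_eq_ap[OF g(1)] A that by blast
  ultimately have F: "bij_betw F (elts k) (elts b)" using bij_betw_cong by metis
  define j where "j = vset ((\<lambda>x. \<langle>F x, x\<rangle>) ` elts k)"
  have j: "z \<in>\<^sub>V j \<longleftrightarrow> (\<exists>x. x \<in>\<^sub>V k \<and> z = \<langle>F x, x\<rangle>)" for z
  proof -
    have "isset ((\<lambda>x. \<langle>F x, x\<rangle>) ` elts k)" by (intro replacement dfn definable_fun1_app[OF F_dfn])
    then show ?thesis unfolding j_def by (simp add: mem_vset image_iff)
  qed
  have Fb: "F x \<in>\<^sub>V b" if "x \<in>\<^sub>V k" for x using F that bij_betwE by fastforce
  have Fi: "x = y" if "x \<in>\<^sub>V k" "y \<in>\<^sub>V k" "F x = F y" for x y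
    using F that unfolding bij_betw_def inj_on_def by auto
  have Fs: "\<exists>x. x \<in>\<^sub>V k \<and> y = F x" if "y \<in>\<^sub>V b" for y
  proof -
    have "y \<in> F ` elts k" using F that unfolding bij_betw_def by simp
    then show ?thesis by auto
  qed
  have "sat UNIV (\<in>\<^sub>V) (case_nat j (case_nat b (\<lambda>_. k))) (Bij_fm 0 1 2)"
    unfolding sat_Bij_fm by (simp add: j numeral_2_eq_2) (use Fb Fi Fs in blast)
  moreover have "\<not> sat UNIV (\<in>\<^sub>V) (case_nat j (case_nat b (\<lambda>_. k))) (Bij_fm 0 1 2)"
  proof -
    have "sat UNIV (\<in>\<^sub>V) (\<lambda>_. k) (BAll 0 (Neg (Ex (Bij_fm 0 1 (0 + 2)))))"
      using k unfolding infinite_cardinal_def InfCard_fm_def sat.simps(4) by blast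
    then show ?thesis using b by (simp add: numeral_2_eq_2)
  qed
  ultimately show False by (rule notE[rotated])
qed

end


section \<open>Names and forced equality\<close>

locale forcing_model = forcing_data mem P le Gr Fl + zfc_model mem
  for mem :: "'v \<Rightarrow> 'v \<Rightarrow> bool" (infix "\<in>\<^sub>V" 50) and P le Gr Fl :: 'v +
  assumes forcing_notion: forcing_notion
begin

abbreviation forces_mem :: "'v \<Rightarrow> 'v \<Rightarrow> 'v \<Rightarrow> bool" where
  "forces_mem \<equiv> forces_mem_by forces_eq"

lemma leq_refl: "p \<in>\<^sub>V P \<Longrightarrow> p \<preceq> p"
  and leq_trans: "p \<preceq> q \<Longrightarrow> q \<preceq> r \<Longrightarrow> p \<in>\<^sub>V P \<Longrightarrow> q \<in>\<^sub>V P \<Longrightarrow> r \<in>\<^sub>V P \<Longrightarrow> p \<preceq> r"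
  using forcing_notion unfolding forcing_notion_def ball_elts by blast+

lemma definable_leq [dfn]:
  "definable_term s \<Longrightarrow> definable_term t \<Longrightarrow> definable (\<lambda>e. s e \<preceq> t e)"
  unfolding leq_def by (intro dfn)

lemma definable_compatible [dfn]:
  assumes "definable_term s" "definable_term t" shows "definable (\<lambda>e. compatible (s e) (t e))"
  by (rule definable2_app[OF _ assms]) (unfold compatible_def, intro dfn)

lemma definable_name_closed: "definable1 name_closed"
  unfolding name_closed_def by (intro dfn)

lemma definable_name [dfn]:
  assumes "definable_term t" shows "definable (\<lambda>e. name (t e))"
  by (rule definable1_app[OF _ assms]) (unfold name_def, intro dfn definable1_app[OF definable_name_closed])

lemma definable_forces_eq [dfn]:
  assumes "definable_term s" "definable_term t" "definable_term u"
  shows "definable (\<lambda>e. forces_eq (s e) (t e) (u e))"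
  by (rule definable3_app[OF _ assms], unfold forces_eq_def Let_def forces_sub_by_def forces_mem_by_def dense_below_def)
    (intro dfn definable1_app[OF definable_name_closed])

lemma definable_forces_mem [dfn]:
  assumes "definable_term s" "definable_term t" "definable_term u"
  shows "definable (\<lambda>e. forces_mem (s e) (t e) (u e))"
  by (rule definable3_app[OF _ assms], unfold forces_mem_by_def dense_below_def) (intro dfn)

lemma name_closedD:
  "name_closed N \<Longrightarrow> x \<in>\<^sub>V N \<Longrightarrow> z \<in>\<^sub>V x \<Longrightarrow> \<exists>p y. p \<in>\<^sub>V P \<and> y \<in>\<^sub>V N \<and> z = \<langle>p, y\<rangle>"
  unfolding name_closed_def ball_elts bex_elts by blast

lemma name_closed_opair:
  "name_closed N \<Longrightarrow> x \<in>\<^sub>V N \<Longrightarrow> \<langle>p, y\<rangle> \<in>\<^sub>V x \<Longrightarrow> p \<in>\<^sub>V P \<and> y \<in>\<^sub>V N"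
  using name_closedD[of N x "\<langle>p, y\<rangle>"] by auto

lemma nameI: "name_closed N \<Longrightarrow> x \<in>\<^sub>V N \<Longrightarrow> name x"
  unfolding name_def by blast

lemma name_opair: "name x \<Longrightarrow> \<langle>p, y\<rangle> \<in>\<^sub>V x \<Longrightarrow> p \<in>\<^sub>V P \<and> name y"
  unfolding name_def using name_closed_opair by blast

lemma name_cond: "name x \<Longrightarrow> \<langle>p, y\<rangle> \<in>\<^sub>V x \<Longrightarrow> p \<in>\<^sub>V P"
  and name_name: "name x \<Longrightarrow> \<langle>p, y\<rangle> \<in>\<^sub>V x \<Longrightarrow> name y"
  using name_opair by blast+

lemma name_elem: "name x \<Longrightarrow> z \<in>\<^sub>V x \<Longrightarrow> \<exists>p y. z = \<langle>p, y\<rangle> \<and> p \<in>\<^sub>V P \<and> name y"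
  unfolding name_def using name_closedD by blast

text \<open>The relation along which the recursions on names run.\<close>

definition appears :: "'v \<Rightarrow> 'v \<Rightarrow> bool" where
  "appears y x \<longleftrightarrow> (\<exists>p. \<langle>p, y\<rangle> \<in>\<^sub>V x)"

lemma definable_appears [dfn]:
  "definable_term s \<Longrightarrow> definable_term t \<Longrightarrow> definable (\<lambda>e. appears (s e) (t e))"
  by (rule definable2_app[of appears]) (unfold appears_def, intro dfn)

text \<open>A set of names is closed off under the steps from \<open>y\<close> to \<open>{p, y}\<close> to \<open>\<langle>p, y\<rangle>\<close>; a minimal
  element of the result is a name in the set in which no member of the set appears.\<close>

lemma wf_set_appears: assumes N: "name_closed N" shows "wf_set N appears"
  unfolding wf_set_def
proof (intro allI impI)
  fix A assume A: "elts A \<subseteq> elts N \<and> elts A \<noteq> {}"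
  define T where "T = Times P A"
  have T: "z \<in>\<^sub>V T \<longleftrightarrow> (\<exists>p y. p \<in>\<^sub>V P \<and> y \<in>\<^sub>V A \<and> z = \<langle>p, y\<rangle>)" for z
    unfolding T_def by (rule mem_Times)
  define U where "U = vset (\<Union>y\<in>elts T. elts y)"
  have U: "z \<in>\<^sub>V U \<longleftrightarrow> (\<exists>y. y \<in>\<^sub>V T \<and> z \<in>\<^sub>V y)" for z
    unfolding U_def by (simp add: mem_vset isset_Union)
  define C where "C = {z \<in> elts U. \<exists>p y. y \<in>\<^sub>V A \<and> z = upair p y}"
  have C: "isset C" unfolding C_def by (rule separation) (intro dfn)
  define B where "B = vset ((elts A \<union> elts T) \<union> C)"
  have B: "z \<in>\<^sub>V B \<longleftrightarrow> z \<in>\<^sub>V A \<or> z \<in>\<^sub>V T \<or> z \<in> C" for z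
    unfolding B_def by (simp add: mem_vset isset_Un isset_elts C)
  have "elts B \<noteq> {}" using A B by auto
  then obtain m where m: "m \<in>\<^sub>V B" "\<And>y. y \<in>\<^sub>V m \<Longrightarrow> \<not> y \<in>\<^sub>V B"
    using foundation[of B] unfolding bex_elts ball_elts elts_iff by blast
  have pair: "upair p y \<in>\<^sub>V \<langle>p, y\<rangle>" for p y unfolding opair_def mem_upair by simp
  have "m \<notin> C"
  proof
    assume "m \<in> C"
    then obtain p y where "y \<in>\<^sub>V A" "m = upair p y" unfolding C_def by blast
    then show False using m(2)[of y] B by (simp add: mem_upair)
  qed
  moreover have "\<not> m \<in>\<^sub>V T"
  proof
    assume mT: "m \<in>\<^sub>V T"
    then obtain p y where py: "y \<in>\<^sub>V A" "m = \<langle>p, y\<rangle>" using T by blast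
    then have "upair p y \<in> C" unfolding C_def using mT U pair by auto
    then show False using m(2)[of "upair p y"] B py pair by simp
  qed
  ultimately have mA: "m \<in>\<^sub>V A" using m(1) B by blast
  have "\<not> appears y m" if "y \<in>\<^sub>V A" for y
  proof
    assume "appears y m"
    then obtain p where p: "\<langle>p, y\<rangle> \<in>\<^sub>V m" unfolding appears_def by blast
    have "m \<in>\<^sub>V N" using A mA by auto
    then have "\<langle>p, y\<rangle> \<in>\<^sub>V T" using name_closed_opair[OF N _ p] that T by blast
    then show False using m(2)[OF p] B by blast
  qed
  with mA show "\<exists>x\<in>elts A. \<forall>y\<in>elts A. \<not> appears y x" by auto
qed

lemma name_induct:
  assumes Q: "definable1 Q" and x: "name x"
    and step: "\<And>x. name x \<Longrightarrow> (\<And>y. appears y x \<Longrightarrow> Q y) \<Longrightarrow> Q x"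
  shows "Q x"
proof -
  obtain N where N: "name_closed N" "x \<in>\<^sub>V N" using x unfolding name_def by blast
  show ?thesis
  proof (rule wf_set_induct[OF wf_set_appears[OF N(1)] Q N(2)])
    fix u assume u: "u \<in>\<^sub>V N" and IH: "\<And>y. y \<in>\<^sub>V N \<Longrightarrow> appears y u \<Longrightarrow> Q y"
    show "Q u"
      by (rule step[OF nameI[OF N(1) u]]) (use IH name_closed_opair[OF N(1) u] in \<open>unfold appears_def, blast\<close>)
  qed
qed

lemma name_closed_Un:
  assumes "name_closed N" "name_closed M"
  obtains K where "name_closed K" "\<And>x. x \<in>\<^sub>V K \<longleftrightarrow> x \<in>\<^sub>V N \<or> x \<in>\<^sub>V M"
proof -
  define K where "K = vset (elts N \<union> elts M)"
  have K: "x \<in>\<^sub>V K \<longleftrightarrow> x \<in>\<^sub>V N \<or> x \<in>\<^sub>V M" for x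
    unfolding K_def by (simp add: mem_vset isset_Un isset_elts)
  have "name_closed K" using assms unfolding name_closed_def ball_elts bex_elts K by blast
  with K show ?thesis using that by blast
qed

lemma forces_sub_by_mono:
  assumes "\<And>s a b. s \<in>\<^sub>V P \<Longrightarrow> appears a u \<Longrightarrow> appears b v \<Longrightarrow> E s a b \<Longrightarrow> E' s a b"
    and "forces_sub_by E q u v"
  shows "forces_sub_by E' q u v"
  using assms unfolding forces_sub_by_def forces_mem_by_def dense_below_def appears_def mem_Collect_eq
    ball_elts bex_elts by meson

lemma forces_sub_by_cong:
  assumes "\<And>s a b. s \<in>\<^sub>V P \<Longrightarrow> appears a u \<Longrightarrow> appears b v \<Longrightarrow> E s a b \<longleftrightarrow> E' s a b"
  shows "forces_sub_by E q u v \<longleftrightarrow> forces_sub_by E' q u v"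
  by (rule iffI; erule forces_sub_by_mono[rotated]) (simp_all add: assms)

text \<open>The recursion in the definition of \<open>forces_eq\<close>, on a closed set \<open>N\<close> of names.\<close>

definition eq_solution :: "'v \<Rightarrow> ('v \<Rightarrow> 'v \<Rightarrow> 'v \<Rightarrow> bool) \<Rightarrow> bool" where
  "eq_solution N E \<longleftrightarrow> name_closed N \<and> (\<forall>q u v. q \<in>\<^sub>V P \<longrightarrow> u \<in>\<^sub>V N \<longrightarrow> v \<in>\<^sub>V N \<longrightarrow>
     (E q u v \<longleftrightarrow> forces_sub_by E q u v \<and> forces_sub_by E q v u))"

abbreviation "rel_of F \<equiv> (\<lambda>q u v. \<langle>q, \<langle>u, v\<rangle>\<rangle> \<in>\<^sub>V F)"

lemma forces_eq_solution:
  "forces_eq p x y \<longleftrightarrow> (\<exists>N F. eq_solution N (rel_of F) \<and> x \<in>\<^sub>V N \<and> y \<in>\<^sub>V N \<and> \<langle>p, \<langle>x, y\<rangle>\<rangle> \<in>\<^sub>V F)"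
  unfolding forces_eq_def eq_solution_def Let_def ball_elts by blast

lemma eq_solutionD:
  "eq_solution N E \<Longrightarrow> q \<in>\<^sub>V P \<Longrightarrow> u \<in>\<^sub>V N \<Longrightarrow> v \<in>\<^sub>V N \<Longrightarrow>
   E q u v \<longleftrightarrow> forces_sub_by E q u v \<and> forces_sub_by E q v u"
  unfolding eq_solution_def by blast

lemma eq_solution_appears: "eq_solution N E \<Longrightarrow> u \<in>\<^sub>V N \<Longrightarrow> appears a u \<Longrightarrow> a \<in>\<^sub>V N"
  unfolding eq_solution_def appears_def using name_closed_opair by blast

text \<open>The recursion for the pair \<open>(u, v)\<close> refers both to pairs in the same and in the opposite
  order, so the induction on \<open>u\<close> treats \<open>(u, v)\<close> and \<open>(v, u)\<close> at once.\<close>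

lemma eq_solution_unique:
  assumes F: "eq_solution N (rel_of F)" and F': "eq_solution N' (rel_of F')"
    and "u \<in>\<^sub>V N" "u \<in>\<^sub>V N'" "v \<in>\<^sub>V N" "v \<in>\<^sub>V N'" "q \<in>\<^sub>V P"
  shows "rel_of F q u v \<longleftrightarrow> rel_of F' q u v"
proof -
  define Q where "Q u \<longleftrightarrow> (u \<in>\<^sub>V N \<longrightarrow> u \<in>\<^sub>V N' \<longrightarrow> (\<forall>v q. v \<in>\<^sub>V N \<longrightarrow> v \<in>\<^sub>V N' \<longrightarrow> q \<in>\<^sub>V P \<longrightarrow>
      (rel_of F q u v \<longleftrightarrow> rel_of F' q u v) \<and> (rel_of F q v u \<longleftrightarrow> rel_of F' q v u)))" for u
  have "definable1 Q" unfolding Q_def by (intro dfn)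
  moreover have "name u" using F assms(3) nameI unfolding eq_solution_def by blast
  ultimately have "Q u"
  proof (rule name_induct)
    fix u assume "name u" and IH: "\<And>y. appears y u \<Longrightarrow> Q y"
    show "Q u" unfolding Q_def
    proof (intro impI allI)
      fix v q assume uv: "u \<in>\<^sub>V N" "u \<in>\<^sub>V N'" "v \<in>\<^sub>V N" "v \<in>\<^sub>V N'" and q: "q \<in>\<^sub>V P"
      have *: "rel_of F s a b \<longleftrightarrow> rel_of F' s a b" "rel_of F s b a \<longleftrightarrow> rel_of F' s b a"
        if "s \<in>\<^sub>V P" "appears a u" "appears b v" for s a b
        using IH[OF that(2)] that(1)
          eq_solution_appears[OF F uv(1) that(2)] eq_solution_appears[OF F' uv(2) that(2)]
          eq_solution_appears[OF F uv(3) that(3)] eq_solution_appears[OF F' uv(4) that(3)]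
        unfolding Q_def by blast+
      have "forces_sub_by (rel_of F) q u v \<longleftrightarrow> forces_sub_by (rel_of F') q u v"
        "forces_sub_by (rel_of F) q v u \<longleftrightarrow> forces_sub_by (rel_of F') q v u"
        by (rule forces_sub_by_cong, simp add: *)+
      then show "(rel_of F q u v \<longleftrightarrow> rel_of F' q u v) \<and> (rel_of F q v u \<longleftrightarrow> rel_of F' q v u)"
        using eq_solutionD[OF F q uv(1,3)] eq_solutionD[OF F q uv(3,1)]
          eq_solutionD[OF F' q uv(2,4)] eq_solutionD[OF F' q uv(4,2)] by blast
    qed
  qed
  then show ?thesis using assms unfolding Q_def by blast
qed

text \<open>A set of conditions is assigned to each pair of names by recursion on the pairs. The
  recursion goes from \<open>(u, v)\<close> to pairs of names appearing in them, in either order. This relation is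
  well-founded: if \<open>m\<close> is minimal among the names occurring in the pairs of a set, every step from a
  pair with \<open>m\<close> leads to a pair in which a name appearing in \<open>m\<close> occurs, and so out of the set.\<close>

lemma eq_solution_exists:
  assumes N: "name_closed N" obtains F where "eq_solution N (rel_of F)"
proof -
  define R where "R z' z \<longleftrightarrow> (\<exists>u v a b. z = \<langle>u, v\<rangle> \<and> z' = \<langle>a, b\<rangle> \<and>
      ((appears a u \<and> appears b v) \<or> (appears a v \<and> appears b u)))" for z' z
  define E where "E g s a b \<longleftrightarrow> s \<in>\<^sub>V ap g \<langle>a, b\<rangle>" for g s a b
  define H where "H z g = vset {q. q \<in>\<^sub>V P \<and> (\<exists>u v. z = \<langle>u, v\<rangle> \<and>
      forces_sub_by (E g) q u v \<and> forces_sub_by (E g) q v u)}" for z g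
  define NN where "NN = Times N N"
  have NN: "z \<in>\<^sub>V NN \<longleftrightarrow> (\<exists>u v. u \<in>\<^sub>V N \<and> v \<in>\<^sub>V N \<and> z = \<langle>u, v\<rangle>)" for z
    unfolding NN_def by (rule mem_Times)
  have wf: "wf_set NN R" unfolding wf_set_def
  proof (intro allI impI)
    fix A assume A: "elts A \<subseteq> elts NN \<and> elts A \<noteq> {}"
    define Q where "Q u \<longleftrightarrow> (\<exists>v. \<langle>u, v\<rangle> \<in>\<^sub>V A \<or> \<langle>v, u\<rangle> \<in>\<^sub>V A)" for u
    have Q: "definable1 Q" unfolding Q_def by (intro dfn)
    obtain z where z: "z \<in>\<^sub>V A" using A by auto
    then obtain u v where u: "u \<in>\<^sub>V N" "z = \<langle>u, v\<rangle>" using A NN by auto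
    then have "Q u" using z unfolding Q_def by blast
    then obtain m where m: "m \<in>\<^sub>V N" "Q m" "\<And>y. y \<in>\<^sub>V N \<Longrightarrow> appears y m \<Longrightarrow> \<not> Q y"
      using wf_set_minimal[OF wf_set_appears[OF N] Q u(1)] by blast
    have no: "\<not> Q a" if "appears a m" for a
      using m(3) that name_closed_opair[OF N m(1)] unfolding appears_def by blast
    obtain v where v: "\<langle>m, v\<rangle> \<in>\<^sub>V A \<or> \<langle>v, m\<rangle> \<in>\<^sub>V A" using m(2) unfolding Q_def by blast
    have "\<not> R z' \<langle>m, v\<rangle> \<and> \<not> R z' \<langle>v, m\<rangle>" if "z' \<in>\<^sub>V A" for z'
      using no that unfolding R_def Q_def by (metis opair_eq)
    with v show "\<exists>x\<in>elts A. \<forall>y\<in>elts A. \<not> R y x" by auto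
  qed
  have R_dfn: "definable2 R" unfolding R_def by (intro dfn)
  have H_dfn: "definable_fun2 H"
    unfolding H_def forces_sub_by_def forces_mem_by_def dense_below_def E_def by (intro dfn)
  obtain f where f_dfn: "definable_fun1 f" and
    f: "\<And>z. z \<in>\<^sub>V NN \<Longrightarrow> f z = H z (graph f {y \<in> elts NN. R y z})"
    by (rule recursion[OF wf R_dfn H_dfn]) blast
  define F where "F = vset {z \<in> elts (Times P NN). \<exists>q w. z = \<langle>q, w\<rangle> \<and> q \<in>\<^sub>V f w}"
  have F: "\<langle>q, w\<rangle> \<in>\<^sub>V F \<longleftrightarrow> q \<in>\<^sub>V P \<and> w \<in>\<^sub>V NN \<and> q \<in>\<^sub>V f w" for q w
  proof -
    have "isset {z \<in> elts (Times P NN). \<exists>q w. z = \<langle>q, w\<rangle> \<and> q \<in>\<^sub>V f w}"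
      by (rule separation) (intro dfn definable_fun1_app[OF f_dfn])
    note mem_vset[OF this, of "\<langle>q, w\<rangle>"]
    then show ?thesis unfolding F_def by simp
  qed
  have "rel_of F q u v \<longleftrightarrow> forces_sub_by (rel_of F) q u v \<and> forces_sub_by (rel_of F) q v u"
    if q: "q \<in>\<^sub>V P" and u: "u \<in>\<^sub>V N" and v: "v \<in>\<^sub>V N" for q u v
  proof -
    define g where "g = graph f {y \<in> elts NN. R y \<langle>u, v\<rangle>}"
    have iss: "isset {y \<in> elts NN. R y \<langle>u, v\<rangle>}" by (rule separation) (intro dfn definable2_app[OF R_dfn])
    have g: "E g s a b \<longleftrightarrow> rel_of F s a b" if "s \<in>\<^sub>V P" "R \<langle>a, b\<rangle> \<langle>u, v\<rangle>" for s a b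
    proof -
      have ab: "a \<in>\<^sub>V N" "b \<in>\<^sub>V N"
        using that(2) name_closed_opair[OF N u] name_closed_opair[OF N v] unfolding R_def appears_def by auto
      then have "ap g \<langle>a, b\<rangle> = f \<langle>a, b\<rangle>" unfolding g_def
        by (intro ap_graph[OF f_dfn iss]) (simp add: that(2) NN)
      then show ?thesis unfolding E_def F using that(1) ab NN by auto
    qed
    have uv: "forces_sub_by (E g) q u v \<longleftrightarrow> forces_sub_by (rel_of F) q u v"
      "forces_sub_by (E g) q v u \<longleftrightarrow> forces_sub_by (rel_of F) q v u"
      by (rule forces_sub_by_cong, rule g, simp, simp add: R_def)+
    have "isset {q \<in> elts P. forces_sub_by (E g) q u v \<and> forces_sub_by (E g) q v u}"
      unfolding forces_sub_by_def forces_mem_by_def dense_below_def E_def by (rule separation) (intro dfn)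
    moreover have "{q \<in> elts P. forces_sub_by (E g) q u v \<and> forces_sub_by (E g) q v u} =
      {q. q \<in>\<^sub>V P \<and> (\<exists>a b. \<langle>u, v\<rangle> = \<langle>a, b\<rangle> \<and> forces_sub_by (E g) q a b \<and> forces_sub_by (E g) q b a)}"
      by auto
    ultimately have "q \<in>\<^sub>V f \<langle>u, v\<rangle> \<longleftrightarrow> forces_sub_by (E g) q u v \<and> forces_sub_by (E g) q v u"
      using f[of "\<langle>u, v\<rangle>"] u v q unfolding H_def g_def[symmetric] NN by (auto simp: mem_vset)
    then show ?thesis unfolding F uv using q u v NN by blast
  qed
  then have "eq_solution N (rel_of F)" unfolding eq_solution_def using N by blast
  then show ?thesis by (rule that)
qed

text \<open>By uniqueness and existence, \<open>forces_eq\<close> satisfies the recursion equation for all names, and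
  not just one of its solutions on one set of names.\<close>

lemma forces_eq_unfold:
  assumes p: "p \<in>\<^sub>V P" and x: "name x" and y: "name y"
  shows "forces_eq p x y \<longleftrightarrow> forces_sub_by forces_eq p x y \<and> forces_sub_by forces_eq p y x"
proof -
  obtain N where N: "name_closed N" "x \<in>\<^sub>V N" using x unfolding name_def by blast
  obtain M where M: "name_closed M" "y \<in>\<^sub>V M" using y unfolding name_def by blast
  obtain K where K: "name_closed K" "\<And>x. x \<in>\<^sub>V K \<longleftrightarrow> x \<in>\<^sub>V N \<or> x \<in>\<^sub>V M"
    by (rule name_closed_Un[OF N(1) M(1)]) blast
  obtain F where F: "eq_solution K (rel_of F)" by (rule eq_solution_exists[OF K(1)])
  have eq: "forces_eq q u v \<longleftrightarrow> rel_of F q u v" if "q \<in>\<^sub>V P" "u \<in>\<^sub>V K" "v \<in>\<^sub>V K" for q u v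
    using F eq_solution_unique[OF F] that unfolding forces_eq_solution by metis
  have xy: "x \<in>\<^sub>V K" "y \<in>\<^sub>V K" using K(2) N M by blast+
  have "forces_sub_by forces_eq p x y \<longleftrightarrow> forces_sub_by (rel_of F) p x y"
    "forces_sub_by forces_eq p y x \<longleftrightarrow> forces_sub_by (rel_of F) p y x"
    by (rule forces_sub_by_cong, rule eq, assumption, (erule eq_solution_appears[OF F, rotated], rule xy)+)+
  then show ?thesis using eq[OF p xy] eq_solutionD[OF F p xy] by blast
qed

lemma forces_mem_iff:
  "forces_mem p x y \<longleftrightarrow> (\<forall>q. q \<in>\<^sub>V P \<longrightarrow> q \<preceq> p \<longrightarrow>
     (\<exists>s t w. s \<in>\<^sub>V P \<and> s \<preceq> q \<and> \<langle>t, w\<rangle> \<in>\<^sub>V y \<and> s \<preceq> t \<and> forces_eq s x w))"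
  unfolding forces_mem_by_def dense_below_def by auto

lemma forces_memI:
  "(\<And>q. q \<in>\<^sub>V P \<Longrightarrow> q \<preceq> p \<Longrightarrow>
     \<exists>s t w. s \<in>\<^sub>V P \<and> s \<preceq> q \<and> \<langle>t, w\<rangle> \<in>\<^sub>V y \<and> s \<preceq> t \<and> forces_eq s x w) \<Longrightarrow> forces_mem p x y"
  unfolding forces_mem_iff by blast

lemma forces_memE:
  assumes "forces_mem p x y" "q \<in>\<^sub>V P" "q \<preceq> p"
  obtains s t w where "s \<in>\<^sub>V P" "s \<preceq> q" "\<langle>t, w\<rangle> \<in>\<^sub>V y" "s \<preceq> t" "forces_eq s x w"
  using assms unfolding forces_mem_iff by blast

lemma forces_eqI:
  assumes "p \<in>\<^sub>V P" "name x" "name y"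
    and "\<And>r z q. \<langle>r, z\<rangle> \<in>\<^sub>V x \<Longrightarrow> q \<in>\<^sub>V P \<Longrightarrow> q \<preceq> p \<Longrightarrow> q \<preceq> r \<Longrightarrow> forces_mem q z y"
    and "\<And>r z q. \<langle>r, z\<rangle> \<in>\<^sub>V y \<Longrightarrow> q \<in>\<^sub>V P \<Longrightarrow> q \<preceq> p \<Longrightarrow> q \<preceq> r \<Longrightarrow> forces_mem q z x"
  shows "forces_eq p x y"
  unfolding forces_eq_unfold[OF assms(1-3)] forces_sub_by_def using assms(4,5) by auto

lemma forces_eqD:
  assumes "forces_eq p x y" "p \<in>\<^sub>V P" "name x" "name y"
    and "\<langle>r, z\<rangle> \<in>\<^sub>V x" "q \<in>\<^sub>V P" "q \<preceq> p" "q \<preceq> r"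
  shows "forces_mem q z y"
  using assms(1) unfolding forces_eq_unfold[OF assms(2-4)] forces_sub_by_def ball_elts using assms(5-8) by blast

lemma forces_eq_sym:
  "forces_eq p x y \<Longrightarrow> p \<in>\<^sub>V P \<Longrightarrow> name x \<Longrightarrow> name y \<Longrightarrow> forces_eq p y x"
  using forces_eq_unfold by blast

lemma forces_mem_mono: "forces_mem p x y \<Longrightarrow> q \<preceq> p \<Longrightarrow> p \<in>\<^sub>V P \<Longrightarrow> q \<in>\<^sub>V P \<Longrightarrow> forces_mem q x y"
  unfolding forces_mem_iff using leq_trans by blast

lemma forces_eq_mono:
  assumes "forces_eq p x y" "q \<preceq> p" "p \<in>\<^sub>V P" "q \<in>\<^sub>V P" "name x" "name y" shows "forces_eq q x y"
proof (rule forces_eqI)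
  fix r z s assume *: "s \<in>\<^sub>V P" "s \<preceq> q" "s \<preceq> r"
  have sp: "s \<preceq> p" using leq_trans * assms by blast
  show "forces_mem s z y" if "\<langle>r, z\<rangle> \<in>\<^sub>V x" by (rule forces_eqD[OF assms(1,3,5,6) that *(1) sp *(3)])
  show "forces_mem s z x" if "\<langle>r, z\<rangle> \<in>\<^sub>V y"
    by (rule forces_eqD[OF forces_eq_sym[OF assms(1,3,5,6)] assms(3,6,5) that *(1) sp *(3)])
qed (use assms in blast)+

text \<open>A condition forces an atomic statement already if the conditions forcing it are dense
  below it. This is what makes the case distinctions below a condition work.\<close>

lemma forces_mem_dense:
  assumes "p \<in>\<^sub>V P" "\<And>q. q \<in>\<^sub>V P \<Longrightarrow> q \<preceq> p \<Longrightarrow> \<exists>s. s \<in>\<^sub>V P \<and> s \<preceq> q \<and> forces_mem s x y"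
  shows "forces_mem p x y"
proof (rule forces_memI)
  fix q assume q: "q \<in>\<^sub>V P" "q \<preceq> p"
  obtain s where s: "s \<in>\<^sub>V P" "s \<preceq> q" "forces_mem s x y" using assms(2)[OF q] by blast
  obtain u t w where "u \<in>\<^sub>V P" "u \<preceq> s" "\<langle>t, w\<rangle> \<in>\<^sub>V y" "u \<preceq> t" "forces_eq u x w"
    by (rule forces_memE[OF s(3,1) leq_refl[OF s(1)]])
  moreover have "u \<preceq> q" using calculation s q leq_trans by blast
  ultimately show "\<exists>s t w. s \<in>\<^sub>V P \<and> s \<preceq> q \<and> \<langle>t, w\<rangle> \<in>\<^sub>V y \<and> s \<preceq> t \<and> forces_eq s x w" by blast
qed

lemma forces_eq_dense:
  assumes p: "p \<in>\<^sub>V P" and n: "name x" "name y"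
    and d: "\<And>q. q \<in>\<^sub>V P \<Longrightarrow> q \<preceq> p \<Longrightarrow> \<exists>s. s \<in>\<^sub>V P \<and> s \<preceq> q \<and> forces_eq s x y"
  shows "forces_eq p x y"
proof (rule forces_eqI[OF p n])
  have main: "forces_mem q z v" if z: "\<langle>r, z\<rangle> \<in>\<^sub>V u" and q: "q \<in>\<^sub>V P" "q \<preceq> p" "q \<preceq> r"
    and uv: "name u" "name v" "\<And>q. q \<in>\<^sub>V P \<Longrightarrow> q \<preceq> p \<Longrightarrow> \<exists>s. s \<in>\<^sub>V P \<and> s \<preceq> q \<and> forces_eq s u v"
    for u v r z q
  proof (rule forces_mem_dense[OF q(1)])
    fix q' assume q': "q' \<in>\<^sub>V P" "q' \<preceq> q"
    then obtain s where s: "s \<in>\<^sub>V P" "s \<preceq> q'" "forces_eq s u v" using uv(3) q p leq_trans by blast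
    have r: "r \<in>\<^sub>V P" by (rule name_cond[OF uv(1) z])
    have "s \<preceq> r" using s q q' r leq_trans by blast
    then have "forces_mem s z v" by (rule forces_eqD[OF s(3,1) uv(1,2) z s(1) leq_refl[OF s(1)]])
    then show "\<exists>s. s \<in>\<^sub>V P \<and> s \<preceq> q' \<and> forces_mem s z v" using s by blast
  qed
  show "forces_mem q z y" if "\<langle>r, z\<rangle> \<in>\<^sub>V x" "q \<in>\<^sub>V P" "q \<preceq> p" "q \<preceq> r" for r z q
    by (rule main[OF that n d])
  show "forces_mem q z x" if "\<langle>r, z\<rangle> \<in>\<^sub>V y" "q \<in>\<^sub>V P" "q \<preceq> p" "q \<preceq> r" for r z q
    by (rule main[OF that n(2,1)]) (use d forces_eq_sym n in blast)
qed

lemma forces_eq_refl: assumes "name x" "p \<in>\<^sub>V P" shows "forces_eq p x x"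
proof -
  have "\<forall>p. p \<in>\<^sub>V P \<longrightarrow> forces_eq p x x"
  proof (rule name_induct[where Q = "\<lambda>x. \<forall>p. p \<in>\<^sub>V P \<longrightarrow> forces_eq p x x", OF _ assms(1)])
    show "definable1 (\<lambda>x. \<forall>p. p \<in>\<^sub>V P \<longrightarrow> forces_eq p x x)" by (intro dfn)
    fix x assume x: "name x" and IH: "\<And>y. appears y x \<Longrightarrow> \<forall>p. p \<in>\<^sub>V P \<longrightarrow> forces_eq p y y"
    have *: "forces_mem q z x" if z: "\<langle>r, z\<rangle> \<in>\<^sub>V x" and q: "q \<in>\<^sub>V P" "q \<preceq> r" for r z q
    proof (rule forces_memI)
      fix q' assume q': "q' \<in>\<^sub>V P" "q' \<preceq> q"
      have "q' \<preceq> r" using q' q name_cond[OF x z] leq_trans by blast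
      moreover have "forces_eq q' z z" using IH z q' unfolding appears_def by blast
      ultimately show "\<exists>s t w. s \<in>\<^sub>V P \<and> s \<preceq> q' \<and> \<langle>t, w\<rangle> \<in>\<^sub>V x \<and> s \<preceq> t \<and> forces_eq s z w"
        using z q' leq_refl by blast
    qed
    show "\<forall>p. p \<in>\<^sub>V P \<longrightarrow> forces_eq p x x"
      by (intro allI impI forces_eqI x) (assumption | rule *)+
  qed
  then show ?thesis using assms(2) by blast
qed

lemma forces_mem_opair:
  assumes "name x" "\<langle>r, z\<rangle> \<in>\<^sub>V x" "q \<in>\<^sub>V P" "q \<preceq> r" shows "forces_mem q z x"
  by (rule forces_eqD[OF forces_eq_refl[OF assms(1,3)] assms(3,1,1,2,3) leq_refl[OF assms(3)] assms(4)])

text \<open>One inclusion of \<open>x = z\<close>, given \<open>y = z\<close> and that \<open>a\<close> is in \<open>y\<close>; the last assumption is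
  the induction hypothesis of transitivity. Used for \<open>a\<close> appearing in \<open>x\<close>, and with the roles of the
  outer names exchanged.\<close>

lemma forces_eq_trans_aux:
  assumes yz: "forces_eq p y z" and p: "p \<in>\<^sub>V P" and n: "name a" "name y" "name z"
    and q: "q \<in>\<^sub>V P" "q \<preceq> p" and m: "forces_mem q a y"
    and tr: "\<And>s b c. s \<in>\<^sub>V P \<Longrightarrow> name b \<Longrightarrow> appears c z \<Longrightarrow> forces_eq s a b \<Longrightarrow> forces_eq s b c \<Longrightarrow> forces_eq s a c"
  shows "forces_mem q a z"
proof (rule forces_mem_dense[OF q(1)])
  fix q' assume q': "q' \<in>\<^sub>V P" "q' \<preceq> q"
  obtain s t b where s: "s \<in>\<^sub>V P" "s \<preceq> q'" "\<langle>t, b\<rangle> \<in>\<^sub>V y" "s \<preceq> t" "forces_eq s a b"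
    by (rule forces_memE[OF m q'])
  note nb = name_name[OF n(2) s(3)]
  have sp: "s \<preceq> p" using s q q' p leq_trans by blast
  have m': "forces_mem s b z" by (rule forces_eqD[OF yz p n(2,3) s(3,1) sp s(4)])
  have "forces_mem s a z"
  proof (rule forces_memI)
    fix v assume v: "v \<in>\<^sub>V P" "v \<preceq> s"
    obtain u t' c where u: "u \<in>\<^sub>V P" "u \<preceq> v" "\<langle>t', c\<rangle> \<in>\<^sub>V z" "u \<preceq> t'" "forces_eq u b c"
      by (rule forces_memE[OF m' v])
    have "u \<preceq> s" using u v s leq_trans by blast
    then have "forces_eq u a b" by (rule forces_eq_mono[OF s(5) _ s(1) u(1) n(1) nb])
    then have "forces_eq u a c" using tr[OF u(1) nb _ _ u(5)] u(3) unfolding appears_def by blast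
    with u show "\<exists>s t w. s \<in>\<^sub>V P \<and> s \<preceq> v \<and> \<langle>t, w\<rangle> \<in>\<^sub>V z \<and> s \<preceq> t \<and> forces_eq s a w" by blast
  qed
  with s show "\<exists>s. s \<in>\<^sub>V P \<and> s \<preceq> q' \<and> forces_mem s a z" by blast
qed

lemma forces_eq_trans:
  assumes "forces_eq p x y" "forces_eq p y z" "p \<in>\<^sub>V P" "name x" "name y" "name z"
  shows "forces_eq p x z"
proof -
  define Q where "Q x \<longleftrightarrow> (\<forall>p y z. p \<in>\<^sub>V P \<longrightarrow> name y \<longrightarrow> name z \<longrightarrow> forces_eq p x y \<longrightarrow> forces_eq p y z \<longrightarrow>
      forces_eq p x z)" for x
  have "definable1 Q" unfolding Q_def by (intro dfn)
  then have "Q x" using assms(4)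
  proof (rule name_induct)
    fix x assume x: "name x" and IH0: "\<And>y. appears y x \<Longrightarrow> Q y"
    have IH: "forces_eq s a c" if "appears a x" "forces_eq s a b" "forces_eq s b c" "s \<in>\<^sub>V P" "name b" "name c"
      for s a b c using IH0[OF that(1)] that unfolding Q_def by blast
    show "Q x" unfolding Q_def
    proof (intro allI impI)
      fix p y z assume p: "p \<in>\<^sub>V P" and yz: "name y" "name z" and xy: "forces_eq p x y" and yz': "forces_eq p y z"
      note zy = forces_eq_sym[OF yz' p yz] and yx = forces_eq_sym[OF xy p x yz(1)]
      show "forces_eq p x z"
      proof (rule forces_eqI[OF p x yz(2)])
        fix r a q assume a: "\<langle>r, a\<rangle> \<in>\<^sub>V x" and q: "q \<in>\<^sub>V P" "q \<preceq> p" "q \<preceq> r"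
        show "forces_mem q a z"
        proof (rule forces_eq_trans_aux[OF yz' p name_name[OF x a] yz q(1,2) forces_eqD[OF xy p x yz(1) a q]])
          fix s b c assume "s \<in>\<^sub>V P" "name b" "appears c z" "forces_eq s a b" "forces_eq s b c"
          then show "forces_eq s a c" using IH a yz(2) name_name unfolding appears_def by blast
        qed
      next
        fix r c q assume c: "\<langle>r, c\<rangle> \<in>\<^sub>V z" and q: "q \<in>\<^sub>V P" "q \<preceq> p" "q \<preceq> r"
        note nc = name_name[OF yz(2) c]
        show "forces_mem q c x"
        proof (rule forces_eq_trans_aux[OF yx p nc yz(1) x q(1,2) forces_eqD[OF zy p yz(2,1) c q]])
          fix s b a assume s: "s \<in>\<^sub>V P" and nb: "name b" and a: "appears a x"
            and eqs: "forces_eq s c b" "forces_eq s b a"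
          have na: "name a" using a x name_name unfolding appears_def by blast
          have "forces_eq s a c"
            by (rule IH[OF a forces_eq_sym[OF eqs(2) s nb na] forces_eq_sym[OF eqs(1) s nc nb] s nb nc])
          then show "forces_eq s c a" by (rule forces_eq_sym[OF _ s na nc])
        qed
      qed
    qed
  qed
  then show ?thesis using assms unfolding Q_def by blast
qed

lemma forces_mem_eq_left:
  assumes "forces_mem p x z" "forces_eq p x y" and p: "p \<in>\<^sub>V P" and n: "name x" "name y" "name z"
  shows "forces_mem p y z"
proof (rule forces_memI)
  fix q assume q: "q \<in>\<^sub>V P" "q \<preceq> p"
  obtain s t w where s: "s \<in>\<^sub>V P" "s \<preceq> q" "\<langle>t, w\<rangle> \<in>\<^sub>V z" "s \<preceq> t" "forces_eq s x w"
    by (rule forces_memE[OF assms(1) q])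
  have w: "name w" by (rule name_name[OF n(3) s(3)])
  have "s \<preceq> p" using s q p leq_trans by blast
  then have "forces_eq s x y" by (rule forces_eq_mono[OF assms(2) _ p s(1) n(1,2)])
  then have "forces_eq s y w"
    by (rule forces_eq_trans[OF forces_eq_sym[OF _ s(1) n(1,2)] s(5,1) n(2,1) w])
  with s show "\<exists>s t w. s \<in>\<^sub>V P \<and> s \<preceq> q \<and> \<langle>t, w\<rangle> \<in>\<^sub>V z \<and> s \<preceq> t \<and> forces_eq s y w" by blast
qed

lemma forces_mem_eq_right:
  assumes "forces_mem p x y" "forces_eq p y z" and p: "p \<in>\<^sub>V P" and n: "name x" "name y" "name z"
  shows "forces_mem p x z"
proof (rule forces_mem_dense[OF p])
  fix q assume q: "q \<in>\<^sub>V P" "q \<preceq> p"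
  obtain s t w where s: "s \<in>\<^sub>V P" "s \<preceq> q" "\<langle>t, w\<rangle> \<in>\<^sub>V y" "s \<preceq> t" "forces_eq s x w"
    by (rule forces_memE[OF assms(1) q])
  have w: "name w" by (rule name_name[OF n(2) s(3)])
  have sp: "s \<preceq> p" using s q p leq_trans by blast
  have "forces_mem s w z" by (rule forces_eqD[OF assms(2) p n(2,3) s(3,1) sp s(4)])
  then have "forces_mem s x z"
    by (rule forces_mem_eq_left[OF _ forces_eq_sym[OF s(5,1) n(1) w] s(1) w n(1,3)])
  with s show "\<exists>s. s \<in>\<^sub>V P \<and> s \<preceq> q \<and> forces_mem s x z" by blast
qed

end


section \<open>Automorphisms acting on names\<close>

context forcing_model
begin

lemma ex_pair_cong:
  assumes "\<And>p z. \<langle>p, z\<rangle> \<in>\<^sub>V x \<Longrightarrow> f p z = g p z"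
  shows "(\<exists>p z. \<langle>p, z\<rangle> \<in>\<^sub>V x \<and> w = f p z) \<longleftrightarrow> (\<exists>p z. \<langle>p, z\<rangle> \<in>\<^sub>V x \<and> w = g p z)"
  using assms by metis

text \<open>Replacement applies to functions of one argument; a pair is decomposed by \<open>the_one\<close>.\<close>

lemma isset_pair_image:
  assumes f: "definable_fun2 f" shows "isset {w. \<exists>p z. \<langle>p, z\<rangle> \<in>\<^sub>V y \<and> w = f p z}"
proof -
  define h where "h u = the_one (\<lambda>w. \<exists>p z. u = \<langle>p, z\<rangle> \<and> w = f p z)" for u
  have h_dfn: "definable_fun1 h" unfolding h_def by (intro dfn definable_fun2_app[OF f])
  have h: "h \<langle>p, z\<rangle> = f p z" for p z unfolding h_def by (rule the_one_eq) auto
  have "isset {u \<in> elts y. \<exists>p z. u = \<langle>p, z\<rangle>}" by (rule separation) (intro dfn)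
  then have "isset (h ` {u \<in> elts y. \<exists>p z. u = \<langle>p, z\<rangle>})"
    by (rule isset_image[OF h_dfn])
  moreover have "h ` {u \<in> elts y. \<exists>p z. u = \<langle>p, z\<rangle>} = {w. \<exists>p z. \<langle>p, z\<rangle> \<in>\<^sub>V y \<and> w = f p z}"
  proof (intro subset_antisym subsetI)
    fix w assume "w \<in> h ` {u \<in> elts y. \<exists>p z. u = \<langle>p, z\<rangle>}"
    then obtain p z where "\<langle>p, z\<rangle> \<in>\<^sub>V y" "w = h \<langle>p, z\<rangle>" by auto
    then show "w \<in> {w. \<exists>p z. \<langle>p, z\<rangle> \<in>\<^sub>V y \<and> w = f p z}" using h by blast
  next
    fix w assume "w \<in> {w. \<exists>p z. \<langle>p, z\<rangle> \<in>\<^sub>V y \<and> w = f p z}"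
    then obtain p z where "\<langle>p, z\<rangle> \<in> {u \<in> elts y. \<exists>p z. u = \<langle>p, z\<rangle>}" "w = h \<langle>p, z\<rangle>" using h by auto
    then show "w \<in> h ` {u \<in> elts y. \<exists>p z. u = \<langle>p, z\<rangle>}" by (rule rev_image_eqI)
  qed
  ultimately show ?thesis by (simp only:)
qed

text \<open>The constant \<open>act\<close> is a \<open>THE\<close> term, whose values outside of its intended domain are not
  known to be definable. \<open>name_act\<close> agrees with it where it matters (\<open>act_name_act\<close>) and is definable
  everywhere.\<close>

definition act_rec :: "'v \<Rightarrow> 'v \<Rightarrow> 'v \<Rightarrow> bool" where
  "act_rec \<pi> N f \<longleftrightarrow> (\<forall>y. y \<in>\<^sub>V N \<longrightarrow>
     (\<forall>w. w \<in>\<^sub>V ap f y \<longleftrightarrow> (\<exists>p z. \<langle>p, z\<rangle> \<in>\<^sub>V y \<and> w = \<langle>ap \<pi> p, ap f z\<rangle>)))"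

definition name_act :: "'v \<Rightarrow> 'v \<Rightarrow> 'v" where
  "name_act \<pi> x = the_one (\<lambda>x'. \<exists>N f. name_closed N \<and> x \<in>\<^sub>V N \<and> fun_on f N \<and> act_rec \<pi> N f \<and> x' = ap f x)"

lemma definable_act_rec: "definable3 act_rec"
  unfolding act_rec_def by (intro dfn)

lemma definable_fun_on: "definable2 fun_on"
  unfolding fun_on_def Ex1_def by (intro dfn)

lemma definable_name_act [dfn]:
  assumes "definable_term s" "definable_term t" shows "definable_term (\<lambda>e. name_act (s e) (t e))"
  by (rule definable_fun2_app[OF _ assms], unfold name_act_def)
    (intro dfn definable1_app[OF definable_name_closed] definable2_app[OF definable_fun_on]
      definable3_app[OF definable_act_rec])

lemma act_rec_unique:
  assumes N: "name_closed N" "act_rec \<pi> N f" and M: "name_closed M" "act_rec \<pi> M g"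
    and x: "x \<in>\<^sub>V N" "x \<in>\<^sub>V M"
  shows "ap f x = ap g x"
proof -
  define Q where "Q x \<longleftrightarrow> (x \<in>\<^sub>V N \<longrightarrow> x \<in>\<^sub>V M \<longrightarrow> ap f x = ap g x)" for x
  have "definable1 Q" unfolding Q_def by (intro dfn)
  then have "Q x" using nameI[OF N(1) x(1)]
  proof (rule name_induct)
    fix x assume "name x" and IH: "\<And>y. appears y x \<Longrightarrow> Q y"
    show "Q x" unfolding Q_def
    proof (intro impI elts_inject)
      assume x: "x \<in>\<^sub>V N" "x \<in>\<^sub>V M"
      have eq: "ap f z = ap g z" if "\<langle>p, z\<rangle> \<in>\<^sub>V x" for p z
        using IH[of z] that name_closed_opair[OF N(1) x(1) that] name_closed_opair[OF M(1) x(2) that]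
        unfolding Q_def appears_def by blast
      have "w \<in>\<^sub>V ap f x \<longleftrightarrow> w \<in>\<^sub>V ap g x" for w
      proof -
        have "w \<in>\<^sub>V ap f x \<longleftrightarrow> (\<exists>p z. \<langle>p, z\<rangle> \<in>\<^sub>V x \<and> w = \<langle>ap \<pi> p, ap f z\<rangle>)"
          using N(2) x(1) unfolding act_rec_def by blast
        also have "\<dots> \<longleftrightarrow> (\<exists>p z. \<langle>p, z\<rangle> \<in>\<^sub>V x \<and> w = \<langle>ap \<pi> p, ap g z\<rangle>)"
          by (rule ex_pair_cong) (drule eq, simp)
        also have "\<dots> \<longleftrightarrow> w \<in>\<^sub>V ap g x" using M(2) x(2) unfolding act_rec_def by blast
        finally show ?thesis .
      qed
      then show "elts (ap f x) = elts (ap g x)" by (simp add: set_eq_iff)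
    qed
  qed
  then show ?thesis using x unfolding Q_def by blast
qed

lemma act_rec_exists:
  assumes N: "name_closed N" obtains f where "fun_on f N" "act_rec \<pi> N f"
proof -
  define H where "H y g = vset {w. \<exists>p z. \<langle>p, z\<rangle> \<in>\<^sub>V y \<and> w = \<langle>ap \<pi> p, ap g z\<rangle>}" for y g
  have H_dfn: "definable_fun2 H" unfolding H_def by (intro dfn)
  have R_dfn: "definable2 appears" by (intro dfn)
  obtain F where F_dfn: "definable_fun1 F" and
    F: "\<And>y. y \<in>\<^sub>V N \<Longrightarrow> F y = H y (graph F {z \<in> elts N. appears z y})"
    by (rule recursion[OF wf_set_appears[OF N] R_dfn H_dfn]) blast
  have "act_rec \<pi> N (graph F (elts N))" unfolding act_rec_def
  proof (intro allI impI)
    fix y w assume y: "y \<in>\<^sub>V N"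
    have iss: "isset {z \<in> elts N. appears z y}" by (rule separation) (intro dfn)
    have zN: "z \<in>\<^sub>V N" if "\<langle>p, z\<rangle> \<in>\<^sub>V y" for p z using name_closed_opair[OF N y that] by blast
    have eq: "ap (graph F {z \<in> elts N. appears z y}) z = ap (graph F (elts N)) z" if "\<langle>p, z\<rangle> \<in>\<^sub>V y" for p z
      using ap_graph[OF F_dfn iss, of z] ap_graph[OF F_dfn isset_elts, of z N] zN[OF that] that
      unfolding appears_def by auto
    have "isset {w. \<exists>p z. \<langle>p, z\<rangle> \<in>\<^sub>V y \<and> w = \<langle>ap \<pi> p, ap (graph F {z \<in> elts N. appears z y}) z\<rangle>}"
      by (rule isset_pair_image) (intro dfn)
    then have "w \<in>\<^sub>V F y \<longleftrightarrow> (\<exists>p z. \<langle>p, z\<rangle> \<in>\<^sub>V y \<and> w = \<langle>ap \<pi> p, ap (graph F {z \<in> elts N. appears z y}) z\<rangle>)"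
      unfolding F[OF y] H_def by (simp add: mem_vset)
    also have "\<dots> \<longleftrightarrow> (\<exists>p z. \<langle>p, z\<rangle> \<in>\<^sub>V y \<and> w = \<langle>ap \<pi> p, ap (graph F (elts N)) z\<rangle>)"
      by (rule ex_pair_cong) (drule eq, simp)
    finally show "w \<in>\<^sub>V ap (graph F (elts N)) y \<longleftrightarrow> \<dots>"
      using ap_graph[OF F_dfn isset_elts, of y N] y by simp
  qed
  then show ?thesis using that fun_on_graph[OF F_dfn] by blast
qed

lemma name_act_eq:
  assumes "name_closed N" "x \<in>\<^sub>V N" "fun_on f N" "act_rec \<pi> N f" shows "name_act \<pi> x = ap f x"
  unfolding name_act_def by (rule the_one_eq) (use assms act_rec_unique in blast)+

text \<open>The recursion equation of the action.\<close>

lemma mem_name_act: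
  assumes x: "name x" shows "w \<in>\<^sub>V name_act \<pi> x \<longleftrightarrow> (\<exists>p z. \<langle>p, z\<rangle> \<in>\<^sub>V x \<and> w = \<langle>ap \<pi> p, name_act \<pi> z\<rangle>)"
proof -
  obtain N where N: "name_closed N" "x \<in>\<^sub>V N" using x unfolding name_def by blast
  obtain f where f: "fun_on f N" "act_rec \<pi> N f" by (rule act_rec_exists[OF N(1)])
  have eq: "name_act \<pi> z = ap f z" if "z \<in>\<^sub>V N" for z by (rule name_act_eq[OF N(1) that f])
  have "w \<in>\<^sub>V ap f x \<longleftrightarrow> (\<exists>p z. \<langle>p, z\<rangle> \<in>\<^sub>V x \<and> w = \<langle>ap \<pi> p, ap f z\<rangle>)"
    using f(2) N(2) unfolding act_rec_def by blast
  also have "\<dots> \<longleftrightarrow> (\<exists>p z. \<langle>p, z\<rangle> \<in>\<^sub>V x \<and> w = \<langle>ap \<pi> p, name_act \<pi> z\<rangle>)"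
    by (rule ex_pair_cong) (drule name_closed_opair[OF N], simp add: eq)
  finally show ?thesis using eq[OF N(2)] by simp
qed

lemma opair_mem_name_act:
  assumes "name x"
  shows "\<langle>q, w\<rangle> \<in>\<^sub>V name_act \<pi> x \<longleftrightarrow> (\<exists>p z. \<langle>p, z\<rangle> \<in>\<^sub>V x \<and> q = ap \<pi> p \<and> w = name_act \<pi> z)"
  unfolding mem_name_act[OF assms] by simp

lemma name_act_mono:
  assumes "name x" "name y" "elts x \<subseteq> elts y" shows "elts (name_act \<pi> x) \<subseteq> elts (name_act \<pi> y)"
  using assms(3) by (simp add: mem_name_act assms(1,2)) blast

lemma name_act_id:
  assumes x: "name x" and eq: "\<And>p. p \<in>\<^sub>V P \<Longrightarrow> ap \<pi> p = p" shows "name_act \<pi> x = x"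
proof (rule name_induct[where Q = "\<lambda>x. name_act \<pi> x = x", OF _ x])
  show "definable1 (\<lambda>x. name_act \<pi> x = x)" by (intro dfn)
  fix x assume x: "name x" and IH: "\<And>y. appears y x \<Longrightarrow> name_act \<pi> y = y"
  have *: "ap \<pi> p = p" "name_act \<pi> z = z" if "\<langle>p, z\<rangle> \<in>\<^sub>V x" for p z
    using that eq name_cond[OF x that] IH unfolding appears_def by blast+
  have "w \<in>\<^sub>V name_act \<pi> x \<longleftrightarrow> w \<in>\<^sub>V x" for w
  proof -
    have "w \<in>\<^sub>V name_act \<pi> x \<longleftrightarrow> (\<exists>p z. \<langle>p, z\<rangle> \<in>\<^sub>V x \<and> w = \<langle>p, z\<rangle>)"
      unfolding mem_name_act[OF x] by (rule ex_pair_cong) (frule *(1), drule *(2), simp)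
    then show ?thesis using name_elem[OF x, of w] by blast
  qed
  then show "name_act \<pi> x = x" by (intro elts_inject) (simp add: set_eq_iff)
qed

text \<open>The union of sets of names chosen one for each \<open>y\<close> would need collection; the least closed
  set of names containing \<open>y\<close> is definable from \<open>y\<close>.\<close>

definition name_closure :: "'v \<Rightarrow> 'v" where
  "name_closure y = vset {z. \<forall>N. name_closed N \<longrightarrow> y \<in>\<^sub>V N \<longrightarrow> z \<in>\<^sub>V N}"

lemma mem_name_closure:
  assumes "name y" shows "z \<in>\<^sub>V name_closure y \<longleftrightarrow> (\<forall>N. name_closed N \<longrightarrow> y \<in>\<^sub>V N \<longrightarrow> z \<in>\<^sub>V N)"
proof -
  obtain N where N: "name_closed N" "y \<in>\<^sub>V N" using assms unfolding name_def by blast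
  have "isset {z. \<forall>N. name_closed N \<longrightarrow> y \<in>\<^sub>V N \<longrightarrow> z \<in>\<^sub>V N}"
    by (rule isset_subset[of _ N]) (intro dfn definable1_app[OF definable_name_closed], use N in auto)
  then show ?thesis unfolding name_closure_def by (simp add: mem_vset)
qed

lemma definable_name_closure: "definable_fun1 name_closure"
  unfolding name_closure_def by (intro dfn definable1_app[OF definable_name_closed])

lemma name_closed_insert:
  assumes elem: "\<And>z. z \<in>\<^sub>V x \<Longrightarrow> \<exists>p y. p \<in>\<^sub>V P \<and> name y \<and> z = \<langle>p, y\<rangle>"
  obtains K where "name_closed K" "x \<in>\<^sub>V K"
    "\<forall>u. u \<in>\<^sub>V K \<longrightarrow> u = x \<or> (\<exists>y. appears y x \<and> u \<in>\<^sub>V name_closure y)"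
proof -
  define d where "d = vset {y. \<exists>p. \<langle>p, y\<rangle> \<in>\<^sub>V x}"
  have d: "y \<in>\<^sub>V d \<longleftrightarrow> appears y x" for y unfolding d_def appears_def by (simp add: mem_vset isset_snd)
  define K where "K = vset (insert x (\<Union>y\<in>elts d. elts (name_closure y)))"
  have K: "z \<in>\<^sub>V K \<longleftrightarrow> z = x \<or> (\<exists>y. appears y x \<and> z \<in>\<^sub>V name_closure y)" for z
    unfolding K_def by (simp add: mem_vset isset_insert isset_UN[OF definable_name_closure] d)
  have nm: "name y" if "appears y x" for y using elem that unfolding appears_def by fastforce
  have "name_closed K" unfolding name_closed_def ball_elts bex_elts
  proof (intro allI impI)
    fix u z assume u: "u \<in>\<^sub>V K" and z: "z \<in>\<^sub>V u"
    show "\<exists>p. p \<in>\<^sub>V P \<and> (\<exists>y. y \<in>\<^sub>V K \<and> z = \<langle>p, y\<rangle>)"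
    proof (cases "u = x")
      case True
      then obtain p y where py: "p \<in>\<^sub>V P" "z = \<langle>p, y\<rangle>" using elem z by blast
      then have y: "appears y x" using z True unfolding appears_def by blast
      then have "y \<in>\<^sub>V name_closure y" using mem_name_closure[OF nm] by blast
      then show ?thesis using K py y by blast
    next
      case False
      then obtain y where y: "appears y x" "u \<in>\<^sub>V name_closure y" using u K by blast
      note ny = mem_name_closure[OF nm[OF y(1)]]
      obtain N where N: "name_closed N" "y \<in>\<^sub>V N" using nm[OF y(1)] unfolding name_def by blast
      then have "u \<in>\<^sub>V N" using ny y(2) by blast
      then obtain p v where pv: "p \<in>\<^sub>V P" "z = \<langle>p, v\<rangle>" using name_closedD[OF N(1) _ z] by blast
      have "v \<in>\<^sub>V name_closure y" unfolding ny using name_closed_opair y(2) z pv unfolding ny by blast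
      then show ?thesis using K y pv by blast
    qed
  qed
  with K show ?thesis using that by blast
qed

lemma name_I:
  assumes "\<And>z. z \<in>\<^sub>V x \<Longrightarrow> \<exists>p y. p \<in>\<^sub>V P \<and> name y \<and> z = \<langle>p, y\<rangle>" shows "name x"
  using name_closed_insert[OF assms] nameI by metis

end


locale symmetric_model = forcing_model mem P le Gr Fl
  for mem :: "'v \<Rightarrow> 'v \<Rightarrow> bool" (infix "\<in>\<^sub>V" 50) and P le Gr Fl :: 'v +
  assumes symmetric_system: symmetric_system
begin

lemma Gr_group: "automorphism_group Gr" and filter: normal_filter
  using symmetric_system unfolding symmetric_system_def by blast+

lemma Gr_automorphism: "\<pi> \<in>\<^sub>V Gr \<Longrightarrow> automorphism \<pi>"
  using Gr_group unfolding automorphism_group_def by simp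

lemma aut_fun: "\<pi> \<in>\<^sub>V Gr \<Longrightarrow> fun_on \<pi> P"
  and aut_bij: "\<pi> \<in>\<^sub>V Gr \<Longrightarrow> bij_betw (app \<pi>) (elts P) (elts P)"
  using Gr_automorphism unfolding automorphism_def bijection_def by blast+

lemma aut_app: "\<pi> \<in>\<^sub>V Gr \<Longrightarrow> p \<in>\<^sub>V P \<Longrightarrow> app \<pi> p = ap \<pi> p"
  using app_eq_ap[OF aut_fun] by simp

lemma aut_cond: assumes "\<pi> \<in>\<^sub>V Gr" "p \<in>\<^sub>V P" shows "ap \<pi> p \<in>\<^sub>V P"
  using bij_betwE[OF aut_bij[OF assms(1)]] aut_app[OF assms] assms(2) by auto

lemma aut_leq: assumes "\<pi> \<in>\<^sub>V Gr" "p \<in>\<^sub>V P" "q \<in>\<^sub>V P" shows "ap \<pi> p \<preceq> ap \<pi> q \<longleftrightarrow> p \<preceq> q"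
  using Gr_automorphism[OF assms(1)] aut_app[OF assms(1)] assms(2,3) unfolding automorphism_def by simp

lemma aut_surj: assumes "\<pi> \<in>\<^sub>V Gr" "q \<in>\<^sub>V P" obtains p where "p \<in>\<^sub>V P" "ap \<pi> p = q"
proof -
  have "q \<in> app \<pi> ` elts P" using aut_bij[OF assms(1)] assms(2) unfolding bij_betw_def by simp
  then show ?thesis using that aut_app[OF assms(1)] by auto
qed

lemma perm_apply: "\<pi> \<in>\<^sub>V Gr \<Longrightarrow> p \<in>\<^sub>V P \<Longrightarrow> perm \<pi> p = ap \<pi> p"
  unfolding perm_def by (simp add: aut_app)

lemma perm_Bij: assumes "\<pi> \<in>\<^sub>V Gr" shows "perm \<pi> \<in> Bij (elts P)"
proof -
  have "bij_betw (perm \<pi>) (elts P) (elts P)"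
    using aut_bij[OF assms] unfolding perm_def by (subst bij_betw_cong[of _ _ "app \<pi>"]) auto
  then show ?thesis unfolding Bij_def perm_def by simp
qed

lemma perm_mult:
  assumes "\<pi> \<in>\<^sub>V Gr" "\<sigma> \<in>\<^sub>V Gr" "p \<in>\<^sub>V P"
  shows "(perm \<pi> \<otimes>\<^bsub>BijGroup (elts P)\<^esub> perm \<sigma>) p = ap \<pi> (ap \<sigma> p)"
  using assms by (simp add: BijGroup_def perm_Bij compose_def perm_apply aut_cond)

text \<open>The subgroups are given by sets of internal bijections; group-theoretic facts about
  their permutations have to be brought back to elements of these sets.\<close>

lemma perm_image:
  assumes H: "elts H \<subseteq> elts Gr" and h: "h \<in> perm ` elts H"
  obtains \<tau> where "\<tau> \<in>\<^sub>V H" "\<tau> \<in>\<^sub>V Gr" "h = perm \<tau>" "\<And>p. p \<in>\<^sub>V P \<Longrightarrow> h p = ap \<tau> p"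
proof -
  obtain \<tau> where "\<tau> \<in>\<^sub>V H" "h = perm \<tau>" using h by auto
  then show ?thesis using that H perm_apply by auto
qed

lemma perm_inv:
  assumes "\<pi> \<in>\<^sub>V Gr" "p \<in>\<^sub>V P" shows "(inv\<^bsub>BijGroup (elts P)\<^esub> perm \<pi>) (ap \<pi> p) = p"
proof -
  have "inv_into (elts P) (perm \<pi>) (perm \<pi> p) = p"
    using perm_Bij[OF assms(1)] assms(2) unfolding Bij_def bij_betw_def by simp
  then show ?thesis using assms by (simp add: inv_BijGroup perm_Bij perm_apply aut_cond)
qed

lemma subgroup_inv:
  assumes H: "subgrp H" and "\<pi> \<in>\<^sub>V H"
  obtains \<tau> where "\<tau> \<in>\<^sub>V H" "\<And>p. p \<in>\<^sub>V P \<Longrightarrow> ap \<tau> (ap \<pi> p) = p" "\<And>p. p \<in>\<^sub>V P \<Longrightarrow> ap \<pi> (ap \<tau> p) = p"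
proof -
  have sub: "elts H \<subseteq> elts Gr" and g: "subgroup (perm ` elts H) (BijGroup (elts P))"
    using H unfolding subgrp_def automorphism_group_def by blast+
  have \<pi>: "\<pi> \<in>\<^sub>V Gr" using sub assms by auto
  have "inv\<^bsub>BijGroup (elts P)\<^esub> perm \<pi> \<in> perm ` elts H"
    by (rule subgroup.m_inv_closed[OF g]) (use assms in simp)
  then obtain \<tau> where \<tau>: "\<tau> \<in>\<^sub>V H" "\<And>p. p \<in>\<^sub>V P \<Longrightarrow> (inv\<^bsub>BijGroup (elts P)\<^esub> perm \<pi>) p = ap \<tau> p"
    by (rule perm_image[OF sub]) blast
  have 1: "ap \<tau> (ap \<pi> p) = p" if "p \<in>\<^sub>V P" for p
    using \<tau>(2)[OF aut_cond[OF \<pi> that]] perm_inv[OF \<pi> that] by simp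
  have "ap \<pi> (ap \<tau> p) = p" if p: "p \<in>\<^sub>V P" for p
  proof -
    obtain q where q: "q \<in>\<^sub>V P" "ap \<pi> q = p" by (rule aut_surj[OF \<pi> p])
    then show ?thesis using 1 by auto
  qed
  with \<tau>(1) 1 show ?thesis using that by blast
qed

lemma Fl_subgrp: "H \<in>\<^sub>V Fl \<Longrightarrow> subgrp H"
  and Fl_up: "H \<in>\<^sub>V Fl \<Longrightarrow> subgrp K \<Longrightarrow> elts H \<subseteq> elts K \<Longrightarrow> K \<in>\<^sub>V Fl"
  and Fl_Int: "H \<in>\<^sub>V Fl \<Longrightarrow> K \<in>\<^sub>V Fl \<Longrightarrow> \<exists>L. L \<in>\<^sub>V Fl \<and> elts L = elts H \<inter> elts K"
  and Gr_Fl: "Gr \<in>\<^sub>V Fl"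
  using filter unfolding normal_filter_def ball_elts bex_elts by blast+

lemma Fl_Gr: "H \<in>\<^sub>V Fl \<Longrightarrow> \<pi> \<in>\<^sub>V H \<Longrightarrow> \<pi> \<in>\<^sub>V Gr"
  using Fl_subgrp unfolding subgrp_def by auto

lemma act_name_act: assumes \<pi>: "\<pi> \<in>\<^sub>V Gr" and x: "name x" shows "act \<pi> x = name_act \<pi> x"
proof -
  have rec: "(\<forall>y\<in>elts N. elts (app f y) = {\<langle>app \<pi> p, app f z\<rangle> | p z. \<langle>p, z\<rangle> \<in>\<^sub>V y}) \<longleftrightarrow> act_rec \<pi> N f"
    if N: "name_closed N" "fun_on f N" for N f
  proof -
    have "elts (app f y) = {\<langle>app \<pi> p, app f z\<rangle> | p z. \<langle>p, z\<rangle> \<in>\<^sub>V y} \<longleftrightarrow>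
      (\<forall>w. w \<in>\<^sub>V ap f y \<longleftrightarrow> (\<exists>p z. \<langle>p, z\<rangle> \<in>\<^sub>V y \<and> w = \<langle>ap \<pi> p, ap f z\<rangle>))" if y: "y \<in>\<^sub>V N" for y
    proof -
      have "app \<pi> p = ap \<pi> p \<and> app f z = ap f z" if "\<langle>p, z\<rangle> \<in>\<^sub>V y" for p z
        using name_closed_opair[OF N(1) y that] aut_app[OF \<pi>] app_eq_ap[OF N(2)] by simp
      then have "(\<exists>p z. \<langle>p, z\<rangle> \<in>\<^sub>V y \<and> w = \<langle>app \<pi> p, app f z\<rangle>) \<longleftrightarrow>
          (\<exists>p z. \<langle>p, z\<rangle> \<in>\<^sub>V y \<and> w = \<langle>ap \<pi> p, ap f z\<rangle>)" for w
        by (intro ex_pair_cong) simp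
      then have "{\<langle>app \<pi> p, app f z\<rangle> | p z. \<langle>p, z\<rangle> \<in>\<^sub>V y} = {w. \<exists>p z. \<langle>p, z\<rangle> \<in>\<^sub>V y \<and> w = \<langle>ap \<pi> p, ap f z\<rangle>}"
        unfolding set_eq_iff mem_Collect_eq by (simp only: conj_commute simp_thms)
      then show ?thesis using app_eq_ap[OF N(2)] y by (simp add: set_eq_iff)
    qed
    then show ?thesis unfolding act_rec_def by simp
  qed
  obtain N where N: "name_closed N" "x \<in>\<^sub>V N" using x unfolding name_def by blast
  obtain f where f: "fun_on f N" "act_rec \<pi> N f" by (rule act_rec_exists[OF N(1)])
  have fx: "app f x = ap f x" using app_eq_ap[OF f(1)] N by simp
  show ?thesis unfolding act_def name_act_eq[OF N f]
  proof (rule the_equality)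
    show "\<exists>N fa. name_closed N \<and> x \<in>\<^sub>V N \<and> fun_on fa N \<and>
       (\<forall>y\<in>elts N. elts (app fa y) = {\<langle>app \<pi> p, app fa z\<rangle> | p z. \<langle>p, z\<rangle> \<in>\<^sub>V y}) \<and> ap f x = app fa x"
      by (rule exI[of _ N], rule exI[of _ f]) (intro conjI N f(1) fx[symmetric] rec[OF N(1) f(1), THEN iffD2] f(2))
  next
    fix x' assume "\<exists>M g. name_closed M \<and> x \<in>\<^sub>V M \<and> fun_on g M \<and>
       (\<forall>y\<in>elts M. elts (app g y) = {\<langle>app \<pi> p, app g z\<rangle> | p z. \<langle>p, z\<rangle> \<in>\<^sub>V y}) \<and> x' = app g x"
    then obtain M g where M: "name_closed M" "x \<in>\<^sub>V M" "fun_on g M"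
       "\<forall>y\<in>elts M. elts (app g y) = {\<langle>app \<pi> p, app g z\<rangle> | p z. \<langle>p, z\<rangle> \<in>\<^sub>V y}" "x' = app g x"
      by (elim exE conjE)
    then have "act_rec \<pi> M g" using rec[OF M(1,3)] by blast
    then have "ap f x = ap g x" by (rule act_rec_unique[OF N(1) f(2) M(1) _ N(2) M(2)])
    then show "x' = ap f x" using M(5) app_eq_ap[OF M(3)] M(2) by simp
  qed
qed

lemma name_name_act: assumes \<pi>: "\<pi> \<in>\<^sub>V Gr" and x: "name x" shows "name (name_act \<pi> x)"
proof -
  obtain N where N: "name_closed N" "x \<in>\<^sub>V N" using x unfolding name_def by blast
  have "isset (name_act \<pi> ` elts N)" by (intro replacement dfn)
  then have M: "y \<in>\<^sub>V vset (name_act \<pi> ` elts N) \<longleftrightarrow> (\<exists>u. u \<in>\<^sub>V N \<and> y = name_act \<pi> u)" for y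
    by (auto simp: mem_vset)
  have "name_closed (vset (name_act \<pi> ` elts N))"
    unfolding name_closed_def ball_elts bex_elts M
  proof (intro allI impI, elim exE conjE)
    fix y z u assume u: "u \<in>\<^sub>V N" "y = name_act \<pi> u" and "z \<in>\<^sub>V y"
    then obtain p v where "\<langle>p, v\<rangle> \<in>\<^sub>V u" "z = \<langle>ap \<pi> p, name_act \<pi> v\<rangle>"
      using mem_name_act[OF nameI[OF N(1) u(1)]] by auto
    then show "\<exists>p. p \<in>\<^sub>V P \<and> (\<exists>y. (\<exists>u. u \<in>\<^sub>V N \<and> y = name_act \<pi> u) \<and> z = \<langle>p, y\<rangle>)"
      using name_closed_opair[OF N(1) u(1)] aut_cond[OF \<pi>] by blast
  qed
  then show ?thesis by (rule nameI) (use M N in blast)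
qed

lemma mem_name_act_act:
  assumes "\<beta> \<in>\<^sub>V Gr" "name x"
  shows "w \<in>\<^sub>V name_act \<alpha> (name_act \<beta> x) \<longleftrightarrow>
    (\<exists>p z. \<langle>p, z\<rangle> \<in>\<^sub>V x \<and> w = \<langle>ap \<alpha> (ap \<beta> p), name_act \<alpha> (name_act \<beta> z)\<rangle>)"
  unfolding mem_name_act[OF name_name_act[OF assms]] opair_mem_name_act[OF assms(2)] by blast

text \<open>Two factorizations of the same permutation act in the same way. Stated with products on both
  sides, this covers composition as well as inverses.\<close>

lemma name_act_comp:
  assumes x: "name x" and \<beta>: "\<beta> \<in>\<^sub>V Gr" and \<delta>: "\<delta> \<in>\<^sub>V Gr"
    and eq: "\<And>p. p \<in>\<^sub>V P \<Longrightarrow> ap \<alpha> (ap \<beta> p) = ap \<gamma> (ap \<delta> p)"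
  shows "name_act \<alpha> (name_act \<beta> x) = name_act \<gamma> (name_act \<delta> x)"
proof (rule name_induct[where Q = "\<lambda>x. name_act \<alpha> (name_act \<beta> x) = name_act \<gamma> (name_act \<delta> x)", OF _ x])
  show "definable1 (\<lambda>x. name_act \<alpha> (name_act \<beta> x) = name_act \<gamma> (name_act \<delta> x))" by (intro dfn)
  fix x assume x: "name x"
    and IH: "\<And>y. appears y x \<Longrightarrow> name_act \<alpha> (name_act \<beta> y) = name_act \<gamma> (name_act \<delta> y)"
  have *: "ap \<alpha> (ap \<beta> p) = ap \<gamma> (ap \<delta> p)" "name_act \<alpha> (name_act \<beta> z) = name_act \<gamma> (name_act \<delta> z)"
    if "\<langle>p, z\<rangle> \<in>\<^sub>V x" for p z
    using that eq name_cond[OF x that] IH unfolding appears_def by blast+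
  have "w \<in>\<^sub>V name_act \<alpha> (name_act \<beta> x) \<longleftrightarrow> w \<in>\<^sub>V name_act \<gamma> (name_act \<delta> x)" for w
    unfolding mem_name_act_act[OF \<beta> x] mem_name_act_act[OF \<delta> x]
    by (rule ex_pair_cong) (frule *(1), drule *(2), simp)
  then show "name_act \<alpha> (name_act \<beta> x) = name_act \<gamma> (name_act \<delta> x)"
    by (intro elts_inject) (simp add: set_eq_iff)
qed

lemma identity: obtains \<iota> where "\<iota> \<in>\<^sub>V Gr" "\<And>p. p \<in>\<^sub>V P \<Longrightarrow> ap \<iota> p = p"
proof -
  have g: "subgroup (perm ` elts Gr) (BijGroup (elts P))"
    using Gr_group unfolding automorphism_group_def by blast
  have "\<one>\<^bsub>BijGroup (elts P)\<^esub> \<in> perm ` elts Gr" by (rule subgroup.one_closed[OF g])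
  then obtain \<iota> where "\<iota> \<in>\<^sub>V Gr" "\<And>p. p \<in>\<^sub>V P \<Longrightarrow> \<one>\<^bsub>BijGroup (elts P)\<^esub> p = ap \<iota> p"
    by (rule perm_image[OF subset_refl]) blast
  then show ?thesis using that by (auto simp: BijGroup_def)
qed

lemma name_act_comp':
  assumes "name x" "\<sigma> \<in>\<^sub>V Gr" "\<And>p. p \<in>\<^sub>V P \<Longrightarrow> ap \<tau> p = ap \<pi> (ap \<sigma> p)"
  shows "name_act \<tau> x = name_act \<pi> (name_act \<sigma> x)"
proof -
  obtain \<iota> where \<iota>: "\<iota> \<in>\<^sub>V Gr" "\<And>p. p \<in>\<^sub>V P \<Longrightarrow> ap \<iota> p = p" by (rule identity) blast
  have "name_act \<tau> (name_act \<iota> x) = name_act \<pi> (name_act \<sigma> x)"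
    by (rule name_act_comp[OF assms(1) \<iota>(1) assms(2)]) (use \<iota> assms in simp)
  then show ?thesis using name_act_id[OF assms(1) \<iota>(2)] by simp
qed

lemma name_act_inverse:
  assumes "name x" "\<pi> \<in>\<^sub>V Gr" "\<And>p. p \<in>\<^sub>V P \<Longrightarrow> ap \<tau> (ap \<pi> p) = p"
  shows "name_act \<tau> (name_act \<pi> x) = x"
proof -
  obtain \<iota> where \<iota>: "\<iota> \<in>\<^sub>V Gr" "\<And>p. p \<in>\<^sub>V P \<Longrightarrow> ap \<iota> p = p" by (rule identity) blast
  have "name_act \<tau> (name_act \<pi> x) = name_act \<iota> (name_act \<iota> x)"
    by (rule name_act_comp[OF assms(1,2) \<iota>(1)]) (use \<iota> assms in simp)
  then show ?thesis using name_act_id[OF assms(1) \<iota>(2)] by simp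
qed


section \<open>Symmetric names\<close>

text \<open>A name is symmetric if and only if some group supports it (\<open>symmetric_iff\<close>); in contrast
  to the stabilizer, a support can be shrunk, and so be shared by several names.\<close>

definition supports :: "'v \<Rightarrow> 'v \<Rightarrow> bool" where
  "supports L x \<longleftrightarrow> L \<in>\<^sub>V Fl \<and> (\<forall>\<pi>. \<pi> \<in>\<^sub>V L \<longrightarrow> name_act \<pi> x = x)"

definition stabilizer :: "'v \<Rightarrow> 'v" where
  "stabilizer x = vset {\<pi> \<in> elts Gr. name_act \<pi> x = x}"

lemma definable_supports [dfn]:
  "definable_term s \<Longrightarrow> definable_term t \<Longrightarrow> definable (\<lambda>e. supports (s e) (t e))"
  by (rule definable2_app[of supports]) (unfold supports_def, intro dfn)

lemma definable_stabilizer: "definable_fun1 stabilizer"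
  unfolding stabilizer_def by (intro dfn)

lemma elts_stabilizer: "elts (stabilizer x) = {\<pi> \<in> elts Gr. name_act \<pi> x = x}"
  unfolding stabilizer_def by (rule elts_vset, rule separation) (intro dfn)

text \<open>The filter is closed upwards among the subgroups, so what has to be shown is that the
  stabilizer is a subgroup.\<close>

lemma stabilizer_Fl: assumes x: "name x" and L: "supports L x" shows "stabilizer x \<in>\<^sub>V Fl"
proof (rule Fl_up)
  show "L \<in>\<^sub>V Fl" using L unfolding supports_def by blast
  then show "elts L \<subseteq> elts (stabilizer x)" using L Fl_Gr unfolding supports_def elts_stabilizer by auto
  let ?B = "BijGroup (elts P)" and ?S = "stabilizer x"
  have mem: "\<pi> \<in>\<^sub>V ?S \<longleftrightarrow> \<pi> \<in>\<^sub>V Gr \<and> name_act \<pi> x = x" for \<pi>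
    using elts_stabilizer[of x] elts_iff[of \<pi> ?S] by simp
  have g: "subgroup (perm ` elts Gr) ?B" using Gr_group unfolding automorphism_group_def by blast
  have "subgroup (perm ` elts ?S) ?B"
  proof (rule group.subgroupI[OF group_BijGroup])
    show "perm ` elts ?S \<subseteq> carrier ?B" using perm_Bij mem by (auto simp: BijGroup_def)
    obtain \<iota> where "\<iota> \<in>\<^sub>V Gr" "\<And>p. p \<in>\<^sub>V P \<Longrightarrow> ap \<iota> p = p" by (rule identity) blast
    then have "\<iota> \<in>\<^sub>V ?S" using mem name_act_id[OF x] by blast
    then show "perm ` elts ?S \<noteq> {}" by auto
  next
    fix a assume "a \<in> perm ` elts ?S"
    then obtain \<pi> where \<pi>: "\<pi> \<in>\<^sub>V Gr" "name_act \<pi> x = x" "a = perm \<pi>" using mem by auto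
    have "inv\<^bsub>?B\<^esub> a \<in> perm ` elts Gr" by (rule subgroup.m_inv_closed[OF g]) (use \<pi> in simp)
    then obtain \<tau> where \<tau>: "\<tau> \<in>\<^sub>V Gr" "inv\<^bsub>?B\<^esub> a = perm \<tau>" "\<And>p. p \<in>\<^sub>V P \<Longrightarrow> (inv\<^bsub>?B\<^esub> a) p = ap \<tau> p"
      by (rule perm_image[OF subset_refl]) blast
    have "ap \<tau> (ap \<pi> p) = p" if "p \<in>\<^sub>V P" for p
      using \<tau>(3)[OF aut_cond[OF \<pi>(1) that]] perm_inv[OF \<pi>(1) that] \<pi>(3) by simp
    then have "name_act \<tau> x = x" using name_act_inverse[OF x \<pi>(1)] \<pi>(2) by metis
    then show "inv\<^bsub>?B\<^esub> a \<in> perm ` elts ?S" using \<tau> mem by auto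
  next
    fix a b assume "a \<in> perm ` elts ?S" "b \<in> perm ` elts ?S"
    then obtain \<pi> \<sigma> where \<pi>: "\<pi> \<in>\<^sub>V Gr" "name_act \<pi> x = x" "a = perm \<pi>"
      and \<sigma>: "\<sigma> \<in>\<^sub>V Gr" "name_act \<sigma> x = x" "b = perm \<sigma>" using mem by auto
    have "a \<otimes>\<^bsub>?B\<^esub> b \<in> perm ` elts Gr" by (rule subgroup.m_closed[OF g]) (use \<pi> \<sigma> in simp_all)
    then obtain \<tau> where \<tau>: "\<tau> \<in>\<^sub>V Gr" "a \<otimes>\<^bsub>?B\<^esub> b = perm \<tau>" "\<And>p. p \<in>\<^sub>V P \<Longrightarrow> (a \<otimes>\<^bsub>?B\<^esub> b) p = ap \<tau> p"
      by (rule perm_image[OF subset_refl]) blast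
    have "ap \<tau> p = ap \<pi> (ap \<sigma> p)" if "p \<in>\<^sub>V P" for p
      using \<tau>(3)[OF that] perm_mult[OF \<pi>(1) \<sigma>(1) that] \<pi>(3) \<sigma>(3) by simp
    then have "name_act \<tau> x = x" using name_act_comp'[OF x \<sigma>(1)] \<pi>(2) \<sigma>(2) by metis
    then show "a \<otimes>\<^bsub>?B\<^esub> b \<in> perm ` elts ?S" using \<tau> mem by auto
  qed
  then show "subgrp ?S" unfolding subgrp_def automorphism_group_def using mem Gr_automorphism by simp
qed

lemma symmetric_iff: assumes x: "name x" shows "symmetric x \<longleftrightarrow> (\<exists>L. supports L x)"
proof
  have eq: "{\<pi> \<in> elts Gr. act \<pi> x = x} = elts (stabilizer x)"
    unfolding elts_stabilizer using act_name_act[OF _ x] by auto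
  {
    assume "symmetric x"
    then obtain H where "H \<in>\<^sub>V Fl" "elts H = elts (stabilizer x)" unfolding symmetric_def eq by auto
    moreover have "name_act \<pi> x = x" if "\<pi> \<in>\<^sub>V H" for \<pi>
    proof -
      have "\<pi> \<in> elts (stabilizer x)" using \<open>elts H = _\<close> that by auto
      then show ?thesis unfolding elts_stabilizer by blast
    qed
    ultimately have "supports H x" unfolding supports_def by blast
    then show "\<exists>L. supports L x" ..
  next
    assume "\<exists>L. supports L x"
    then show "symmetric x" unfolding symmetric_def eq using stabilizer_Fl[OF x] by auto
  }
qed

lemma HS_iff: "x \<in> HS \<longleftrightarrow> (\<exists>N. name_closed N \<and> x \<in>\<^sub>V N \<and> (\<forall>y. y \<in>\<^sub>V N \<longrightarrow> (\<exists>L. supports L y)))"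
  unfolding HS_def mem_Collect_eq ball_elts using symmetric_iff nameI by blast

lemma definable_HS [dfn]: assumes "definable_term t" shows "definable (\<lambda>e. t e \<in> HS)"
  by (rule definable1_app[OF _ assms], unfold HS_iff) (intro dfn definable1_app[OF definable_name_closed])

lemma HS_name: "x \<in> HS \<Longrightarrow> name x"
  unfolding HS_iff using nameI by blast

lemma HS_supports: "x \<in> HS \<Longrightarrow> \<exists>L. supports L x"
  unfolding HS_iff by blast

lemma HS_opair: "x \<in> HS \<Longrightarrow> \<langle>p, y\<rangle> \<in>\<^sub>V x \<Longrightarrow> p \<in>\<^sub>V P \<and> y \<in> HS"
  unfolding HS_iff using name_closed_opair by blast

text \<open>The way in which all hereditarily symmetric names below are obtained.\<close>

lemma HS_I:
  assumes elem: "\<And>z. z \<in>\<^sub>V x \<Longrightarrow> \<exists>p y. p \<in>\<^sub>V P \<and> y \<in> HS \<and> z = \<langle>p, y\<rangle>" and L: "supports L x"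
  shows "x \<in> HS"
proof -
  have "\<exists>p y. p \<in>\<^sub>V P \<and> name y \<and> z = \<langle>p, y\<rangle>" if "z \<in>\<^sub>V x" for z using elem[OF that] HS_name by blast
  then obtain K where K: "name_closed K" "x \<in>\<^sub>V K"
      "\<forall>u. u \<in>\<^sub>V K \<longrightarrow> u = x \<or> (\<exists>y. appears y x \<and> u \<in>\<^sub>V name_closure y)"
    by (rule name_closed_insert) blast
  have "\<exists>L. supports L u" if u: "u \<in>\<^sub>V K" for u
  proof (cases "u = x")
    case False
    then obtain p y where y: "\<langle>p, y\<rangle> \<in>\<^sub>V x" "u \<in>\<^sub>V name_closure y" using K(3) u unfolding appears_def by blast
    have "y \<in> HS" using elem[OF y(1)] by simp
    then show ?thesis using y(2) mem_name_closure[OF HS_name] unfolding HS_iff by blast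
  qed (use L in blast)
  with K(1,2) show ?thesis unfolding HS_iff by blast
qed

lemma HS_appears: "x \<in> HS \<Longrightarrow> appears y x \<Longrightarrow> y \<in> HS"
  unfolding appears_def using HS_opair by blast

text \<open>The symmetry lemma for atomic formulas. The auxiliary lemma is the induction step for membership,
  with the induction hypothesis as its last assumption.\<close>

lemma forces_mem_act_aux:
  assumes \<pi>: "\<pi> \<in>\<^sub>V Gr" and q: "q \<in>\<^sub>V P" and y: "name y" and m: "forces_mem q z y"
    and eq: "\<And>s t w. s \<in>\<^sub>V P \<Longrightarrow> \<langle>t, w\<rangle> \<in>\<^sub>V y \<Longrightarrow> forces_eq s z w \<Longrightarrow> forces_eq (ap \<pi> s) (name_act \<pi> z) (name_act \<pi> w)"
  shows "forces_mem (ap \<pi> q) (name_act \<pi> z) (name_act \<pi> y)"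
proof (rule forces_memI)
  fix s' assume s': "s' \<in>\<^sub>V P" "s' \<preceq> ap \<pi> q"
  obtain s where s: "s \<in>\<^sub>V P" "ap \<pi> s = s'" by (rule aut_surj[OF \<pi> s'(1)]) blast
  then have sq: "s \<preceq> q" using s'(2) aut_leq[OF \<pi> s(1) q] by simp
  obtain u t w where u: "u \<in>\<^sub>V P" "u \<preceq> s" "\<langle>t, w\<rangle> \<in>\<^sub>V y" "u \<preceq> t" "forces_eq u z w"
    by (rule forces_memE[OF m s(1) sq])
  have t: "t \<in>\<^sub>V P" by (rule name_cond[OF y u(3)])
  have "ap \<pi> u \<in>\<^sub>V P" "ap \<pi> u \<preceq> s'" "ap \<pi> u \<preceq> ap \<pi> t" "\<langle>ap \<pi> t, name_act \<pi> w\<rangle> \<in>\<^sub>V name_act \<pi> y"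
    using aut_cond[OF \<pi> u(1)] aut_leq[OF \<pi> u(1) s(1)] aut_leq[OF \<pi> u(1) t] u s opair_mem_name_act[OF y] by auto
  with eq[OF u(1,3,5)]
  show "\<exists>s t w. s \<in>\<^sub>V P \<and> s \<preceq> s' \<and> \<langle>t, w\<rangle> \<in>\<^sub>V name_act \<pi> y \<and> s \<preceq> t \<and> forces_eq s (name_act \<pi> z) w" by blast
qed

lemma forces_eq_act:
  assumes \<pi>: "\<pi> \<in>\<^sub>V Gr" and "p \<in>\<^sub>V P" and x: "name x" and "name y" and "forces_eq p x y"
  shows "forces_eq (ap \<pi> p) (name_act \<pi> x) (name_act \<pi> y)"
proof -
  define Q where "Q x \<longleftrightarrow> (\<forall>p y. p \<in>\<^sub>V P \<longrightarrow> name y \<longrightarrow> forces_eq p x y \<longrightarrow>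
      forces_eq (ap \<pi> p) (name_act \<pi> x) (name_act \<pi> y))" for x
  have "definable1 Q" unfolding Q_def by (intro dfn)
  then have "Q x" using x
  proof (rule name_induct)
    fix x assume x: "name x" and IH0: "\<And>y. appears y x \<Longrightarrow> Q y"
    have IH: "forces_eq (ap \<pi> s) (name_act \<pi> z) (name_act \<pi> w)"
      if "\<langle>r, z\<rangle> \<in>\<^sub>V x" "forces_eq s z w" "s \<in>\<^sub>V P" "name w" for r z s w
      using IH0[of z] that unfolding Q_def appears_def by blast
    show "Q x" unfolding Q_def
    proof (intro allI impI)
      fix p y assume p: "p \<in>\<^sub>V P" and y: "name y" and xy: "forces_eq p x y"
      note yx = forces_eq_sym[OF xy p x y]
      show "forces_eq (ap \<pi> p) (name_act \<pi> x) (name_act \<pi> y)"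
      proof (rule forces_eqI[OF aut_cond[OF \<pi> p] name_name_act[OF \<pi> x] name_name_act[OF \<pi> y]])
        fix r' z' q' assume z': "\<langle>r', z'\<rangle> \<in>\<^sub>V name_act \<pi> x" and q': "q' \<in>\<^sub>V P" "q' \<preceq> ap \<pi> p" "q' \<preceq> r'"
        obtain r z where z: "\<langle>r, z\<rangle> \<in>\<^sub>V x" "r' = ap \<pi> r" "z' = name_act \<pi> z"
          using z' opair_mem_name_act[OF x] by blast
        obtain q where q: "q \<in>\<^sub>V P" "ap \<pi> q = q'" by (rule aut_surj[OF \<pi> q'(1)])
        have "q \<preceq> p" "q \<preceq> r"
          using q q' z aut_leq[OF \<pi> q(1) p] aut_leq[OF \<pi> q(1) name_cond[OF x z(1)]] by auto
        then have "forces_mem q z y" by (intro forces_eqD[OF xy p x y z(1) q(1)])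
        then show "forces_mem q' z' (name_act \<pi> y)" unfolding z(3) q(2)[symmetric]
          by (rule forces_mem_act_aux[OF \<pi> q(1) y]) (rule IH[OF z(1)], assumption+, rule name_name[OF y])
      next
        fix r' z' q' assume z': "\<langle>r', z'\<rangle> \<in>\<^sub>V name_act \<pi> y" and q': "q' \<in>\<^sub>V P" "q' \<preceq> ap \<pi> p" "q' \<preceq> r'"
        obtain r z where z: "\<langle>r, z\<rangle> \<in>\<^sub>V y" "r' = ap \<pi> r" "z' = name_act \<pi> z"
          using z' opair_mem_name_act[OF y] by blast
        note nz = name_name[OF y z(1)]
        obtain q where q: "q \<in>\<^sub>V P" "ap \<pi> q = q'" by (rule aut_surj[OF \<pi> q'(1)])
        have "q \<preceq> p" "q \<preceq> r"
          using q q' z aut_leq[OF \<pi> q(1) p] aut_leq[OF \<pi> q(1) name_cond[OF y z(1)]] by auto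
        then have "forces_mem q z x" by (intro forces_eqD[OF yx p y x z(1) q(1)])
        then show "forces_mem q' z' (name_act \<pi> x)" unfolding z(3) q(2)[symmetric]
        proof (rule forces_mem_act_aux[OF \<pi> q(1) x])
          fix s t w assume s: "s \<in>\<^sub>V P" and w: "\<langle>t, w\<rangle> \<in>\<^sub>V x" and zw: "forces_eq s z w"
          note nw = name_name[OF x w]
          have "forces_eq (ap \<pi> s) (name_act \<pi> w) (name_act \<pi> z)"
            by (rule IH[OF w forces_eq_sym[OF zw s nz nw] s nz])
          then show "forces_eq (ap \<pi> s) (name_act \<pi> z) (name_act \<pi> w)"
            by (rule forces_eq_sym[OF _ aut_cond[OF \<pi> s] name_name_act[OF \<pi> nw] name_name_act[OF \<pi> nz]])
        qed
      qed
    qed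
  qed
  then show ?thesis using assms unfolding Q_def by blast
qed

lemma forces_mem_act:
  assumes "\<pi> \<in>\<^sub>V Gr" "p \<in>\<^sub>V P" "name x" "name y" "forces_mem p x y"
  shows "forces_mem (ap \<pi> p) (name_act \<pi> x) (name_act \<pi> y)"
  by (rule forces_mem_act_aux[OF assms(1,2,4,5)]) (use forces_eq_act assms name_name in blast)

end


section \<open>Canonical names\<close>

context forcing_model
begin

text \<open>Each member of \<open>a\<close> appears with every condition, which has the effect of appearing with a
  largest one. All names of concrete sets in this section are of this form, and they inherit symmetry from
  the members of \<open>a\<close> (\<open>supports_full_name\<close>).\<close>

definition full_name :: "'v \<Rightarrow> 'v" where
  "full_name a = Times P a"

definition upair_name :: "'v \<Rightarrow> 'v \<Rightarrow> 'v" where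
  "upair_name x y = full_name (upair x y)"

definition opair_name :: "'v \<Rightarrow> 'v \<Rightarrow> 'v" where
  "opair_name x y = upair_name (upair_name x x) (upair_name x y)"

lemma definable_full_name [dfn]:
  "definable_term s \<Longrightarrow> definable_term (\<lambda>e. full_name (s e))"
  by (rule definable_fun1_app[of full_name]) (unfold full_name_def Times_def, intro dfn)

lemma definable_opair_name [dfn]:
  "definable_term s \<Longrightarrow> definable_term t \<Longrightarrow> definable_term (\<lambda>e. opair_name (s e) (t e))"
  unfolding opair_name_def upair_name_def by (intro dfn)

lemma mem_full_name: "z \<in>\<^sub>V full_name a \<longleftrightarrow> (\<exists>p y. p \<in>\<^sub>V P \<and> y \<in>\<^sub>V a \<and> z = \<langle>p, y\<rangle>)"
  unfolding full_name_def by (rule mem_Times)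

lemma opair_mem_full_name: "\<langle>p, y\<rangle> \<in>\<^sub>V full_name a \<longleftrightarrow> p \<in>\<^sub>V P \<and> y \<in>\<^sub>V a"
  unfolding full_name_def by simp

lemma name_full_name: "(\<And>y. y \<in>\<^sub>V a \<Longrightarrow> name y) \<Longrightarrow> name (full_name a)"
  by (rule name_I) (auto simp: mem_full_name)

lemma forces_mem_full_name:
  "forces_mem p x (full_name a) \<longleftrightarrow>
    (\<forall>q. q \<in>\<^sub>V P \<longrightarrow> q \<preceq> p \<longrightarrow> (\<exists>s y. s \<in>\<^sub>V P \<and> s \<preceq> q \<and> y \<in>\<^sub>V a \<and> forces_eq s x y))"
  unfolding forces_mem_iff opair_mem_full_name using leq_refl by blast

lemma forces_mem_full_nameI:
  assumes x: "name x" and a: "\<And>y. y \<in>\<^sub>V a \<Longrightarrow> name y" and p: "p \<in>\<^sub>V P" and y: "y \<in>\<^sub>V a" "forces_eq p x y"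
  shows "forces_mem p x (full_name a)"
  unfolding forces_mem_full_name
  using forces_eq_mono[OF y(2) _ p _ x a[OF y(1)]] y(1) leq_refl by blast

lemma name_upair_name: "name x \<Longrightarrow> name y \<Longrightarrow> name (upair_name x y)"
  unfolding upair_name_def by (rule name_full_name) (auto simp: mem_upair)

lemma name_opair_name: "name x \<Longrightarrow> name y \<Longrightarrow> name (opair_name x y)"
  unfolding opair_name_def by (intro name_upair_name)

lemma forces_upair_cong:
  assumes p: "p \<in>\<^sub>V P" and n: "name x" "name y" "name x'" "name y'"
    and eq: "forces_eq p x x'" "forces_eq p y y'"
  shows "forces_eq p (upair_name x y) (upair_name x' y')"
proof (rule forces_eqI[OF p])
  have main: "forces_mem q z (upair_name u' v')" if "\<langle>r, z\<rangle> \<in>\<^sub>V upair_name u v" and q: "q \<in>\<^sub>V P" "q \<preceq> p"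
    and "name u" "name v" "name u'" "name v'" "forces_eq p u u'" "forces_eq p v v'" for r z q u v u' v'
  proof -
    have "z = u \<or> z = v" using that(1) unfolding upair_name_def opair_mem_full_name mem_upair by blast
    moreover have "forces_eq q u u'" "forces_eq q v v'" using that forces_eq_mono p by blast+
    ultimately obtain w where "w \<in>\<^sub>V upair u' v'" "forces_eq q z w" unfolding mem_upair by blast
    then show ?thesis unfolding upair_name_def
      by (intro forces_mem_full_nameI) (use that \<open>z = u \<or> z = v\<close> in \<open>auto simp: mem_upair\<close>)
  qed
  note eq' = forces_eq_sym[OF eq(1) p n(1,3)] forces_eq_sym[OF eq(2) p n(2,4)]
  show "forces_mem q z (upair_name x' y')" if "\<langle>r, z\<rangle> \<in>\<^sub>V upair_name x y" "q \<in>\<^sub>V P" "q \<preceq> p" "q \<preceq> r" for r z q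
    by (rule main[OF that(1-3) n eq])
  show "forces_mem q z (upair_name x y)" if "\<langle>r, z\<rangle> \<in>\<^sub>V upair_name x' y'" "q \<in>\<^sub>V P" "q \<preceq> p" "q \<preceq> r" for r z q
    by (rule main[OF that(1-3) n(3,4,1,2) eq'])
qed (use n name_upair_name in blast)+

lemma forces_opair_cong:
  assumes "p \<in>\<^sub>V P" "name x" "name y" "name x'" "name y'" "forces_eq p x x'" "forces_eq p y y'"
  shows "forces_eq p (opair_name x y) (opair_name x' y')"
  unfolding opair_name_def by (intro forces_upair_cong name_upair_name assms)

text \<open>If \<open>{x, y} = {x', y'}\<close> is forced, then densely often it is decided which element of
  \<open>{x', y'}\<close> a given element of \<open>{x, y}\<close> is.\<close>

lemma forces_upair_left:
  assumes p: "p \<in>\<^sub>V P" and n: "name x" "name y" "name x'" "name y'"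
    and eq: "forces_eq p (upair_name x y) (upair_name x' y')" and z: "z = x \<or> z = y"
    and q: "q \<in>\<^sub>V P" "q \<preceq> p"
  obtains s where "s \<in>\<^sub>V P" "s \<preceq> q" "forces_eq s z x' \<or> forces_eq s z y'"
proof -
  have nz: "name z" using z n by blast
  have "forces_mem p z (upair_name x' y')"
    by (rule forces_eqD[OF eq p name_upair_name[OF n(1,2)] name_upair_name[OF n(3,4)] _ p leq_refl[OF p] leq_refl[OF p]])
      (use z p in \<open>auto simp: upair_name_def opair_mem_full_name mem_upair\<close>)
  then have "\<exists>s w. s \<in>\<^sub>V P \<and> s \<preceq> q \<and> w \<in>\<^sub>V upair x' y' \<and> forces_eq s z w"
    unfolding upair_name_def using q n by (subst (asm) forces_mem_full_name) blast
  then show ?thesis using that unfolding mem_upair by blast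
qed

text \<open>The usual argument for Kuratowski pairs, carried out below an arbitrary condition. For
  the second coordinates, \<open>y\<close> is forced to be \<open>x'\<close> or \<open>y'\<close>; in the first case \<open>y = x\<close>, and then \<open>y'\<close>,
  which is \<open>x\<close> or \<open>y\<close>, equals \<open>y\<close> either way.\<close>

lemma forces_opair_inject:
  assumes p: "p \<in>\<^sub>V P" and n: "name x" "name y" "name x'" "name y'"
    and eq: "forces_eq p (opair_name x y) (opair_name x' y')"
  shows "forces_eq p x x' \<and> forces_eq p y y'"
proof -
  note nu = name_upair_name[OF n(1,1)] name_upair_name[OF n(1,2)] name_upair_name[OF n(3,3)] name_upair_name[OF n(3,4)]
  note eqs = forces_eq_sym[OF eq p name_opair_name[OF n(1,2)] name_opair_name[OF n(3,4)]]
  have sing: "forces_eq s u v" if e: "forces_eq s (upair_name u u) (upair_name v w)" and s: "s \<in>\<^sub>V P" and m: "name u" "name v" "name w" for s u v w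
  proof (rule forces_eq_dense[OF s m(1,2)])
    fix q assume q: "q \<in>\<^sub>V P" "q \<preceq> s"
    have "forces_eq s (upair_name v w) (upair_name u u)"
      by (rule forces_eq_sym[OF e s name_upair_name[OF m(1,1)] name_upair_name[OF m(2,3)]])
    then obtain t where "t \<in>\<^sub>V P" "t \<preceq> q" "forces_eq t v u"
      by (rule forces_upair_left[OF s m(2,3,1,1) _ disjI1[OF refl] q]) blast
    then show "\<exists>t. t \<in>\<^sub>V P \<and> t \<preceq> q \<and> forces_eq t u v" using forces_eq_sym m by blast
  qed
  have x: "forces_eq p x x'"
  proof (rule forces_eq_dense[OF p n(1,3)])
    fix q assume q: "q \<in>\<^sub>V P" "q \<preceq> p"
    obtain s where s: "s \<in>\<^sub>V P" "s \<preceq> q"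
        "forces_eq s (upair_name x x) (upair_name x' x') \<or> forces_eq s (upair_name x x) (upair_name x' y')"
      by (rule forces_upair_left[OF p nu eq[unfolded opair_name_def] disjI1[OF refl] q]) blast
    then have "forces_eq s x x'" using sing n by blast
    with s show "\<exists>s. s \<in>\<^sub>V P \<and> s \<preceq> q \<and> forces_eq s x x'" by blast
  qed
  have "forces_eq p y y'"
  proof (rule forces_eq_dense[OF p n(2,4)])
    fix q assume q: "q \<in>\<^sub>V P" "q \<preceq> p"
    \<comment> \<open>\<open>s\<close> decides whether \<open>{x', y'}\<close> is \<open>{x, x}\<close> or \<open>{x, y}\<close>, and \<open>u\<close> decides whether \<open>{x, y}\<close> is \<open>{x', x'}\<close>
      or \<open>{x', y'}\<close>.\<close>
    obtain s where s: "s \<in>\<^sub>V P" "s \<preceq> q"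
        "forces_eq s (upair_name x' y') (upair_name x x) \<or> forces_eq s (upair_name x' y') (upair_name x y)"
      by (rule forces_upair_left[OF p nu(3,4,1,2) eqs[unfolded opair_name_def] disjI2[OF refl] q]) blast
    have sp: "s \<preceq> p" using s q p leq_trans by blast
    have eq_s: "forces_eq s x x'" by (rule forces_eq_mono[OF x sp p s(1) n(1,3)])
    obtain u where u: "u \<in>\<^sub>V P" "u \<preceq> s"
        "forces_eq u (upair_name x y) (upair_name x' x') \<or> forces_eq u (upair_name x y) (upair_name x' y')"
      by (rule forces_upair_left[OF p nu eq[unfolded opair_name_def] disjI2[OF refl] s(1) sp]) blast
    have up: "u \<preceq> p" and uq: "u \<preceq> q" using u s sp p q leq_trans by blast+
    have xu: "forces_eq u x x'" by (rule forces_eq_mono[OF x up p u(1) n(1,3)])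
    note xu' = forces_eq_sym[OF xu u(1) n(1,3)]
    obtain v where v: "v \<in>\<^sub>V P" "v \<preceq> u" "forces_eq v y x' \<or> forces_eq v y y'"
    proof (cases "forces_eq u (upair_name x y) (upair_name x' x')")
      case True
      then show ?thesis
        by (rule forces_upair_left[OF u(1) n(1,2) n(3,3) _ disjI2[OF refl] u(1) leq_refl[OF u(1)]]) (use that in blast)
    next
      case False
      then have "forces_eq u (upair_name x y) (upair_name x' y')" using u(3) by blast
      then show ?thesis
        by (rule forces_upair_left[OF u(1) n(1,2) n(3,4) _ disjI2[OF refl] u(1) leq_refl[OF u(1)]]) (use that in blast)
    qed
    have vq: "v \<preceq> q" and vs: "v \<preceq> s" using v u uq q s leq_trans by blast+
    show "\<exists>s. s \<in>\<^sub>V P \<and> s \<preceq> q \<and> forces_eq s y y'"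
    proof (cases "forces_eq v y y'")
      case True
      with v(1) vq show ?thesis by blast
    next
      case False
      then have yx': "forces_eq v y x'" using v(3) by blast
      have xv: "forces_eq v x x'" by (rule forces_eq_mono[OF xu v(2) u(1) v(1) n(1,3)])
      have yx: "forces_eq v y x"
        by (rule forces_eq_trans[OF yx' forces_eq_sym[OF xv v(1) n(1,3)] v(1) n(2,3,1)])
      obtain w where w: "w \<in>\<^sub>V P" "w \<preceq> v" "forces_eq w y' x \<or> forces_eq w y' y"
      proof (cases "forces_eq s (upair_name x' y') (upair_name x x)")
        case True
        then show ?thesis
          by (rule forces_upair_left[OF s(1) n(3,4,1,1) _ disjI2[OF refl] v(1) vs]) (use that in blast)
      next
        case False
        then have "forces_eq s (upair_name x' y') (upair_name x y)" using s(3) by blast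
        then show ?thesis
          by (rule forces_upair_left[OF s(1) n(3,4,1,2) _ disjI2[OF refl] v(1) vs]) (use that in blast)
      qed
      have yxw: "forces_eq w y x" by (rule forces_eq_mono[OF yx w(2) v(1) w(1) n(2,1)])
      have "forces_eq w y y'" using w(3)
      proof
        assume "forces_eq w y' x"
        then show ?thesis by (intro forces_eq_trans[OF yxw _ w(1) n(2,1,4)] forces_eq_sym[OF _ w(1) n(4,1)])
      next
        assume "forces_eq w y' y"
        then show ?thesis by (rule forces_eq_sym[OF _ w(1) n(4,2)])
      qed
      moreover have "w \<preceq> q" using w v vq q leq_trans by blast
      ultimately show ?thesis using w(1) by blast
    qed
  qed
  with x show ?thesis ..
qed

lemma ex_mem_cong:
  assumes "\<And>z. z \<in>\<^sub>V a \<Longrightarrow> f z = g z"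
  shows "(\<exists>p z. p \<in>\<^sub>V P \<and> z \<in>\<^sub>V a \<and> w = \<langle>p, f z\<rangle>) \<longleftrightarrow> (\<exists>p z. p \<in>\<^sub>V P \<and> z \<in>\<^sub>V a \<and> w = \<langle>p, g z\<rangle>)"
  using assms by metis

text \<open>As for the action on names, \<open>check\<close> is replaced by a function that is definable everywhere and
  agrees with it on the elements of transitive sets (\<open>check_check_name\<close>).\<close>

definition check_rec :: "'v \<Rightarrow> 'v \<Rightarrow> bool" where
  "check_rec t f \<longleftrightarrow> (\<forall>y. y \<in>\<^sub>V t \<longrightarrow> (\<forall>w. w \<in>\<^sub>V ap f y \<longleftrightarrow> (\<exists>p z. p \<in>\<^sub>V P \<and> z \<in>\<^sub>V y \<and> w = \<langle>p, ap f z\<rangle>)))"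

definition check_name :: "'v \<Rightarrow> 'v" where
  "check_name x = the_one (\<lambda>x'. \<exists>t f. transitive t \<and> x \<in>\<^sub>V t \<and> fun_on f t \<and> check_rec t f \<and> x' = ap f x)"

lemma definable_check_name [dfn]:
  assumes "definable_term s" shows "definable_term (\<lambda>e. check_name (s e))"
proof -
  have r: "definable2 check_rec" unfolding check_rec_def by (intro dfn)
  have t: "definable1 transitive" unfolding transitive_def by (intro dfn)
  have "definable_fun1 check_name" unfolding check_name_def
    by (intro dfn definable2_app[OF definable_fun_on] definable2_app[OF r] definable1_app[OF t])
  then show ?thesis using assms by (rule definable_fun1_app)
qed

lemma check_rec_unique:
  assumes t: "transitive t" "check_rec t f" and u: "transitive u" "check_rec u g" and x: "x \<in>\<^sub>V t" "x \<in>\<^sub>V u"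
  shows "ap f x = ap g x"
proof -
  define Q where "Q x \<longleftrightarrow> (x \<in>\<^sub>V u \<longrightarrow> ap f x = ap g x)" for x
  have "definable1 Q" unfolding Q_def by (intro dfn)
  then have "Q x" using x(1)
  proof (rule wf_set_induct[OF wf_set_mem])
    fix x assume xt: "x \<in>\<^sub>V t" and IH: "\<And>y. y \<in>\<^sub>V t \<Longrightarrow> y \<in>\<^sub>V x \<Longrightarrow> Q y"
    show "Q x" unfolding Q_def
    proof (intro impI elts_inject)
      assume xu: "x \<in>\<^sub>V u"
      have eq: "ap f z = ap g z" if "z \<in>\<^sub>V x" for z
        using IH[of z] that t(1) u(1) xt xu unfolding Q_def transitive_def by blast
      have "w \<in>\<^sub>V ap f x \<longleftrightarrow> (\<exists>p z. p \<in>\<^sub>V P \<and> z \<in>\<^sub>V x \<and> w = \<langle>p, ap f z\<rangle>)" for w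
        using t(2) xt unfolding check_rec_def by blast
      moreover have "w \<in>\<^sub>V ap g x \<longleftrightarrow> (\<exists>p z. p \<in>\<^sub>V P \<and> z \<in>\<^sub>V x \<and> w = \<langle>p, ap g z\<rangle>)" for w
        using u(2) xu unfolding check_rec_def by blast
      moreover have "(\<exists>p z. p \<in>\<^sub>V P \<and> z \<in>\<^sub>V x \<and> w = \<langle>p, ap f z\<rangle>) \<longleftrightarrow>
          (\<exists>p z. p \<in>\<^sub>V P \<and> z \<in>\<^sub>V x \<and> w = \<langle>p, ap g z\<rangle>)" for w
        by (simp add: eq cong: conj_cong)
      ultimately show "elts (ap f x) = elts (ap g x)" by (simp add: set_eq_iff)
    qed
  qed
  then show ?thesis using x unfolding Q_def by blast
qed

lemma check_rec_exists:
  assumes t: "transitive t" obtains f where "fun_on f t" "check_rec t f"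
proof -
  define H where "H y g = Times P (vset {w. \<exists>z\<in>elts y. w = ap g z})" for y g
  have H_dfn: "definable_fun2 H" unfolding H_def Times_def by (intro dfn)
  have R_dfn: "definable2 (\<in>\<^sub>V)" by (intro dfn)
  obtain F where F_dfn: "definable_fun1 F" and
    F: "\<And>y. y \<in>\<^sub>V t \<Longrightarrow> F y = H y (graph F {z \<in> elts t. z \<in>\<^sub>V y})"
    by (rule recursion[OF wf_set_mem[of t] R_dfn H_dfn]) blast
  have "check_rec t (graph F (elts t))" unfolding check_rec_def
  proof (intro allI impI)
    fix y w assume y: "y \<in>\<^sub>V t"
    have iss: "isset {z \<in> elts t. z \<in>\<^sub>V y}" by (rule separation) (intro dfn)
    have zt: "z \<in>\<^sub>V t" if "z \<in>\<^sub>V y" for z using t y that unfolding transitive_def by blast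
    have eq: "ap (graph F {z \<in> elts t. z \<in>\<^sub>V y}) z = ap (graph F (elts t)) z" if "z \<in>\<^sub>V y" for z
      using ap_graph[OF F_dfn iss, of z] ap_graph[OF F_dfn isset_elts, of z t] zt[OF that] that by auto
    let ?g = "graph F {z \<in> elts t. z \<in>\<^sub>V y}"
    have "isset (ap ?g ` elts y)" by (intro replacement dfn)
    moreover have "ap ?g ` elts y = {w. \<exists>z\<in>elts y. w = ap ?g z}" by auto
    ultimately have "isset {w. \<exists>z\<in>elts y. w = ap ?g z}" by (simp only:)
    from mem_vset[OF this]
    have vs: "v \<in>\<^sub>V vset {w. \<exists>z\<in>elts y. w = ap ?g z} \<longleftrightarrow> (\<exists>z. z \<in>\<^sub>V y \<and> v = ap ?g z)" for v
      by simp
    have "w \<in>\<^sub>V F y \<longleftrightarrow> (\<exists>p z. p \<in>\<^sub>V P \<and> z \<in>\<^sub>V y \<and> w = \<langle>p, ap ?g z\<rangle>)"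
      unfolding F[OF y] H_def mem_Times vs by blast
    also have "\<dots> \<longleftrightarrow> (\<exists>p z. p \<in>\<^sub>V P \<and> z \<in>\<^sub>V y \<and> w = \<langle>p, ap (graph F (elts t)) z\<rangle>)"
      using eq by (rule ex_mem_cong)
    finally show "w \<in>\<^sub>V ap (graph F (elts t)) y \<longleftrightarrow> \<dots>"
      using ap_graph[OF F_dfn isset_elts, of y t] y by simp
  qed
  then show ?thesis using that fun_on_graph[OF F_dfn] by blast
qed

lemma check_name_eq:
  assumes "transitive t" "x \<in>\<^sub>V t" "fun_on f t" "check_rec t f" shows "check_name x = ap f x"
  unfolding check_name_def by (rule the_one_eq) (use assms check_rec_unique in blast)+

lemma mem_check_name:
  assumes t: "transitive t" "x \<in>\<^sub>V t"
  shows "w \<in>\<^sub>V check_name x \<longleftrightarrow> (\<exists>p z. p \<in>\<^sub>V P \<and> z \<in>\<^sub>V x \<and> w = \<langle>p, check_name z\<rangle>)"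
proof -
  obtain f where f: "fun_on f t" "check_rec t f" by (rule check_rec_exists[OF t(1)])
  have eq: "check_name z = ap f z" if "z \<in>\<^sub>V t" for z by (rule check_name_eq[OF t(1) that f])
  have zt: "z \<in>\<^sub>V t" if "z \<in>\<^sub>V x" for z using t that unfolding transitive_def by blast
  have "w \<in>\<^sub>V ap f x \<longleftrightarrow> (\<exists>p z. p \<in>\<^sub>V P \<and> z \<in>\<^sub>V x \<and> w = \<langle>p, ap f z\<rangle>)"
    using f(2) t(2) unfolding check_rec_def by blast
  also have "\<dots> \<longleftrightarrow> (\<exists>p z. p \<in>\<^sub>V P \<and> z \<in>\<^sub>V x \<and> w = \<langle>p, check_name z\<rangle>)"
    by (simp add: eq zt cong: conj_cong)
  finally show ?thesis using eq[OF t(2)] by simp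
qed

definition check_set :: "'v \<Rightarrow> 'v" where
  "check_set x = vset {y. \<exists>z\<in>elts x. y = check_name z}"

lemma mem_check_set: "y \<in>\<^sub>V check_set x \<longleftrightarrow> (\<exists>z. z \<in>\<^sub>V x \<and> y = check_name z)"
proof -
  have "isset (check_name ` elts x)" by (intro replacement dfn)
  moreover have "check_name ` elts x = {y. \<exists>z\<in>elts x. y = check_name z}" by auto
  ultimately have "isset {y. \<exists>z\<in>elts x. y = check_name z}" by (simp only:)
  from mem_vset[OF this] show ?thesis unfolding check_set_def by simp
qed

lemma check_name_full:
  assumes "transitive t" "x \<in>\<^sub>V t" shows "check_name x = full_name (check_set x)"
proof (rule elts_inject)
  have "w \<in>\<^sub>V check_name x \<longleftrightarrow> w \<in>\<^sub>V full_name (check_set x)" for w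
    unfolding mem_check_name[OF assms] mem_full_name mem_check_set by blast
  then show "elts (check_name x) = elts (full_name (check_set x))" by (simp add: set_eq_iff)
qed

lemma check_check_name: assumes t: "transitive t" and x: "x \<in>\<^sub>V t" shows "check x = check_name x"
proof -
  have rec: "(\<forall>y\<in>elts t. elts (app f y) = {\<langle>p, app f z\<rangle> | p z. p \<in>\<^sub>V P \<and> z \<in>\<^sub>V y}) \<longleftrightarrow> check_rec t f"
    if t: "transitive t" "fun_on f t" for t f
  proof -
    have "elts (app f y) = {\<langle>p, app f z\<rangle> | p z. p \<in>\<^sub>V P \<and> z \<in>\<^sub>V y} \<longleftrightarrow>
      (\<forall>w. w \<in>\<^sub>V ap f y \<longleftrightarrow> (\<exists>p z. p \<in>\<^sub>V P \<and> z \<in>\<^sub>V y \<and> w = \<langle>p, ap f z\<rangle>))" if y: "y \<in>\<^sub>V t" for y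
    proof -
      have "app f z = ap f z" if "z \<in>\<^sub>V y" for z
        using app_eq_ap[OF t(2)] t(1) y that unfolding transitive_def by simp
      then have e: "(\<exists>p z. p \<in>\<^sub>V P \<and> z \<in>\<^sub>V y \<and> w = \<langle>p, app f z\<rangle>) \<longleftrightarrow>
          (\<exists>p z. p \<in>\<^sub>V P \<and> z \<in>\<^sub>V y \<and> w = \<langle>p, ap f z\<rangle>)" for w by (rule ex_mem_cong)
      have "{\<langle>p, app f z\<rangle> | p z. p \<in>\<^sub>V P \<and> z \<in>\<^sub>V y} = {w. \<exists>p z. p \<in>\<^sub>V P \<and> z \<in>\<^sub>V y \<and> w = \<langle>p, ap f z\<rangle>}"
      proof (rule Set.set_eqI)
        fix w
        show "w \<in> {\<langle>p, app f z\<rangle> | p z. p \<in>\<^sub>V P \<and> z \<in>\<^sub>V y} \<longleftrightarrow>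
            w \<in> {w. \<exists>p z. p \<in>\<^sub>V P \<and> z \<in>\<^sub>V y \<and> w = \<langle>p, ap f z\<rangle>}"
          unfolding mem_Collect_eq e[symmetric] by blast
      qed
      then show ?thesis using app_eq_ap[OF t(2)] y by (simp add: set_eq_iff)
    qed
    then show ?thesis unfolding check_rec_def by simp
  qed
  obtain f where f: "fun_on f t" "check_rec t f" by (rule check_rec_exists[OF t])
  have fx: "app f x = ap f x" using app_eq_ap[OF f(1)] x by simp
  have tr: "(\<forall>y\<in>elts t. elts y \<subseteq> elts t) \<longleftrightarrow> transitive t" for t unfolding transitive_def by auto
  show ?thesis unfolding check_def check_name_eq[OF t x f] tr
  proof (rule the_equality)
    show "\<exists>t fa. transitive t \<and> x \<in>\<^sub>V t \<and> fun_on fa t \<and>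
       (\<forall>y\<in>elts t. elts (app fa y) = {\<langle>p, app fa z\<rangle> | p z. p \<in>\<^sub>V P \<and> z \<in>\<^sub>V y}) \<and> ap f x = app fa x"
      by (rule exI[of _ t], rule exI[of _ f]) (intro conjI t x f(1) fx[symmetric] rec[OF t f(1), THEN iffD2] f(2))
  next
    fix x' assume "\<exists>t f. transitive t \<and> x \<in>\<^sub>V t \<and> fun_on f t \<and>
       (\<forall>y\<in>elts t. elts (app f y) = {\<langle>p, app f z\<rangle> | p z. p \<in>\<^sub>V P \<and> z \<in>\<^sub>V y}) \<and> x' = app f x"
    then obtain u g where u: "transitive u" "x \<in>\<^sub>V u" "fun_on g u"
       "\<forall>y\<in>elts u. elts (app g y) = {\<langle>p, app g z\<rangle> | p z. p \<in>\<^sub>V P \<and> z \<in>\<^sub>V y}" "x' = app g x"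
      by (elim exE conjE)
    then have "check_rec u g" using rec[OF u(1,3)] by blast
    then have "ap f x = ap g x" by (rule check_rec_unique[OF t f(2) u(1) _ x u(2)])
    then show "x' = ap f x" using u(5) app_eq_ap[OF u(3)] u(2) by simp
  qed
qed

end


context symmetric_model
begin

lemma supports_full_name:
  assumes L: "L \<in>\<^sub>V Fl" and y: "\<And>y. y \<in>\<^sub>V a \<Longrightarrow> name y \<and> supports L y" shows "supports L (full_name a)"
proof -
  have n: "name (full_name a)" by (rule name_full_name) (use y in blast)
  have "name_act \<pi> (full_name a) = full_name a" if "\<pi> \<in>\<^sub>V L" for \<pi>
  proof -
    have \<pi>: "\<pi> \<in>\<^sub>V Gr" using Fl_Gr[OF L that] .
    have fixed: "name_act \<pi> y = y" if "y \<in>\<^sub>V a" for y using y[OF that] \<open>\<pi> \<in>\<^sub>V L\<close> unfolding supports_def by blast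
    have "w \<in>\<^sub>V name_act \<pi> (full_name a) \<longleftrightarrow> w \<in>\<^sub>V full_name a" for w
    proof
      assume "w \<in>\<^sub>V name_act \<pi> (full_name a)"
      then obtain p z where "p \<in>\<^sub>V P" "z \<in>\<^sub>V a" "w = \<langle>ap \<pi> p, name_act \<pi> z\<rangle>"
        unfolding mem_name_act[OF n] opair_mem_full_name by blast
      then show "w \<in>\<^sub>V full_name a" using fixed aut_cond[OF \<pi>] unfolding mem_full_name by auto
    next
      assume "w \<in>\<^sub>V full_name a"
      then obtain q z where qz: "q \<in>\<^sub>V P" "z \<in>\<^sub>V a" "w = \<langle>q, z\<rangle>" unfolding mem_full_name by blast
      obtain p where p: "p \<in>\<^sub>V P" "ap \<pi> p = q" by (rule aut_surj[OF \<pi> qz(1)]) blast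
      then have "w = \<langle>ap \<pi> p, name_act \<pi> z\<rangle>" using qz fixed[OF qz(2)] by simp
      then show "w \<in>\<^sub>V name_act \<pi> (full_name a)"
        unfolding mem_name_act[OF n] opair_mem_full_name using p(1) qz(2) by blast
    qed
    then show ?thesis by (intro elts_inject) (simp add: set_eq_iff)
  qed
  then show ?thesis using L unfolding supports_def by blast
qed

lemma full_name_HS:
  assumes "L \<in>\<^sub>V Fl" and y: "\<And>y. y \<in>\<^sub>V a \<Longrightarrow> y \<in> HS \<and> supports L y" shows "full_name a \<in> HS"
proof (rule HS_I)
  show "supports L (full_name a)" by (rule supports_full_name) (use assms HS_name in blast)+
  show "\<exists>p x. p \<in>\<^sub>V P \<and> x \<in> HS \<and> z = \<langle>p, x\<rangle>" if "z \<in>\<^sub>V full_name a" for z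
    using that y unfolding mem_full_name by blast
qed

lemma supports_mono: "supports L x \<Longrightarrow> M \<in>\<^sub>V Fl \<Longrightarrow> (\<And>\<pi>. \<pi> \<in>\<^sub>V M \<Longrightarrow> \<pi> \<in>\<^sub>V L) \<Longrightarrow> supports M x"
  unfolding supports_def by blast

lemma Fl_Int_mem:
  assumes "H \<in>\<^sub>V Fl" "K \<in>\<^sub>V Fl" shows "\<exists>L. L \<in>\<^sub>V Fl \<and> (\<forall>\<pi>. \<pi> \<in>\<^sub>V L \<longrightarrow> \<pi> \<in>\<^sub>V H \<and> \<pi> \<in>\<^sub>V K)"
proof -
  obtain L where L: "L \<in>\<^sub>V Fl" "elts L = elts H \<inter> elts K" using Fl_Int[OF assms] by blast
  have "\<pi> \<in> elts L \<longleftrightarrow> \<pi> \<in> elts H \<inter> elts K" for \<pi> unfolding L(2) ..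
  with L(1) show ?thesis by auto
qed

lemma supports_Int: assumes L: "supports L x" and K: "supports K y"
  obtains M where "supports M x" "supports M y" "M \<in>\<^sub>V Fl"
proof -
  have "L \<in>\<^sub>V Fl" "K \<in>\<^sub>V Fl" using L K unfolding supports_def by blast+
  then obtain M where M: "M \<in>\<^sub>V Fl" "\<forall>\<pi>. \<pi> \<in>\<^sub>V M \<longrightarrow> \<pi> \<in>\<^sub>V L \<and> \<pi> \<in>\<^sub>V K" using Fl_Int_mem by blast
  have "supports M x" by (rule supports_mono[OF L M(1)]) (use M(2) in blast)
  moreover have "supports M y" by (rule supports_mono[OF K M(1)]) (use M(2) in blast)
  ultimately show ?thesis using M(1) by (rule that)
qed

lemma supports_upair_name:
  assumes "supports L x" "supports L y" "name x" "name y" shows "supports L (upair_name x y)"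
proof -
  have "L \<in>\<^sub>V Fl" using assms(1) unfolding supports_def by blast
  then show ?thesis unfolding upair_name_def
    by (rule supports_full_name) (use assms in \<open>unfold mem_upair, blast\<close>)
qed

lemma supports_opair_name:
  assumes "supports L x" "supports L y" "name x" "name y" shows "supports L (opair_name x y)"
  unfolding opair_name_def by (intro supports_upair_name name_upair_name assms)

lemma upair_name_HS: assumes "x \<in> HS" "y \<in> HS" shows "upair_name x y \<in> HS"
proof -
  obtain L K where "supports L x" "supports K y" using HS_supports assms by blast
  then obtain M where M: "supports M x" "supports M y" "M \<in>\<^sub>V Fl" by (rule supports_Int) blast
  show ?thesis unfolding upair_name_def
    by (rule full_name_HS[OF M(3)]) (use M assms in \<open>unfold mem_upair, blast\<close>)
qed

lemma opair_name_HS: "x \<in> HS \<Longrightarrow> y \<in> HS \<Longrightarrow> opair_name x y \<in> HS"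
  unfolding opair_name_def by (intro upair_name_HS)

lemma name_act_upair_name:
  assumes \<pi>: "\<pi> \<in>\<^sub>V Gr" and n: "name x" "name y"
  shows "name_act \<pi> (upair_name x y) = upair_name (name_act \<pi> x) (name_act \<pi> y)"
proof (rule elts_inject)
  have "w \<in>\<^sub>V name_act \<pi> (upair_name x y) \<longleftrightarrow> w \<in>\<^sub>V upair_name (name_act \<pi> x) (name_act \<pi> y)" for w
  proof
    assume "w \<in>\<^sub>V name_act \<pi> (upair_name x y)"
    then obtain p z where "p \<in>\<^sub>V P" "z = x \<or> z = y" "w = \<langle>ap \<pi> p, name_act \<pi> z\<rangle>"
      unfolding mem_name_act[OF name_upair_name[OF n]] unfolding upair_name_def opair_mem_full_name mem_upair by blast
    then show "w \<in>\<^sub>V upair_name (name_act \<pi> x) (name_act \<pi> y)"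
      using aut_cond[OF \<pi>] unfolding upair_name_def mem_full_name mem_upair by blast
  next
    assume "w \<in>\<^sub>V upair_name (name_act \<pi> x) (name_act \<pi> y)"
    then obtain q z where qz: "q \<in>\<^sub>V P" "z = x \<or> z = y" "w = \<langle>q, name_act \<pi> z\<rangle>"
      unfolding upair_name_def mem_full_name mem_upair by blast
    obtain p where p: "p \<in>\<^sub>V P" "ap \<pi> p = q" by (rule aut_surj[OF \<pi> qz(1)]) blast
    then have "w = \<langle>ap \<pi> p, name_act \<pi> z\<rangle>" using qz by simp
    then show "w \<in>\<^sub>V name_act \<pi> (upair_name x y)" unfolding mem_name_act[OF name_upair_name[OF n]]
      unfolding upair_name_def opair_mem_full_name mem_upair using p(1) qz(2) by blast
  qed
  then show "elts (name_act \<pi> (upair_name x y)) = elts (upair_name (name_act \<pi> x) (name_act \<pi> y))"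
    by (simp add: set_eq_iff)
qed

lemma name_act_opair_name:
  assumes "\<pi> \<in>\<^sub>V Gr" "name x" "name y"
  shows "name_act \<pi> (opair_name x y) = opair_name (name_act \<pi> x) (name_act \<pi> y)"
  unfolding opair_name_def by (simp add: name_act_upair_name assms name_upair_name)

lemma check_name_HS:
  assumes t: "transitive t" and x: "x \<in>\<^sub>V t" shows "check_name x \<in> HS \<and> supports Gr (check_name x)"
proof (rule wf_set_induct[OF wf_set_mem _ x, where Q = "\<lambda>x. check_name x \<in> HS \<and> supports Gr (check_name x)"])
  show "definable1 (\<lambda>x. check_name x \<in> HS \<and> supports Gr (check_name x))" by (intro dfn)
  fix x assume x: "x \<in>\<^sub>V t" and IH: "\<And>y. y \<in>\<^sub>V t \<Longrightarrow> y \<in>\<^sub>V x \<Longrightarrow> check_name y \<in> HS \<and> supports Gr (check_name y)"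
  have *: "y \<in> HS \<and> supports Gr y" if "y \<in>\<^sub>V check_set x" for y
    using that IH t x unfolding mem_check_set transitive_def by blast
  show "check_name x \<in> HS \<and> supports Gr (check_name x)"
    unfolding check_name_full[OF t x]
    using full_name_HS[OF Gr_Fl *] supports_full_name[OF Gr_Fl, of "check_set x"] * HS_name by blast
qed

lemma forces_mem_check_name:
  assumes t: "transitive t" and x: "x \<in>\<^sub>V t" and y: "name y" and p: "p \<in>\<^sub>V P"
  shows "forces_mem p y (check_name x) \<longleftrightarrow>
    (\<forall>q. q \<in>\<^sub>V P \<longrightarrow> q \<preceq> p \<longrightarrow> (\<exists>s z. s \<in>\<^sub>V P \<and> s \<preceq> q \<and> z \<in>\<^sub>V x \<and> forces_eq s y (check_name z)))"
proof -
  have "name u" if "u \<in>\<^sub>V check_set x" for u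
    using that check_name_HS[OF t] HS_name t x unfolding mem_check_set transitive_def by blast
  then show ?thesis unfolding check_name_full[OF t x]
    unfolding forces_mem_full_name mem_check_set by blast
qed

lemma check_name_mem:
  assumes "transitive t" "x \<in>\<^sub>V t" "z \<in>\<^sub>V x" "p \<in>\<^sub>V P" shows "forces_mem p (check_name z) (check_name x)"
proof -
  have "z \<in>\<^sub>V t" using assms unfolding transitive_def by blast
  then have n: "name (check_name z)" using check_name_HS[OF assms(1)] HS_name by blast
  then show ?thesis unfolding forces_mem_check_name[OF assms(1,2) n assms(4)]
    using assms(3) forces_eq_refl leq_refl by blast
qed

text \<open>If \<open>x\<close> is minimal such that some condition forces the canonical name of \<open>x\<close> into itself,
  a stronger condition identifies it with the canonical name of some \<open>z \<in> x\<close>, for which the same then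
  holds.\<close>

lemma check_name_irrefl:
  assumes t: "transitive t" and x: "x \<in>\<^sub>V t" and p: "p \<in>\<^sub>V P"
  shows "\<not> forces_mem p (check_name x) (check_name x)"
proof
  assume "forces_mem p (check_name x) (check_name x)"
  then have Q0: "\<exists>p. p \<in>\<^sub>V P \<and> forces_mem p (check_name x) (check_name x)" using p by blast
  define Q where "Q x \<longleftrightarrow> (\<exists>p. p \<in>\<^sub>V P \<and> forces_mem p (check_name x) (check_name x))" for x
  have Q_dfn: "definable1 Q" unfolding Q_def by (intro dfn)
  obtain m where m: "m \<in>\<^sub>V t" "Q m" and min: "\<And>y. y \<in>\<^sub>V t \<Longrightarrow> y \<in>\<^sub>V m \<Longrightarrow> \<not> Q y"
    by (rule wf_set_minimal[OF wf_set_mem Q_dfn x Q0[folded Q_def]]) blast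
  obtain q where q: "q \<in>\<^sub>V P" "forces_mem q (check_name m) (check_name m)" using m(2) unfolding Q_def by blast
  have nm: "name (check_name m)" using check_name_HS[OF t m(1)] HS_name by blast
  obtain s z where s: "s \<in>\<^sub>V P" "s \<preceq> q" "z \<in>\<^sub>V m" "forces_eq s (check_name m) (check_name z)"
    using q(2) unfolding forces_mem_check_name[OF t m(1) nm q(1)] using q(1) leq_refl by blast
  have zt: "z \<in>\<^sub>V t" using t m(1) s(3) unfolding transitive_def by blast
  have nz: "name (check_name z)" using check_name_HS[OF t zt] HS_name by blast
  have "forces_mem s (check_name z) (check_name z)"
    using forces_mem_eq_right[OF check_name_mem[OF t m(1) s(3,1)] s(4,1) nz nm nz] .
  then show False using min[OF zt s(3)] s(1) unfolding Q_def by blast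
qed

text \<open>Otherwise one of \<open>x\<close> and \<open>y\<close> is an element of the other, and a canonical name would be
  forced into itself.\<close>

lemma check_name_inject:
  assumes t: "ordinal t" and x: "x \<in>\<^sub>V t" and y: "y \<in>\<^sub>V t" and p: "p \<in>\<^sub>V P"
    and eq: "forces_eq p (check_name x) (check_name y)"
  shows "x = y"
proof (rule ccontr)
  assume "x \<noteq> y"
  then have "x \<in>\<^sub>V y \<or> y \<in>\<^sub>V x" using ordinal_linear[OF t x y] by blast
  have tr: "transitive t" using t unfolding ordinal_def by blast
  note n = HS_name[OF check_name_HS[OF tr x, THEN conjunct1]] HS_name[OF check_name_HS[OF tr y, THEN conjunct1]]
  have "forces_mem p (check_name y) (check_name y) \<or> forces_mem p (check_name x) (check_name x)"
    using \<open>x \<in>\<^sub>V y \<or> y \<in>\<^sub>V x\<close>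
  proof
    assume "x \<in>\<^sub>V y"
    then have "forces_mem p (check_name y) (check_name y)"
      using forces_mem_eq_left[OF check_name_mem[OF tr y _ p] eq p n n(2)] by blast
    then show ?thesis ..
  next
    assume "y \<in>\<^sub>V x"
    then have "forces_mem p (check_name x) (check_name x)"
      using forces_mem_eq_left[OF check_name_mem[OF tr x _ p] forces_eq_sym[OF eq p n] p n(2,1) n(1)] by blast
    then show ?thesis ..
  qed
  then show False using check_name_irrefl[OF tr x p] check_name_irrefl[OF tr y p] by blast
qed

end


section \<open>The symmetric forcing relation\<close>

context symmetric_model
begin

definition HS_env :: "(nat \<Rightarrow> 'v) \<Rightarrow> bool" where
  "HS_env e \<longleftrightarrow> (\<forall>i. e i \<in> HS)"

lemma HS_env_case: "x \<in> HS \<Longrightarrow> HS_env e \<Longrightarrow> HS_env (case_nat x e)"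
  unfolding HS_env_def by (simp split: nat.split)

lemma HS_env_HS: "HS_env e \<Longrightarrow> e i \<in> HS"
  and HS_env_name: "HS_env e \<Longrightarrow> name (e i)"
  unfolding HS_env_def using HS_name by blast+

lemma forces_HS_mono:
  "forces_HS p e \<phi> \<Longrightarrow> q \<preceq> p \<Longrightarrow> p \<in>\<^sub>V P \<Longrightarrow> q \<in>\<^sub>V P \<Longrightarrow> HS_env e \<Longrightarrow> forces_HS q e \<phi>"
proof (induction \<phi> arbitrary: e)
  case (Mem i j)
  then show ?case using forces_mem_mono by simp
next
  case (Eq i j)
  then show ?case using forces_eq_mono HS_env_name by simp
next
  case (Neg \<phi>)
  then show ?case using leq_trans by simp
next
  case (Conj \<phi> \<psi>)
  then show ?case by simp
next
  case (All \<phi>)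
  then show ?case using HS_env_case by simp
qed

lemma forces_HS_dense:
  "p \<in>\<^sub>V P \<Longrightarrow> HS_env e \<Longrightarrow> (\<And>q. q \<in>\<^sub>V P \<Longrightarrow> q \<preceq> p \<Longrightarrow> \<exists>s. s \<in>\<^sub>V P \<and> s \<preceq> q \<and> forces_HS s e \<phi>) \<Longrightarrow>
   forces_HS p e \<phi>"
proof (induction \<phi> arbitrary: e)
  case (Mem i j)
  then show ?case using forces_mem_dense[of p "e i" "e j"] by simp
next
  case (Eq i j)
  then show ?case using forces_eq_dense[of p "e i" "e j"] HS_env_name by simp
next
  case (Neg \<phi>)
  have "\<not> forces_HS q e \<phi>" if q: "q \<in>\<^sub>V P" "q \<preceq> p" for q
  proof
    assume f: "forces_HS q e \<phi>"
    obtain s where s: "s \<in>\<^sub>V P" "s \<preceq> q" "forces_HS s e (Neg \<phi>)" using Neg.prems(3)[OF q] by blast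
    have "forces_HS s e \<phi>" by (rule forces_HS_mono[OF f s(2) q(1) s(1) Neg.prems(2)])
    then show False using s leq_refl by simp
  qed
  then show ?case by simp
next
  case (Conj \<phi> \<psi>)
  have "\<exists>s. s \<in>\<^sub>V P \<and> s \<preceq> q \<and> forces_HS s e \<phi>" "\<exists>s. s \<in>\<^sub>V P \<and> s \<preceq> q \<and> forces_HS s e \<psi>"
    if "q \<in>\<^sub>V P" "q \<preceq> p" for q using Conj.prems(3)[OF that] unfolding forces_HS.simps by blast+
  then show ?case unfolding forces_HS.simps using Conj.IH Conj.prems(1,2) by blast
next
  case (All \<phi>)
  have "forces_HS p (case_nat x e) \<phi>" if x: "x \<in> HS" for x
    by (rule All.IH[OF All.prems(1) HS_env_case[OF x All.prems(2)]])
      (use All.prems(3) x in \<open>unfold forces_HS.simps, blast\<close>)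
  then show ?case by simp
qed

lemma forces_HS_cong:
  "forces_HS p e \<phi> \<Longrightarrow> p \<in>\<^sub>V P \<Longrightarrow> HS_env e \<Longrightarrow> HS_env e' \<Longrightarrow> (\<And>i. forces_eq p (e i) (e' i)) \<Longrightarrow> forces_HS p e' \<phi>"
proof (induction \<phi> arbitrary: p e e')
  case (Mem i j)
  have m: "forces_mem p (e i) (e j)" using Mem.prems(1) by simp
  have "forces_mem p (e' i) (e j)"
    by (rule forces_mem_eq_left[OF m Mem.prems(5,2)]) (use Mem.prems HS_env_name in blast)+
  then have "forces_mem p (e' i) (e' j)"
    by (rule forces_mem_eq_right[OF _ Mem.prems(5,2)]) (use Mem.prems HS_env_name in blast)+
  then show ?case by simp
next
  case (Eq i j)
  note n = HS_env_name[OF Eq.prems(3)] and n' = HS_env_name[OF Eq.prems(4)]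
  have m: "forces_eq p (e i) (e j)" using Eq.prems(1) by simp
  have "forces_eq p (e i) (e' j)" by (rule forces_eq_trans[OF m Eq.prems(5,2) n n n'])
  then have "forces_eq p (e' i) (e' j)"
    by (rule forces_eq_trans[OF forces_eq_sym[OF Eq.prems(5,2) n n'] _ Eq.prems(2) n' n n'])
  then show ?case by simp
next
  case (Neg \<phi>)
  have "\<not> forces_HS q e' \<phi>" if q: "q \<in>\<^sub>V P" "q \<preceq> p" for q
  proof
    assume f: "forces_HS q e' \<phi>"
    have "forces_eq q (e' i) (e i)" for i
    proof -
      have "forces_eq q (e i) (e' i)"
        by (rule forces_eq_mono[OF Neg.prems(5) q(2) Neg.prems(2) q(1)]) (use Neg.prems HS_env_name in blast)+
      then show ?thesis by (rule forces_eq_sym[OF _ q(1)]) (use Neg.prems HS_env_name in blast)+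
    qed
    then have "forces_HS q e \<phi>" by (rule Neg.IH[OF f q(1) Neg.prems(4,3)])
    then show False using Neg.prems(1) q by simp
  qed
  then show ?case by simp
next
  case (Conj \<phi> \<psi>)
  have c: "forces_HS p e \<phi>" "forces_HS p e \<psi>" using Conj.prems(1) by simp_all
  show ?case unfolding forces_HS.simps using Conj.IH(1)[OF c(1) Conj.prems(2-)] Conj.IH(2)[OF c(2) Conj.prems(2-)] ..
next
  case (All \<phi>)
  have "forces_HS p (case_nat x e') \<phi>" if x: "x \<in> HS" for x
  proof (rule All.IH[OF _ All.prems(2) HS_env_case[OF x All.prems(3)] HS_env_case[OF x All.prems(4)]])
    show "forces_HS p (case_nat x e) \<phi>" using All.prems(1) x by simp
    show "forces_eq p (case_nat x e i) (case_nat x e' i)" for i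
      using All.prems(5) forces_eq_refl[OF HS_name[OF x] All.prems(2)] by (cases i) simp_all
  qed
  then show ?case by simp
qed

text \<open>The connectives that are abbreviations behave as in Kripke semantics, with disjunctions and
  existential quantifiers decided densely.\<close>

lemma forces_Imp:
  assumes p: "p \<in>\<^sub>V P" and e: "HS_env e"
  shows "forces_HS p e (\<phi> \<^bold>\<longrightarrow> \<psi>) \<longleftrightarrow>
    (\<forall>q. q \<in>\<^sub>V P \<longrightarrow> q \<preceq> p \<longrightarrow> forces_HS q e \<phi> \<longrightarrow> forces_HS q e \<psi>)"
proof (intro iffI allI impI)
  fix q assume f: "forces_HS p e (\<phi> \<^bold>\<longrightarrow> \<psi>)" and q: "q \<in>\<^sub>V P" "q \<preceq> p" "forces_HS q e \<phi>"
  show "forces_HS q e \<psi>"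
  proof (rule forces_HS_dense[OF q(1) e])
    fix r assume r: "r \<in>\<^sub>V P" "r \<preceq> q"
    have "forces_HS r e \<phi>" by (rule forces_HS_mono[OF q(3) r(2) q(1) r(1) e])
    moreover have "r \<preceq> p" using leq_trans r q p by blast
    ultimately show "\<exists>s. s \<in>\<^sub>V P \<and> s \<preceq> r \<and> forces_HS s e \<psi>"
      using f r(1) unfolding forces_HS.simps ball_elts by blast
  qed
next
  assume f: "\<forall>q. q \<in>\<^sub>V P \<longrightarrow> q \<preceq> p \<longrightarrow> forces_HS q e \<phi> \<longrightarrow> forces_HS q e \<psi>"
  then show "forces_HS p e (\<phi> \<^bold>\<longrightarrow> \<psi>)" unfolding forces_HS.simps ball_elts using leq_refl by blast
qed

lemma forces_Ex:
  "forces_HS p e (Ex \<phi>) \<longleftrightarrow> (\<forall>q. q \<in>\<^sub>V P \<longrightarrow> q \<preceq> p \<longrightarrow>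
     (\<exists>s x. s \<in>\<^sub>V P \<and> s \<preceq> q \<and> x \<in> HS \<and> forces_HS s (case_nat x e) \<phi>))"
  unfolding forces_HS.simps ball_elts by blast

lemma forces_Disj:
  "forces_HS p e (\<phi> \<^bold>\<or> \<psi>) \<longleftrightarrow> (\<forall>q. q \<in>\<^sub>V P \<longrightarrow> q \<preceq> p \<longrightarrow>
     (\<exists>s. s \<in>\<^sub>V P \<and> s \<preceq> q \<and> (forces_HS s e \<phi> \<or> forces_HS s e \<psi>)))"
  unfolding forces_HS.simps ball_elts by blast

lemma forces_BAll:
  assumes p: "p \<in>\<^sub>V P" and e: "HS_env e"
  shows "forces_HS p e (BAll a \<phi>) \<longleftrightarrow>
    (\<forall>x q. x \<in> HS \<longrightarrow> q \<in>\<^sub>V P \<longrightarrow> q \<preceq> p \<longrightarrow> forces_mem q x (e a) \<longrightarrow> forces_HS q (case_nat x e) \<phi>)"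
proof -
  have "forces_HS p (case_nat x e) (Mem 0 (a + 1) \<^bold>\<longrightarrow> \<phi>) \<longleftrightarrow>
      (\<forall>q. q \<in>\<^sub>V P \<longrightarrow> q \<preceq> p \<longrightarrow> forces_mem q x (e a) \<longrightarrow> forces_HS q (case_nat x e) \<phi>)" if "x \<in> HS" for x
    unfolding forces_Imp[OF p HS_env_case[OF that e]] by simp
  then show ?thesis unfolding forces_HS.simps(5) by blast
qed

lemma forces_BEx:
  "forces_HS p e (BEx a \<phi>) \<longleftrightarrow> (\<forall>q. q \<in>\<^sub>V P \<longrightarrow> q \<preceq> p \<longrightarrow>
     (\<exists>s x. s \<in>\<^sub>V P \<and> s \<preceq> q \<and> x \<in> HS \<and> forces_mem s x (e a) \<and> forces_HS s (case_nat x e) \<phi>))"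
  unfolding forces_Ex by simp

lemma forces_ExI:
  assumes "p \<in>\<^sub>V P" "HS_env e" "x \<in> HS" "forces_HS p (case_nat x e) \<phi>" shows "forces_HS p e (Ex \<phi>)"
  unfolding forces_Ex
proof (intro allI impI)
  fix q assume q: "q \<in>\<^sub>V P" "q \<preceq> p"
  have "forces_HS q (case_nat x e) \<phi>"
    by (rule forces_HS_mono[OF assms(4) q(2) assms(1) q(1) HS_env_case[OF assms(3,2)]])
  then show "\<exists>s x. s \<in>\<^sub>V P \<and> s \<preceq> q \<and> x \<in> HS \<and> forces_HS s (case_nat x e) \<phi>" using q assms(3) leq_refl by blast
qed

text \<open>Extensionality in the symmetric extension: the names appearing in a hereditarily
  symmetric name are hereditarily symmetric, so quantifying over \<open>HS\<close> loses no elements.\<close>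

lemma forces_eq_ext:
  assumes p: "p \<in>\<^sub>V P" and x: "x \<in> HS" and y: "y \<in> HS"
    and "\<And>z q. z \<in> HS \<Longrightarrow> q \<in>\<^sub>V P \<Longrightarrow> q \<preceq> p \<Longrightarrow> forces_mem q z x \<longleftrightarrow> forces_mem q z y"
  shows "forces_eq p x y"
proof (rule forces_eqI[OF p HS_name[OF x] HS_name[OF y]])
  fix r z q assume q: "q \<in>\<^sub>V P" "q \<preceq> p" "q \<preceq> r"
  show "forces_mem q z y" if z: "\<langle>r, z\<rangle> \<in>\<^sub>V x"
    using assms(4)[OF _ q(1,2)] HS_opair[OF x z] forces_mem_opair[OF HS_name[OF x] z q(1,3)] by blast
  show "forces_mem q z x" if z: "\<langle>r, z\<rangle> \<in>\<^sub>V y"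
    using assms(4)[OF _ q(1,2)] HS_opair[OF y z] forces_mem_opair[OF HS_name[OF y] z q(1,3)] by blast
qed

lemma forces_mem_upair_name:
  "forces_mem p z (upair_name x y) \<longleftrightarrow> (\<forall>q. q \<in>\<^sub>V P \<longrightarrow> q \<preceq> p \<longrightarrow>
     (\<exists>s. s \<in>\<^sub>V P \<and> s \<preceq> q \<and> (forces_eq s z x \<or> forces_eq s z y)))"
  unfolding upair_name_def forces_mem_full_name mem_upair by blast

text \<open>The formulas for pairs are absolute: they are forced exactly when the canonical names of
  the pairs are forced to be equal to the given ones.\<close>

lemma forces_Upair_fm:
  assumes p: "p \<in>\<^sub>V P" and e: "HS_env e"
  shows "forces_HS p e (Upair_fm a b c) \<longleftrightarrow> forces_eq p (e c) (upair_name (e a) (e b))"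
proof -
  let ?u = "upair_name (e a) (e b)"
  have u: "?u \<in> HS" by (rule upair_name_HS) (rule HS_env_HS[OF e])+
  have disj: "forces_HS q (case_nat z e) (Eq 0 (a + 1) \<^bold>\<or> Eq 0 (b + 1)) \<longleftrightarrow> forces_mem q z ?u" for q z
    unfolding forces_Disj forces_mem_upair_name by simp
  have iff: "forces_HS p (case_nat z e) (Mem 0 (c + 1) \<^bold>\<longleftrightarrow> (Eq 0 (a + 1) \<^bold>\<or> Eq 0 (b + 1))) \<longleftrightarrow>
      (\<forall>q. q \<in>\<^sub>V P \<longrightarrow> q \<preceq> p \<longrightarrow> (forces_mem q z (e c) \<longleftrightarrow> forces_mem q z ?u))" if z: "z \<in> HS" for z
  proof -
    note imp = forces_Imp[OF p HS_env_case[OF z e]]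
    have m: "forces_HS q (case_nat z e) (Mem 0 (c + 1)) \<longleftrightarrow> forces_mem q z (e c)" for q by simp
    show ?thesis unfolding forces_HS.simps(4)[of _ _ "_ \<^bold>\<longrightarrow> _"] imp disj m by blast
  qed
  have all: "forces_HS p e (Upair_fm a b c) \<longleftrightarrow>
      (\<forall>z q. z \<in> HS \<longrightarrow> q \<in>\<^sub>V P \<longrightarrow> q \<preceq> p \<longrightarrow> (forces_mem q z (e c) \<longleftrightarrow> forces_mem q z ?u))"
    unfolding Upair_fm_def forces_HS.simps(5) using iff by blast
  show ?thesis unfolding all
  proof
    assume "\<forall>z q. z \<in> HS \<longrightarrow> q \<in>\<^sub>V P \<longrightarrow> q \<preceq> p \<longrightarrow> (forces_mem q z (e c) \<longleftrightarrow> forces_mem q z ?u)"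
    then show "forces_eq p (e c) ?u" by (intro forces_eq_ext[OF p HS_env_HS[OF e] u]) blast
  next
    assume eq: "forces_eq p (e c) ?u"
    note n = HS_env_name[OF e, of c] HS_name[OF u]
    show "\<forall>z q. z \<in> HS \<longrightarrow> q \<in>\<^sub>V P \<longrightarrow> q \<preceq> p \<longrightarrow> (forces_mem q z (e c) \<longleftrightarrow> forces_mem q z ?u)"
    proof (intro allI impI)
      fix z q assume z: "z \<in> HS" and q: "q \<in>\<^sub>V P" "q \<preceq> p"
      have eq_q: "forces_eq q (e c) ?u" by (rule forces_eq_mono[OF eq q(2) p q(1) n])
      show "forces_mem q z (e c) \<longleftrightarrow> forces_mem q z ?u"
        using forces_mem_eq_right[OF _ eq_q q(1) HS_name[OF z] n]
          forces_mem_eq_right[OF _ forces_eq_sym[OF eq_q q(1) n] q(1) HS_name[OF z] n(2,1)] by blast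
    qed
  qed
qed

lemma forces_Pair_fm:
  assumes p: "p \<in>\<^sub>V P" and e: "HS_env e"
  shows "forces_HS p e (Pair_fm a b c) \<longleftrightarrow> forces_eq p (e c) (opair_name (e a) (e b))"
proof -
  let ?u = "upair_name (e a) (e a)" and ?v = "upair_name (e a) (e b)"
  have u: "?u \<in> HS" and v: "?v \<in> HS" by (intro upair_name_HS HS_env_HS[OF e])+
  have body: "forces_HS s (case_nat y (case_nat x e)) (Upair_fm (a + 2) (a + 2) 1 \<^bold>\<and> Upair_fm (a + 2) (b + 2) 0 \<^bold>\<and>
      Upair_fm 1 0 (c + 2)) \<longleftrightarrow> forces_eq s x ?u \<and> forces_eq s y ?v \<and> forces_eq s (e c) (upair_name x y)"
    if "s \<in>\<^sub>V P" "x \<in> HS" "y \<in> HS" for s x y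
    unfolding forces_HS.simps(4) using that e
    by (simp add: forces_Upair_fm HS_env_case numeral_2_eq_2)
  show ?thesis
  proof
    assume f: "forces_HS p e (Pair_fm a b c)"
    show "forces_eq p (e c) (opair_name (e a) (e b))"
    proof (rule forces_eq_dense[OF p HS_env_name[OF e] HS_name[OF opair_name_HS[OF HS_env_HS[OF e] HS_env_HS[OF e]]]])
      fix q assume q: "q \<in>\<^sub>V P" "q \<preceq> p"
      from f q obtain s x where s: "s \<in>\<^sub>V P" "s \<preceq> q" "x \<in> HS"
        "forces_HS s (case_nat x e) (Ex (Upair_fm (a + 2) (a + 2) 1 \<^bold>\<and> Upair_fm (a + 2) (b + 2) 0 \<^bold>\<and> Upair_fm 1 0 (c + 2)))"
        unfolding Pair_fm_def forces_Ex[of p] by blast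
      from s(4) s(1) leq_refl[OF s(1)] obtain r y where r: "r \<in>\<^sub>V P" "r \<preceq> s" "y \<in> HS"
        "forces_HS r (case_nat y (case_nat x e)) (Upair_fm (a + 2) (a + 2) 1 \<^bold>\<and> Upair_fm (a + 2) (b + 2) 0 \<^bold>\<and> Upair_fm 1 0 (c + 2))"
        unfolding forces_Ex[of s] by blast
      have eqs: "forces_eq r x ?u" "forces_eq r y ?v" "forces_eq r (e c) (upair_name x y)"
        using r(4) unfolding body[OF r(1) s(3) r(3)] by blast+
      note n = HS_name[OF s(3)] HS_name[OF r(3)] HS_name[OF u] HS_name[OF v]
      have "forces_eq r (upair_name x y) (upair_name ?u ?v)" by (rule forces_upair_cong[OF r(1) n eqs(1,2)])
      then have "forces_eq r (e c) (opair_name (e a) (e b))" unfolding opair_name_def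
        by (rule forces_eq_trans[OF eqs(3) _ r(1) HS_env_name[OF e] name_upair_name[OF n(1,2)] name_upair_name[OF n(3,4)]])
      moreover have "r \<preceq> q" using leq_trans r s q by blast
      ultimately show "\<exists>s. s \<in>\<^sub>V P \<and> s \<preceq> q \<and> forces_eq s (e c) (opair_name (e a) (e b))" using r(1) by blast
    qed
  next
    assume eq: "forces_eq p (e c) (opair_name (e a) (e b))"
    show "forces_HS p e (Pair_fm a b c)" unfolding Pair_fm_def
    proof (rule forces_ExI[OF p e u], rule forces_ExI[OF p HS_env_case[OF u e] v])
      show "forces_HS p (case_nat ?v (case_nat ?u e)) (Upair_fm (a + 2) (a + 2) 1 \<^bold>\<and> Upair_fm (a + 2) (b + 2) 0 \<^bold>\<and>
          Upair_fm 1 0 (c + 2))"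
        unfolding body[OF p u v] using eq forces_eq_refl[OF HS_name p] u v unfolding opair_name_def by blast
    qed
  qed
qed

lemma forces_Rel_fm:
  assumes p: "p \<in>\<^sub>V P" and e: "HS_env e"
  shows "forces_HS p e (Rel_fm a b r) \<longleftrightarrow> forces_mem p (opair_name (e a) (e b)) (e r)"
proof -
  let ?o = "opair_name (e a) (e b)"
  have o: "?o \<in> HS" by (intro opair_name_HS HS_env_HS[OF e])
  have pair: "forces_HS s (case_nat x e) (Pair_fm (a + 1) (b + 1) 0) \<longleftrightarrow> forces_eq s x ?o"
    if "s \<in>\<^sub>V P" "x \<in> HS" for s x
    using that e by (simp add: forces_Pair_fm HS_env_case)
  show ?thesis
  proof
    assume f: "forces_HS p e (Rel_fm a b r)"
    show "forces_mem p ?o (e r)"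
    proof (rule forces_mem_dense[OF p])
      fix q assume "q \<in>\<^sub>V P" "q \<preceq> p"
      with f obtain s x where s: "s \<in>\<^sub>V P" "s \<preceq> q" "x \<in> HS" "forces_mem s x (e r)"
        "forces_HS s (case_nat x e) (Pair_fm (a + 1) (b + 1) 0)"
        unfolding Rel_fm_def forces_BEx by blast
      have "forces_mem s ?o (e r)"
        by (rule forces_mem_eq_left[OF s(4) s(5)[unfolded pair[OF s(1,3)]] s(1) HS_name[OF s(3)] HS_name[OF o] HS_env_name[OF e]])
      with s show "\<exists>s. s \<in>\<^sub>V P \<and> s \<preceq> q \<and> forces_mem s ?o (e r)" by blast
    qed
  next
    assume m: "forces_mem p ?o (e r)"
    show "forces_HS p e (Rel_fm a b r)" unfolding Rel_fm_def
    proof (rule forces_ExI[OF p e o])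
      show "forces_HS p (case_nat ?o e) (Mem 0 (r + 1) \<^bold>\<and> Pair_fm (a + 1) (b + 1) 0)"
        unfolding forces_HS.simps(4) pair[OF p o] using m forces_eq_refl[OF HS_name[OF o] p] by simp
    qed
  qed
qed

end


section \<open>Fullness\<close>

locale dc_model = symmetric_model mem P le Gr Fl
  for mem :: "'v \<Rightarrow> 'v \<Rightarrow> bool" (infix "\<in>\<^sub>V" 50) and P le Gr Fl :: 'v +
  fixes lam :: 'v
  assumes cardinal: "infinite_cardinal lam"
    and chain_condition: "chain_condition lam"
    and complete: "complete_filter lam"
begin

lemma lam_ordinal: "ordinal lam"
  by (rule infinite_cardinal_ordinal[OF cardinal])

lemma lam_trans: "x \<in>\<^sub>V lam \<Longrightarrow> y \<in>\<^sub>V x \<Longrightarrow> y \<in>\<^sub>V lam"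
  by (rule ordinal_trans[OF lam_ordinal])

text \<open>Completeness of the filter, applied to the set of stabilizers. Several
  entries may have the same stabilizer, so that this set is small takes \<open>card_less_image\<close>.\<close>

lemma family_support:
  assumes b: "b \<in>\<^sub>V lam" and x: "definable_fun1 x" and HS: "\<And>i. i \<in>\<^sub>V b \<Longrightarrow> x i \<in> HS"
  obtains L where "L \<in>\<^sub>V Fl" "\<And>i. i \<in>\<^sub>V b \<Longrightarrow> supports L (x i)"
proof (cases "elts b = {}")
  case True
  then show ?thesis using that Gr_Fl by simp
next
  case False
  define h where "h i = stabilizer (x i)" for i
  have h_dfn: "definable_fun1 h" unfolding h_def by (rule definable_fun1_app[OF definable_stabilizer x])
  define X where "X = vset (h ` elts b)"
  have X: "elts X = h ` elts b" unfolding X_def by (rule elts_vset[OF replacement[OF h_dfn]])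
  have Fl: "h i \<in>\<^sub>V Fl" if i: "i \<in>\<^sub>V b" for i
  proof -
    obtain L where "supports L (x i)" using HS_supports[OF HS[OF i]] by blast
    then show ?thesis unfolding h_def by (rule stabilizer_Fl[OF HS_name[OF HS[OF i]]])
  qed
  have ne: "elts X \<noteq> {}" unfolding X using False by blast
  have sub: "elts X \<subseteq> elts Fl" unfolding X using Fl by auto
  have card: "card_less X lam" unfolding X_def by (rule card_less_image[OF lam_ordinal b h_dfn])
  have "elts X \<noteq> {} \<and> elts X \<subseteq> elts Fl \<and> card_less X lam \<longrightarrow>
      (\<exists>L\<in>elts Fl. elts L = (\<Inter>H\<in>elts X. elts H))"
    using complete unfolding complete_filter_def by (rule spec)
  then have "\<exists>L\<in>elts Fl. elts L = (\<Inter>H\<in>elts X. elts H)"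
    by (rule mp) (rule conjI[OF ne conjI[OF sub card]])
  then obtain L where L: "L \<in>\<^sub>V Fl" "elts L = (\<Inter>H\<in>elts X. elts H)" unfolding bex_elts by (elim exE conjE)
  have "supports L (x i)" if i: "i \<in>\<^sub>V b" for i
  proof -
    have "elts L \<subseteq> elts (h i)" unfolding L(2) X using i by auto
    then have "name_act \<pi> (x i) = x i" if "\<pi> \<in>\<^sub>V L" for \<pi>
      using that unfolding h_def elts_stabilizer by auto
    with L(1) show ?thesis unfolding supports_def by blast
  qed
  with L(1) show ?thesis by (rule that)
qed

text \<open>Choosing pairwise incompatible conditions along \<open>lam\<close> must stop before \<open>lam\<close>, since otherwise
  they would form an antichain of size \<open>lam\<close>. The stage at which it stops indexes a maximal
  antichain.\<close>

lemma maximal_antichain: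
  assumes D: "definable1 D"
  obtains b f where "b \<in>\<^sub>V lam" "definable_fun1 f" "\<And>i. i \<in>\<^sub>V b \<Longrightarrow> f i \<in>\<^sub>V P \<and> D (f i)"
    "\<And>p. p \<in>\<^sub>V P \<Longrightarrow> D p \<Longrightarrow> \<exists>i. i \<in>\<^sub>V b \<and> compatible p (f i)"
proof -
  obtain ch where ch_dfn: "definable_fun1 ch"
    and ch: "\<And>A. elts A \<subseteq> elts P \<Longrightarrow> elts A \<noteq> {} \<Longrightarrow> ch A \<in>\<^sub>V A"
    using choice[of P] by blast
  define H where "H i g = ch (vset {p. p \<in>\<^sub>V P \<and> D p \<and> (\<forall>j\<in>elts i. \<not> compatible p (ap g j))})" for i g
  have H_dfn: "definable_fun2 H" unfolding H_def
    by (intro dfn definable_fun1_app[OF ch_dfn] definable1_app[OF D])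
  have mem_dfn: "definable2 (\<in>\<^sub>V)" by (intro dfn)
  obtain f where f_dfn: "definable_fun1 f" and
    f: "\<And>i. i \<in>\<^sub>V lam \<Longrightarrow> f i = H i (graph f {j \<in> elts lam. j \<in>\<^sub>V i})"
    by (rule recursion[OF wf_set_mem[of lam] mem_dfn H_dfn]) blast
  define C where "C i = {p \<in> elts P. D p \<and> (\<forall>j\<in>elts i. \<not> compatible p (f j))}" for i
  have C_set: "isset (C i)" for i unfolding C_def
    by (rule separation) (intro dfn definable1_app[OF D] definable_fun1_app[OF f_dfn])
  have f_eq: "f i = ch (vset (C i))" if i: "i \<in>\<^sub>V lam" for i
  proof -
    have iss: "isset {j \<in> elts lam. j \<in>\<^sub>V i}" by (rule separation) (intro dfn)
    have "ap (graph f {j \<in> elts lam. j \<in>\<^sub>V i}) j = f j" if "j \<in>\<^sub>V i" for j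
      using ap_graph[OF f_dfn iss] lam_trans[OF i that] that by simp
    then have "{p. p \<in>\<^sub>V P \<and> D p \<and> (\<forall>j\<in>elts i. \<not> compatible p (ap (graph f {j \<in> elts lam. j \<in>\<^sub>V i}) j))} = C i"
      unfolding C_def by auto
    then show ?thesis using f[OF i] unfolding H_def by (simp only:)
  qed
  have fC: "f i \<in> C i" if "i \<in>\<^sub>V lam" "C i \<noteq> {}" for i
  proof -
    have e: "elts (vset (C i)) = C i" by (rule elts_vset[OF C_set])
    have "ch (vset (C i)) \<in> elts (vset (C i))"
      unfolding elts_iff by (rule ch) (use that(2) e in \<open>auto simp: C_def\<close>)
    then show ?thesis unfolding e f_eq[OF that(1)] .
  qed
  have "\<exists>i. i \<in>\<^sub>V lam \<and> C i = {}"
  proof (rule ccontr)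
    assume "\<not> ?thesis"
    then have all: "f i \<in> C i" if "i \<in>\<^sub>V lam" for i using fC that by blast
    have inc: "\<not> compatible (f i) (f j)" if ij: "i \<in>\<^sub>V lam" "j \<in>\<^sub>V lam" "i \<noteq> j" for i j
    proof -
      have "i \<in>\<^sub>V j \<or> j \<in>\<^sub>V i" using ordinal_linear[OF lam_ordinal] ij by blast
      then have "\<not> compatible (f i) (f j) \<or> \<not> compatible (f j) (f i)"
        using all[OF ij(1)] all[OF ij(2)] unfolding C_def by auto
      then show ?thesis unfolding compatible_def by blast
    qed
    have P: "f i \<in>\<^sub>V P" if "i \<in>\<^sub>V lam" for i using all[OF that] unfolding C_def by simp
    have "inj_on f (elts lam)"
    proof (rule inj_onI)
      fix i j assume ij: "i \<in> elts lam" "j \<in> elts lam" "f i = f j"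
      have "compatible (f i) (f i)" using P ij leq_refl unfolding compatible_def by auto
      then show "i = j" using inc[of i j] ij by auto
    qed
    then have "\<not> card_less (vset (f ` elts lam)) lam" by (rule infinite_cardinal_image[OF cardinal f_dfn])
    moreover have e: "elts (vset (f ` elts lam)) = f ` elts lam" by (rule elts_vset[OF replacement[OF f_dfn]])
    have "antichain (vset (f ` elts lam))" unfolding antichain_def e using P inc by (auto simp: image_subset_iff)
    ultimately show False using chain_condition unfolding chain_condition_def by blast
  qed
  then obtain i0 where i0: "i0 \<in>\<^sub>V lam" "C i0 = {}" by blast
  have "definable1 (\<lambda>i. C i = {})" unfolding C_def
    by (intro dfn definable1_app[OF D] definable_fun1_app[OF f_dfn])
  then obtain b where b: "b \<in>\<^sub>V lam" "C b = {}" "\<And>i. i \<in>\<^sub>V lam \<Longrightarrow> i \<in>\<^sub>V b \<Longrightarrow> C i \<noteq> {}"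
    by (rule wf_set_minimal[OF wf_set_mem, where Q = "\<lambda>i. C i = {}", OF _ i0]) blast
  show ?thesis
  proof (rule that[OF b(1) f_dfn])
    show "f i \<in>\<^sub>V P \<and> D (f i)" if "i \<in>\<^sub>V b" for i
      using fC[OF lam_trans[OF b(1) that] b(3)[OF lam_trans[OF b(1) that] that]] unfolding C_def by simp
    show "\<exists>i. i \<in>\<^sub>V b \<and> compatible p (f i)" if "p \<in>\<^sub>V P" "D p" for p
      using b(2) that unfolding C_def by auto
  qed
qed

text \<open>The names obtained by mixing names that appear in \<open>T\<close> are made of conditions and of names that
  appear in these. They form a set, from which the recursion in \<open>forces_chain\<close> can choose; the elements of
  \<open>T\<close> in the extension have a proper class of names.\<close>

definition candidates :: "'v \<Rightarrow> 'v" where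
  "candidates T = vset {x. x \<in> HS \<and>
     (\<forall>z\<in>elts x. \<exists>p y w. z = \<langle>p, y\<rangle> \<and> p \<in>\<^sub>V P \<and> appears y w \<and> appears w T)}"

lemma mem_candidates:
  "x \<in>\<^sub>V candidates T \<longleftrightarrow> x \<in> HS \<and>
     (\<forall>z. z \<in>\<^sub>V x \<longrightarrow> (\<exists>p y w. z = \<langle>p, y\<rangle> \<and> p \<in>\<^sub>V P \<and> appears y w \<and> appears w T))"
proof -
  define dom where "dom w = vset {y. appears y w}" for w
  have dom_dfn: "definable_fun1 dom" unfolding dom_def by (intro dfn)
  have dom: "y \<in>\<^sub>V dom w \<longleftrightarrow> appears y w" for y w
    unfolding dom_def appears_def by (simp add: mem_vset isset_snd)
  define d where "d = vset (\<Union>w\<in>elts (dom T). elts (dom w))"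
  have d: "y \<in>\<^sub>V d \<longleftrightarrow> (\<exists>w. appears y w \<and> appears w T)" for y
    unfolding d_def by (auto simp: mem_vset isset_UN[OF dom_dfn] dom)
  define S where "S = vset {x. elts x \<subseteq> elts (Times P d)}"
  have S: "x \<in>\<^sub>V S \<longleftrightarrow> (\<forall>z. z \<in>\<^sub>V x \<longrightarrow> z \<in>\<^sub>V Times P d)" for x
    unfolding S_def mem_vset[OF isset_Pow] by simp
  let ?A = "{x. x \<in> HS \<and> (\<forall>z\<in>elts x. \<exists>p y w. z = \<langle>p, y\<rangle> \<and> p \<in>\<^sub>V P \<and> appears y w \<and> appears w T)}"
  have "isset ?A"
  proof (rule isset_subset)
    show "definable1 (\<lambda>x. x \<in> ?A)" by (intro dfn)
    show "?A \<subseteq> elts S"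
    proof
      fix x assume x: "x \<in> ?A"
      have "z \<in>\<^sub>V Times P d" if "z \<in>\<^sub>V x" for z using x that unfolding mem_Times d mem_Collect_eq ball_elts by blast
      then show "x \<in> elts S" using S by simp
    qed
  qed
  from mem_vset[OF this] show ?thesis unfolding candidates_def by simp
qed

text \<open>The maximum principle for hereditarily symmetric names, restricted to the elements of \<open>T\<close>. A group
  in the filter need not fix any conditions, so names cannot be mixed along an antichain of
  conditions. Instead, fewer than \<open>lam\<close> of the names appearing in \<open>T\<close>, the \<open>w i\<close>, are picked so that
  the open sets \<open>{p. \<Psi> p (w i)}\<close> together are dense in the set of all conditions that force \<open>\<Psi>\<close> for
  some name appearing in \<open>T\<close>. A group that fixes all \<open>w i\<close> and under which \<open>\<Psi>\<close> is invariant leaves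
  each of these open sets invariant. The disjoint sets \<open>V i\<close> of the conditions in the \<open>i\<close>-th one that are
  incompatible with everything in the earlier ones are then invariant, too, and the mixed name is
  forced to be \<open>w i\<close> on \<open>V i\<close>.\<close>

lemma fullness:
  assumes T: "T \<in> HS" and L: "L \<in>\<^sub>V Fl" and \<Psi>: "definable2 \<Psi>"
    and mono: "\<And>p q x. \<Psi> p x \<Longrightarrow> q \<preceq> p \<Longrightarrow> p \<in>\<^sub>V P \<Longrightarrow> q \<in>\<^sub>V P \<Longrightarrow> x \<in> HS \<Longrightarrow> \<Psi> q x"
    and act: "\<And>\<pi> p x. \<pi> \<in>\<^sub>V L \<Longrightarrow> p \<in>\<^sub>V P \<Longrightarrow> x \<in> HS \<Longrightarrow> \<Psi> p x \<Longrightarrow> \<Psi> (ap \<pi> p) (name_act \<pi> x)"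
    and cong: "\<And>p x y. \<Psi> p x \<Longrightarrow> p \<in>\<^sub>V P \<Longrightarrow> x \<in> HS \<Longrightarrow> y \<in> HS \<Longrightarrow> forces_eq p x y \<Longrightarrow> \<Psi> p y"
    and dense: "\<And>p x. p \<in>\<^sub>V P \<Longrightarrow> x \<in> HS \<Longrightarrow>
      (\<And>q. q \<in>\<^sub>V P \<Longrightarrow> q \<preceq> p \<Longrightarrow> \<exists>s. s \<in>\<^sub>V P \<and> s \<preceq> q \<and> \<Psi> s x) \<Longrightarrow> \<Psi> p x"
  obtains x where "x \<in>\<^sub>V candidates T" "\<forall>p. p \<in>\<^sub>V P \<longrightarrow>
      (\<forall>q. q \<in>\<^sub>V P \<longrightarrow> q \<preceq> p \<longrightarrow> (\<exists>s w. s \<in>\<^sub>V P \<and> s \<preceq> q \<and> appears w T \<and> \<Psi> s w)) \<longrightarrow> \<Psi> p x"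
proof -
  define D where "D p \<longleftrightarrow> (\<exists>w. appears w T \<and> \<Psi> p w)" for p
  have D_dfn: "definable1 D" unfolding D_def by (intro dfn definable2_app[OF \<Psi>])
  obtain b f where b: "b \<in>\<^sub>V lam" and f_dfn: "definable_fun1 f" and f: "\<And>i. i \<in>\<^sub>V b \<Longrightarrow> f i \<in>\<^sub>V P \<and> D (f i)"
    and max: "\<And>p. p \<in>\<^sub>V P \<Longrightarrow> D p \<Longrightarrow> \<exists>i. i \<in>\<^sub>V b \<and> compatible p (f i)"
    using maximal_antichain[OF D_dfn] by blast
  define W where "W = vset {y. appears y T}"
  have W: "w \<in>\<^sub>V W \<longleftrightarrow> appears w T" for w unfolding W_def appears_def by (simp add: mem_vset isset_snd)
  obtain ch where ch_dfn: "definable_fun1 ch"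
    and ch: "\<And>A. elts A \<subseteq> elts W \<Longrightarrow> elts A \<noteq> {} \<Longrightarrow> ch A \<in>\<^sub>V A"
    using choice[of W] by blast
  define w where "w i = ch (vset {w. w \<in>\<^sub>V W \<and> \<Psi> (f i) w})" for i
  have w_dfn: "definable_fun1 w" unfolding w_def
    by (intro dfn definable_fun1_app[OF ch_dfn] definable2_app[OF \<Psi>] definable_fun1_app[OF f_dfn])
  have w: "appears (w i) T \<and> \<Psi> (f i) (w i)" if i: "i \<in>\<^sub>V b" for i
  proof -
    have "isset {w \<in> elts W. \<Psi> (f i) w}" by (rule separation) (intro dfn definable2_app[OF \<Psi>])
    then have m: "u \<in>\<^sub>V vset {w. w \<in>\<^sub>V W \<and> \<Psi> (f i) w} \<longleftrightarrow> u \<in>\<^sub>V W \<and> \<Psi> (f i) u" for u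
      by (simp add: mem_vset)
    obtain u where "appears u T" "\<Psi> (f i) u" using f[OF i] unfolding D_def by blast
    then have "w i \<in>\<^sub>V vset {w. w \<in>\<^sub>V W \<and> \<Psi> (f i) w}" unfolding w_def
      by (intro ch) (use m W in auto)
    then show ?thesis using m[of "w i"] W by blast
  qed
  have wHS: "w i \<in> HS" if "i \<in>\<^sub>V b" for i using HS_appears[OF T] w[OF that] by blast
  obtain L1 where L1: "L1 \<in>\<^sub>V Fl" "\<And>i. i \<in>\<^sub>V b \<Longrightarrow> supports L1 (w i)"
    using family_support[OF b w_dfn wHS] by blast
  obtain M where M: "M \<in>\<^sub>V Fl" "\<And>\<pi>. \<pi> \<in>\<^sub>V M \<Longrightarrow> \<pi> \<in>\<^sub>V L \<and> \<pi> \<in>\<^sub>V L1" using Fl_Int_mem[OF L L1(1)] by blast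
  have MGr: "\<pi> \<in>\<^sub>V Gr" if "\<pi> \<in>\<^sub>V M" for \<pi> using Fl_Gr[OF M(1) that] .
  have fixed: "name_act \<pi> (w i) = w i" if "\<pi> \<in>\<^sub>V M" "i \<in>\<^sub>V b" for \<pi> i
    using L1(2)[OF that(2)] M(2)[OF that(1)] unfolding supports_def by blast
  have U_act: "\<Psi> (ap \<pi> p) (w i)" if "\<pi> \<in>\<^sub>V M" "i \<in>\<^sub>V b" "p \<in>\<^sub>V P" "\<Psi> p (w i)" for \<pi> i p
    using act[of \<pi> p "w i"] M(2)[OF that(1)] wHS[OF that(2)] fixed[OF that(1,2)] that by simp
  define V where "V i p \<longleftrightarrow> \<Psi> p (w i) \<and> (\<forall>j\<in>elts i. \<forall>q\<in>elts P. q \<preceq> p \<longrightarrow> \<not> \<Psi> q (w j))" for i p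
  have V_dfn: "definable2 V" unfolding V_def by (intro dfn definable2_app[OF \<Psi>] definable_fun1_app[OF w_dfn])
  have V_mono: "V i q" if "V i p" "q \<preceq> p" "p \<in>\<^sub>V P" "q \<in>\<^sub>V P" "i \<in>\<^sub>V b" for i p q
    using that mono[of p "w i" q] wHS leq_trans unfolding V_def ball_elts by blast
  have V_disjoint: "i = j" if "V i p" "V j p" "i \<in>\<^sub>V b" "j \<in>\<^sub>V b" "p \<in>\<^sub>V P" for i j p
    using ordinal_linear[OF ordinal_mem[OF lam_ordinal b] that(3,4)] that leq_refl[OF that(5)]
    unfolding V_def ball_elts by blast
  have V_act: "V i (ap \<pi> p)" if \<pi>: "\<pi> \<in>\<^sub>V M" and i: "i \<in>\<^sub>V b" and p: "p \<in>\<^sub>V P" and V: "V i p" for \<pi> i p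
    unfolding V_def ball_elts
  proof (intro conjI allI impI notI)
    show "\<Psi> (ap \<pi> p) (w i)" using U_act \<pi> i p V unfolding V_def by blast
    fix j q assume j: "j \<in>\<^sub>V i" and q: "q \<in>\<^sub>V P" "q \<preceq> ap \<pi> p" and \<Psi>q: "\<Psi> q (w j)"
    have jb: "j \<in>\<^sub>V b" using ordinal_trans[OF ordinal_mem[OF lam_ordinal b] i j] .
    obtain \<tau> where \<tau>: "\<tau> \<in>\<^sub>V M" "\<And>p. p \<in>\<^sub>V P \<Longrightarrow> ap \<tau> (ap \<pi> p) = p"
      using subgroup_inv[OF Fl_subgrp[OF M(1)] \<pi>] by blast
    have "ap \<tau> q \<preceq> ap \<tau> (ap \<pi> p)"
      using aut_leq[OF MGr[OF \<tau>(1)] q(1) aut_cond[OF MGr[OF \<pi>] p]] q(2) by blast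
    then have "ap \<tau> q \<preceq> p" using \<tau>(2)[OF p] by simp
    moreover have "\<Psi> (ap \<tau> q) (w j)" by (rule U_act[OF \<tau>(1) jb q(1) \<Psi>q])
    ultimately show False using V j aut_cond[OF MGr[OF \<tau>(1)] q(1)] unfolding V_def ball_elts by blast
  qed
  \<comment> \<open>The mixed name: on \<open>V i\<close> it has the elements of \<open>w i\<close>.\<close>
  define x where "x = vset {z. \<exists>p y. z = \<langle>p, y\<rangle> \<and> p \<in>\<^sub>V P \<and>
      (\<exists>i\<in>elts b. V i p \<and> appears y (w i) \<and> forces_mem p y (w i))}"
  define mixed where "mixed p y \<longleftrightarrow> p \<in>\<^sub>V P \<and> (\<exists>i. i \<in>\<^sub>V b \<and> V i p \<and> appears y (w i) \<and> forces_mem p y (w i))" for p y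
  have x: "z \<in>\<^sub>V x \<longleftrightarrow> (\<exists>p y. z = \<langle>p, y\<rangle> \<and> mixed p y)" for z
  proof -
    define dom where "dom i = vset {y. appears y (w i)}" for i
    have dom_dfn: "definable_fun1 dom" unfolding dom_def by (intro dfn definable_fun1_app[OF w_dfn])
    have dom: "y \<in>\<^sub>V dom i \<longleftrightarrow> appears y (w i)" for y i
      unfolding dom_def appears_def by (simp add: mem_vset isset_snd)
    define d where "d = vset (\<Union>i\<in>elts b. elts (dom i))"
    have d: "y \<in>\<^sub>V d \<longleftrightarrow> (\<exists>i. i \<in>\<^sub>V b \<and> appears y (w i))" for y
      unfolding d_def by (auto simp: mem_vset isset_UN[OF dom_dfn] dom)
    have "isset {z. \<exists>p y. z = \<langle>p, y\<rangle> \<and> p \<in>\<^sub>V P \<and> (\<exists>i\<in>elts b. V i p \<and> appears y (w i) \<and> forces_mem p y (w i))}"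
      (is "isset ?A")
    proof (rule isset_subset)
      show "definable1 (\<lambda>z. z \<in> ?A)" by (intro dfn definable2_app[OF V_dfn] definable_fun1_app[OF w_dfn])
      show "?A \<subseteq> elts (Times P d)"
      proof
        fix z assume "z \<in> ?A"
        then obtain p y where "z = \<langle>p, y\<rangle>" "p \<in>\<^sub>V P" "y \<in>\<^sub>V d" unfolding d by auto
        then show "z \<in> elts (Times P d)" by simp
      qed
    qed
    from mem_vset[OF this] show ?thesis unfolding x_def mixed_def by simp
  qed
  have x_opair: "\<langle>p, y\<rangle> \<in>\<^sub>V x \<longleftrightarrow> mixed p y" for p y unfolding x by simp
  have yHS: "y \<in> HS" if "mixed p y" for p y using that HS_appears wHS unfolding mixed_def by blast
  have nx: "name x" by (rule name_I) (use x yHS HS_name in \<open>unfold mixed_def, blast\<close>)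
  have sub: "elts (name_act \<pi> x) \<subseteq> elts x" if \<pi>: "\<pi> \<in>\<^sub>V M" for \<pi>
  proof
    fix z assume "z \<in> elts (name_act \<pi> x)"
    then have "z \<in>\<^sub>V name_act \<pi> x" by simp
    then obtain p y where py: "mixed p y" "z = \<langle>ap \<pi> p, name_act \<pi> y\<rangle>"
      unfolding mem_name_act[OF nx] x_opair by blast
    then obtain i where i: "p \<in>\<^sub>V P" "i \<in>\<^sub>V b" "V i p" "appears y (w i)" "forces_mem p y (w i)"
      unfolding mixed_def by blast
    note nw = HS_name[OF wHS[OF i(2)]]
    have "appears (name_act \<pi> y) (name_act \<pi> (w i))"
      using i(4) unfolding appears_def opair_mem_name_act[OF nw] by blast
    moreover have "forces_mem (ap \<pi> p) (name_act \<pi> y) (name_act \<pi> (w i))"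
      by (rule forces_mem_act[OF MGr[OF \<pi>] i(1) HS_name[OF yHS[OF py(1)]] nw i(5)])
    ultimately have "mixed (ap \<pi> p) (name_act \<pi> y)"
      unfolding mixed_def fixed[OF \<pi> i(2)] using i(2) V_act[OF \<pi> i(2,1,3)] aut_cond[OF MGr[OF \<pi>] i(1)] by blast
    then show "z \<in> elts x" unfolding elts_iff py(2) x_opair .
  qed
  have "name_act \<pi> x = x" if \<pi>: "\<pi> \<in>\<^sub>V M" for \<pi>
  proof -
    obtain \<tau> where \<tau>: "\<tau> \<in>\<^sub>V M" "\<And>p. p \<in>\<^sub>V P \<Longrightarrow> ap \<pi> (ap \<tau> p) = p"
      using subgroup_inv[OF Fl_subgrp[OF M(1)] \<pi>] by blast
    have "name_act \<pi> (name_act \<tau> x) = x" by (rule name_act_inverse[OF nx MGr[OF \<tau>(1)] \<tau>(2)])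
    moreover have "elts (name_act \<pi> (name_act \<tau> x)) \<subseteq> elts (name_act \<pi> x)"
      by (rule name_act_mono[OF name_name_act[OF MGr[OF \<tau>(1)] nx] nx sub[OF \<tau>(1)]])
    ultimately show ?thesis using sub[OF \<pi>] by (intro elts_inject subset_antisym) (simp_all only:)
  qed
  then have "supports M x" using M(1) unfolding supports_def by blast
  then have xHS: "x \<in> HS" by (intro HS_I[of x M]) (use x yHS in \<open>unfold mixed_def, blast\<close>)
  have xc: "x \<in>\<^sub>V candidates T" unfolding mem_candidates
    using xHS x w unfolding mixed_def by blast
  have V_eq: "forces_eq p (w i) x" if p: "p \<in>\<^sub>V P" and i: "i \<in>\<^sub>V b" and Vp: "V i p" for p i
  proof (rule forces_eqI[OF p HS_name[OF wHS[OF i]] nx])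
    fix r y q assume y: "\<langle>r, y\<rangle> \<in>\<^sub>V w i" and q: "q \<in>\<^sub>V P" "q \<preceq> p" "q \<preceq> r"
    have "forces_mem q y (w i)" by (rule forces_mem_opair[OF HS_name[OF wHS[OF i]] y q(1,3)])
    moreover have "V i q" by (rule V_mono[OF Vp q(2) p q(1) i])
    ultimately have "\<langle>q, y\<rangle> \<in>\<^sub>V x" unfolding x_opair mixed_def appears_def using q(1) i y by blast
    then show "forces_mem q y x" by (rule forces_mem_opair[OF nx _ q(1) leq_refl[OF q(1)]])
  next
    fix r y q assume y: "\<langle>r, y\<rangle> \<in>\<^sub>V x" and q: "q \<in>\<^sub>V P" "q \<preceq> p" "q \<preceq> r"
    obtain j where j: "r \<in>\<^sub>V P" "j \<in>\<^sub>V b" "V j r" "forces_mem r y (w j)"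
      using y unfolding x_opair mixed_def by blast
    have "i = j" by (rule V_disjoint[OF V_mono[OF Vp q(2) p q(1) i] V_mono[OF j(3) q(3) j(1) q(1) j(2)] i j(2) q(1)])
    then show "forces_mem q y (w i)" using forces_mem_mono[OF j(4) q(3) j(1) q(1)] by simp
  qed
  have "\<Psi> p x" if p: "p \<in>\<^sub>V P" and ex: "\<And>q. q \<in>\<^sub>V P \<Longrightarrow> q \<preceq> p \<Longrightarrow> \<exists>s w. s \<in>\<^sub>V P \<and> s \<preceq> q \<and> appears w T \<and> \<Psi> s w" for p
  proof (rule dense[OF p xHS])
    fix q assume q: "q \<in>\<^sub>V P" "q \<preceq> p"
    obtain s u where s: "s \<in>\<^sub>V P" "s \<preceq> q" "appears u T" "\<Psi> s u" using ex[OF q] by blast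
    then have "D s" unfolding D_def by blast
    then obtain i where i: "i \<in>\<^sub>V b" "compatible s (f i)" using max[OF s(1)] by blast
    then obtain r where r: "r \<in>\<^sub>V P" "r \<preceq> s" "r \<preceq> f i" unfolding compatible_def bex_elts by blast
    have "\<Psi> r (w i)" by (rule mono[OF _ r(3) _ r(1) wHS[OF i(1)]]) (use w f i(1) in blast)+
    then have ex_r: "\<exists>r. r \<in>\<^sub>V P \<and> r \<preceq> s \<and> \<Psi> r (w i)" using r by blast
    define Q where "Q i \<longleftrightarrow> (\<exists>r. r \<in>\<^sub>V P \<and> r \<preceq> s \<and> \<Psi> r (w i))" for i
    have Q_dfn: "definable1 Q" unfolding Q_def by (intro dfn definable2_app[OF \<Psi>] definable_fun1_app[OF w_dfn])
    obtain m where m: "m \<in>\<^sub>V b" "Q m" "\<And>j. j \<in>\<^sub>V b \<Longrightarrow> j \<in>\<^sub>V m \<Longrightarrow> \<not> Q j"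
      by (rule wf_set_minimal[OF wf_set_mem Q_dfn i(1) ex_r[folded Q_def]]) blast
    obtain r' where r': "r' \<in>\<^sub>V P" "r' \<preceq> s" "\<Psi> r' (w m)" using m(2) unfolding Q_def by blast
    have "V m r'" unfolding V_def ball_elts
    proof (intro conjI allI impI notI)
      fix j v assume j: "j \<in>\<^sub>V m" and v: "v \<in>\<^sub>V P" "v \<preceq> r'" "\<Psi> v (w j)"
      have "v \<preceq> s" using leq_trans v r' s by blast
      then have "Q j" unfolding Q_def using v by blast
      then show False using m(3)[OF ordinal_trans[OF ordinal_mem[OF lam_ordinal b] m(1) j] j] by blast
    qed (rule r'(3))
    then have "\<Psi> r' x" by (intro cong[OF r'(3,1) wHS[OF m(1)] xHS] V_eq[OF r'(1) m(1)])
    moreover have "r' \<preceq> q" using leq_trans r' s q by blast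
    ultimately show "\<exists>s. s \<in>\<^sub>V P \<and> s \<preceq> q \<and> \<Psi> s x" using r'(1) by blast
  qed
  then have "\<forall>p. p \<in>\<^sub>V P \<longrightarrow>
      (\<forall>q. q \<in>\<^sub>V P \<longrightarrow> q \<preceq> p \<longrightarrow> (\<exists>s w. s \<in>\<^sub>V P \<and> s \<preceq> q \<and> appears w T \<and> \<Psi> s w)) \<longrightarrow> \<Psi> p x"
    by blast
  with xc show ?thesis by (rule that)
qed

end


section \<open>Dependent choice is forced\<close>

context dc_model
begin

text \<open>The name of the sequence \<open>i \<mapsto> x i\<close> for \<open>i\<close> in \<open>b\<close>.\<close>

definition seq_name :: "'v \<Rightarrow> ('v \<Rightarrow> 'v) \<Rightarrow> 'v" where
  "seq_name b x = full_name (vset {z. \<exists>i\<in>elts b. z = opair_name (check_name i) (x i)})"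

lemma lam_transitive: "transitive lam"
  using lam_ordinal unfolding ordinal_def by blast

lemma check_lam_HS: "i \<in>\<^sub>V lam \<Longrightarrow> check_name i \<in> HS" and check_lam_supports: "i \<in>\<^sub>V lam \<Longrightarrow> supports Gr (check_name i)"
  using check_name_HS[OF lam_transitive] by blast+

lemma mem_seq_set:
  assumes x: "definable_fun1 x"
  shows "z \<in>\<^sub>V vset {z. \<exists>i\<in>elts b. z = opair_name (check_name i) (x i)} \<longleftrightarrow>
    (\<exists>i. i \<in>\<^sub>V b \<and> z = opair_name (check_name i) (x i))"
proof -
  have "isset ((\<lambda>i. opair_name (check_name i) (x i)) ` elts b)"
    by (intro replacement dfn definable_fun1_app[OF x])
  moreover have "(\<lambda>i. opair_name (check_name i) (x i)) ` elts b = {z. \<exists>i\<in>elts b. z = opair_name (check_name i) (x i)}"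
    by auto
  ultimately have "isset {z. \<exists>i\<in>elts b. z = opair_name (check_name i) (x i)}" by (simp only:)
  from mem_vset[OF this] show ?thesis by simp
qed

lemma seq_name_HS:
  assumes b: "b \<in>\<^sub>V lam" and x: "definable_fun1 x" and HS: "\<And>i. i \<in>\<^sub>V b \<Longrightarrow> x i \<in> HS"
  shows "seq_name b x \<in> HS"
proof -
  obtain L where L: "L \<in>\<^sub>V Fl" "\<And>i. i \<in>\<^sub>V b \<Longrightarrow> supports L (x i)" using family_support[OF b x HS] by blast
  show ?thesis unfolding seq_name_def
  proof (rule full_name_HS[OF L(1)])
    fix z assume "z \<in>\<^sub>V vset {z. \<exists>i\<in>elts b. z = opair_name (check_name i) (x i)}"
    then obtain i where i: "i \<in>\<^sub>V b" "z = opair_name (check_name i) (x i)" unfolding mem_seq_set[OF x] by blast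
    have c: "check_name i \<in> HS" by (rule check_lam_HS[OF lam_trans[OF b i(1)]])
    have "supports L (check_name i)"
      by (rule supports_mono[OF check_lam_supports[OF lam_trans[OF b i(1)]] L(1)]) (rule Fl_Gr[OF L(1)])
    then have "supports L z" unfolding i(2)
      by (rule supports_opair_name[OF _ L(2)[OF i(1)] HS_name[OF c] HS_name[OF HS[OF i(1)]]])
    moreover have "z \<in> HS" unfolding i(2) by (rule opair_name_HS[OF c HS[OF i(1)]])
    ultimately show "z \<in> HS \<and> supports L z" by blast
  qed
qed

lemma forces_mem_seq_name:
  assumes x: "definable_fun1 x"
  shows "forces_mem p z (seq_name b x) \<longleftrightarrow> (\<forall>q. q \<in>\<^sub>V P \<longrightarrow> q \<preceq> p \<longrightarrow>
    (\<exists>s i. s \<in>\<^sub>V P \<and> s \<preceq> q \<and> i \<in>\<^sub>V b \<and> forces_eq s z (opair_name (check_name i) (x i))))"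
  unfolding seq_name_def forces_mem_full_name mem_seq_set[OF x] by blast

lemma forces_mem_seq_nameD:
  assumes x: "definable_fun1 x" and b: "b \<in>\<^sub>V lam" and HS: "\<And>i. i \<in>\<^sub>V b \<Longrightarrow> x i \<in> HS" and uv: "u \<in> HS" "v \<in> HS"
    and m: "forces_mem p (opair_name u v) (seq_name b x)" and q: "q \<in>\<^sub>V P" "q \<preceq> p"
  obtains s i where "s \<in>\<^sub>V P" "s \<preceq> q" "i \<in>\<^sub>V b" "forces_eq s u (check_name i)" "forces_eq s v (x i)"
proof -
  obtain s i where s: "s \<in>\<^sub>V P" "s \<preceq> q" "i \<in>\<^sub>V b" "forces_eq s (opair_name u v) (opair_name (check_name i) (x i))"
    using m q unfolding forces_mem_seq_name[OF x] by blast
  have "forces_eq s u (check_name i) \<and> forces_eq s v (x i)"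
    by (rule forces_opair_inject[OF s(1) _ _ _ _ s(4)])
      (use uv HS[OF s(3)] check_lam_HS[OF lam_trans[OF b s(3)]] HS_name in blast)+
  with s show ?thesis using that by blast
qed

lemma forces_mem_seq_nameI:
  assumes x: "definable_fun1 x" and b: "b \<in>\<^sub>V lam" and HS: "\<And>i. i \<in>\<^sub>V b \<Longrightarrow> x i \<in> HS" and u: "u \<in> HS"
    and p: "p \<in>\<^sub>V P" and i: "i \<in>\<^sub>V b" and eq: "forces_eq p u (check_name i)"
  shows "forces_mem p (opair_name u (x i)) (seq_name b x)"
  unfolding forces_mem_seq_name[OF x]
proof (intro allI impI)
  fix q assume q: "q \<in>\<^sub>V P" "q \<preceq> p"
  note n = HS_name[OF u] HS_name[OF HS[OF i]] HS_name[OF check_lam_HS[OF lam_trans[OF b i]]]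
  have "forces_eq q u (check_name i)" by (rule forces_eq_mono[OF eq q(2) p q(1) n(1,3)])
  then have "forces_eq q (opair_name u (x i)) (opair_name (check_name i) (x i))"
    by (intro forces_opair_cong q(1) n forces_eq_refl)
  then show "\<exists>s j. s \<in>\<^sub>V P \<and> s \<preceq> q \<and> j \<in>\<^sub>V b \<and> forces_eq s (opair_name u (x i)) (opair_name (check_name j) (x j))"
    using q(1) i leq_refl by blast
qed

text \<open>The name of a sequence is forced to be a function on the canonical name of \<open>b\<close>: any two
  entries at a place that is forced to be both \<open>i\<close> and \<open>j\<close> agree, because \<open>i = j\<close> by
  \<open>check_name_inject\<close>.\<close>

lemma forces_Fun_fm_seq:
  assumes p: "p \<in>\<^sub>V P" and e: "HS_env e" and b: "b \<in>\<^sub>V lam" and x: "definable_fun1 x"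
    and HS: "\<And>i. i \<in>\<^sub>V b \<Longrightarrow> x i \<in> HS" and f: "e f = seq_name b x" and a: "e a = check_name b"
    and T: "\<And>i. i \<in>\<^sub>V b \<Longrightarrow> forces_mem p (x i) (e T)"
  shows "forces_HS p e (Fun_fm f a T)"
  unfolding Fun_fm_def forces_HS.simps(4)
proof
  note chk = check_lam_HS[OF lam_trans[OF b]]
  show "forces_HS p e (BAll f (BEx (a + 1) (BEx (T + 2) (Pair_fm 1 0 2))))"
    unfolding forces_BAll[OF p e]
  proof (intro allI impI)
    fix z q assume z: "z \<in> HS" and q: "q \<in>\<^sub>V P" "q \<preceq> p" and m: "forces_mem q z (e f)"
    note ez = HS_env_case[OF z e]
    show "forces_HS q (case_nat z e) (BEx (a + 1) (BEx (T + 2) (Pair_fm 1 0 2)))"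
    proof (rule forces_HS_dense[OF q(1) ez])
      fix q' assume q': "q' \<in>\<^sub>V P" "q' \<preceq> q"
      obtain s i where s: "s \<in>\<^sub>V P" "s \<preceq> q'" "i \<in>\<^sub>V b" "forces_eq s z (opair_name (check_name i) (x i))"
        using m q' unfolding f forces_mem_seq_name[OF x] by blast
      have sp: "s \<preceq> p" using leq_trans s q' q p by blast
      have xi: "forces_mem s (x i) (e T)" by (rule forces_mem_mono[OF T[OF s(3)] sp p s(1)])
      have ci: "forces_mem s (check_name i) (e a)" unfolding a by (rule check_name_mem[OF lam_transitive b s(3,1)])
      have "forces_HS s (case_nat z e) (BEx (a + 1) (BEx (T + 2) (Pair_fm 1 0 2)))"
      proof (rule forces_ExI[OF s(1) ez chk[OF s(3)]], unfold forces_HS.simps(4), rule conjI)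
        let ?e = "case_nat (check_name i) (case_nat z e)"
        have e1: "HS_env ?e" by (rule HS_env_case[OF chk[OF s(3)] ez])
        show "forces_HS s ?e (Mem 0 (a + 1 + 1))" using ci by simp
        show "forces_HS s ?e (BEx (T + 2) (Pair_fm 1 0 2))"
        proof (rule forces_ExI[OF s(1) e1 HS[OF s(3)]], unfold forces_HS.simps(4), rule conjI)
          show "forces_HS s (case_nat (x i) ?e) (Mem 0 (T + 2 + 1))" using xi by simp
          show "forces_HS s (case_nat (x i) ?e) (Pair_fm 1 0 2)"
            unfolding forces_Pair_fm[OF s(1) HS_env_case[OF HS[OF s(3)] e1]] using s(4)
            by (simp add: numeral_2_eq_2)
        qed
      qed
      with s show "\<exists>s. s \<in>\<^sub>V P \<and> s \<preceq> q' \<and> forces_HS s (case_nat z e) (BEx (a + 1) (BEx (T + 2) (Pair_fm 1 0 2)))"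
        by blast
    qed
  qed
  let ?unique = "All (Rel_fm 2 0 (f + 3) \<^bold>\<longrightarrow> Eq 0 1)"
  show "forces_HS p e (BAll a (Ex (Rel_fm 1 0 (f + 2) \<^bold>\<and> ?unique)))"
    unfolding forces_BAll[OF p e]
  proof (intro allI impI)
    fix y q assume y: "y \<in> HS" and q: "q \<in>\<^sub>V P" "q \<preceq> p" and m: "forces_mem q y (e a)"
    note ey = HS_env_case[OF y e]
    show "forces_HS q (case_nat y e) (Ex (Rel_fm 1 0 (f + 2) \<^bold>\<and> ?unique))"
    proof (rule forces_HS_dense[OF q(1) ey])
      fix q' assume q': "q' \<in>\<^sub>V P" "q' \<preceq> q"
      obtain s i where s: "s \<in>\<^sub>V P" "s \<preceq> q'" "i \<in>\<^sub>V b" "forces_eq s y (check_name i)"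
        using m q' unfolding a forces_mem_check_name[OF lam_transitive b HS_name[OF y] q(1)] by blast
      let ?e = "case_nat (x i) (case_nat y e)"
      have e1: "HS_env ?e" by (rule HS_env_case[OF HS[OF s(3)] ey])
      have "forces_HS s (case_nat y e) (Ex (Rel_fm 1 0 (f + 2) \<^bold>\<and> ?unique))"
      proof (rule forces_ExI[OF s(1) ey HS[OF s(3)]], unfold forces_HS.simps(4), rule conjI)
        show "forces_HS s ?e (Rel_fm 1 0 (f + 2))" unfolding forces_Rel_fm[OF s(1) e1]
          using forces_mem_seq_nameI[OF x b HS y s(1,3,4)] by (simp add: f)
        show "forces_HS s ?e ?unique" unfolding forces_HS.simps(5)
        proof
          fix v assume v: "v \<in> HS"
          have e2: "HS_env (case_nat v ?e)" by (rule HS_env_case[OF v e1])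
          show "forces_HS s (case_nat v ?e) (Rel_fm 2 0 (f + 3) \<^bold>\<longrightarrow> Eq 0 1)"
            unfolding forces_Imp[OF s(1) e2]
          proof (intro allI impI)
            fix t assume t: "t \<in>\<^sub>V P" "t \<preceq> s" and r: "forces_HS t (case_nat v ?e) (Rel_fm 2 0 (f + 3))"
            have r': "forces_mem t (opair_name y v) (seq_name b x)"
              using r unfolding forces_Rel_fm[OF t(1) e2] by (simp add: f numeral_2_eq_2 numeral_3_eq_3)
            have "forces_eq t v (x i)"
            proof (rule forces_eq_dense[OF t(1) HS_name[OF v] HS_name[OF HS[OF s(3)]]])
              fix t' assume t': "t' \<in>\<^sub>V P" "t' \<preceq> t"
              obtain w j where w: "w \<in>\<^sub>V P" "w \<preceq> t'" "j \<in>\<^sub>V b" "forces_eq w y (check_name j)" "forces_eq w v (x j)"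
                by (rule forces_mem_seq_nameD[OF x b HS y v r' t'])
              have ws: "w \<preceq> s" using leq_trans w t' t s by blast
              note n = HS_name[OF y] HS_name[OF chk[OF s(3)]] HS_name[OF chk[OF w(3)]]
              have "forces_eq w y (check_name i)" by (rule forces_eq_mono[OF s(4) ws s(1) w(1) n(1,2)])
              then have "forces_eq w (check_name i) (check_name j)"
                by (rule forces_eq_trans[OF forces_eq_sym[OF _ w(1) n(1,2)] w(4,1) n(2,1,3)])
              then have "i = j"
                by (rule check_name_inject[OF lam_ordinal lam_trans[OF b s(3)] lam_trans[OF b w(3)] w(1)])
              then show "\<exists>w. w \<in>\<^sub>V P \<and> w \<preceq> t' \<and> forces_eq w v (x i)" using w by blast
            qed
            then show "forces_HS t (case_nat v ?e) (Eq 0 1)" by simp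
          qed
        qed
      qed
      with s show "\<exists>s. s \<in>\<^sub>V P \<and> s \<preceq> q' \<and> forces_HS s (case_nat y e) (Ex (Rel_fm 1 0 (f + 2) \<^bold>\<and> ?unique))"
        by blast
    qed
  qed
qed

lemma forces_Chain_fm_seq:
  assumes p: "p \<in>\<^sub>V P" and e: "HS_env e" and b: "b \<in>\<^sub>V lam" and x: "definable_fun1 x"
    and HS: "\<And>i. i \<in>\<^sub>V b \<Longrightarrow> x i \<in> HS" and f: "e f = seq_name b x" and a: "e a = check_name b"
    and T: "\<And>i. i \<in>\<^sub>V b \<Longrightarrow> forces_mem p (x i) (e T)"
    and inc: "\<And>i j. i \<in>\<^sub>V b \<Longrightarrow> j \<in>\<^sub>V i \<Longrightarrow> forces_mem p (opair_name (x j) (x i)) (e r)"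
  shows "forces_HS p e (Chain_fm f a T r)"
  unfolding Chain_fm_def forces_HS.simps(4)[of _ _ "Fun_fm f a T"]
proof
  show "forces_HS p e (Fun_fm f a T)" by (rule forces_Fun_fm_seq[OF p e b x HS f a T])
  note chk = check_lam_HS[OF lam_trans[OF b]]
  show "forces_HS p e (BAll a (BAll 0 (All (All
        (Rel_fm 2 1 (f + 4) \<^bold>\<and> Rel_fm 3 0 (f + 4) \<^bold>\<longrightarrow> Rel_fm 1 0 (r + 4))))))"
    unfolding forces_BAll[OF p e]
  proof (intro allI impI)
    fix u q assume u: "u \<in> HS" and q: "q \<in>\<^sub>V P" "q \<preceq> p"
    note eu = HS_env_case[OF u e]
    show "forces_HS q (case_nat u e) (BAll 0 (All (All
        (Rel_fm 2 1 (f + 4) \<^bold>\<and> Rel_fm 3 0 (f + 4) \<^bold>\<longrightarrow> Rel_fm 1 0 (r + 4)))))"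
      unfolding forces_BAll[OF q(1) eu] unfolding forces_HS.simps(5)
    proof (intro allI impI ballI)
      fix v q' c d assume v: "v \<in> HS" and q': "q' \<in>\<^sub>V P" "q' \<preceq> q" and m: "forces_mem q' v (case_nat u e 0)"
        and c: "c \<in> HS" and d: "d \<in> HS"
      let ?e = "case_nat d (case_nat c (case_nat v (case_nat u e)))"
      have e1: "HS_env ?e" by (intro HS_env_case u v c d e)
      show "forces_HS q' ?e (Rel_fm 2 1 (f + 4) \<^bold>\<and> Rel_fm 3 0 (f + 4) \<^bold>\<longrightarrow> Rel_fm 1 0 (r + 4))"
        unfolding forces_Imp[OF q'(1) e1]
      proof (intro allI impI)
        fix s assume s: "s \<in>\<^sub>V P" "s \<preceq> q'" and r: "forces_HS s ?e (Rel_fm 2 1 (f + 4) \<^bold>\<and> Rel_fm 3 0 (f + 4))"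
        have r1: "forces_mem s (opair_name v c) (seq_name b x)" and r2: "forces_mem s (opair_name u d) (seq_name b x)"
          using r unfolding forces_HS.simps(4) forces_Rel_fm[OF s(1) e1]
          by (simp_all add: f numeral_2_eq_2 numeral_3_eq_3 eval_nat_numeral)
        have "forces_mem s (opair_name c d) (e r)"
        proof (rule forces_mem_dense[OF s(1)])
          fix t assume t: "t \<in>\<^sub>V P" "t \<preceq> s"
          obtain t1 j where t1: "t1 \<in>\<^sub>V P" "t1 \<preceq> t" "j \<in>\<^sub>V b" "forces_eq t1 v (check_name j)" "forces_eq t1 c (x j)"
            by (rule forces_mem_seq_nameD[OF x b HS v c r1 t])
          have t1s: "t1 \<preceq> s" using leq_trans t1 t s by blast
          obtain t2 i where t2: "t2 \<in>\<^sub>V P" "t2 \<preceq> t1" "i \<in>\<^sub>V b" "forces_eq t2 u (check_name i)" "forces_eq t2 d (x i)"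
            by (rule forces_mem_seq_nameD[OF x b HS u d r2 t1(1) t1s])
          note n = HS_name[OF u] HS_name[OF v] HS_name[OF chk[OF t2(3)]] HS_name[OF chk[OF t1(3)]]
            HS_name[OF c] HS_name[OF d] HS_name[OF HS[OF t1(3)]] HS_name[OF HS[OF t2(3)]]
          have eqv: "forces_eq t2 v (check_name j)" by (rule forces_eq_mono[OF t1(4) t2(2) t1(1) t2(1) n(2,4)])
          have eqc: "forces_eq t2 c (x j)" by (rule forces_eq_mono[OF t1(5) t2(2) t1(1) t2(1) n(5,7)])
          have t2q: "t2 \<preceq> q'" using leq_trans t2 t1 t s q' by blast
          have "forces_mem t2 v u" using forces_mem_mono[OF m t2q q'(1) t2(1)] by simp
          then have "forces_mem t2 (check_name j) u" by (rule forces_mem_eq_left[OF _ eqv t2(1) n(2,4,1)])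
          then have "forces_mem t2 (check_name j) (check_name i)"
            by (rule forces_mem_eq_right[OF _ t2(4,1) n(4,1,3)])
          then obtain t3 k where t3: "t3 \<in>\<^sub>V P" "t3 \<preceq> t2" "k \<in>\<^sub>V i" "forces_eq t3 (check_name j) (check_name k)"
            unfolding forces_mem_check_name[OF lam_transitive lam_trans[OF b t2(3)] n(4) t2(1)]
            using t2(1) leq_refl by blast
          have "j = k"
            by (rule check_name_inject[OF lam_ordinal lam_trans[OF b t1(3)] lam_trans[OF lam_trans[OF b t2(3)] t3(3)] t3(1,4)])
          then have ji: "j \<in>\<^sub>V i" using t3(3) by simp
          have t2p: "t2 \<preceq> p" using leq_trans t2q q' q t2 p by blast
          have "forces_mem t2 (opair_name (x j) (x i)) (e r)"
            by (rule forces_mem_mono[OF inc[OF t2(3) ji] t2p p t2(1)])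
          moreover have "forces_eq t2 (opair_name (x j) (x i)) (opair_name c d)"
            by (intro forces_opair_cong t2(1) n forces_eq_sym[OF eqc t2(1) n(5,7)] forces_eq_sym[OF t2(5,1) n(6,8)])
          ultimately have "forces_mem t2 (opair_name c d) (e r)"
            by (rule forces_mem_eq_left[OF _ _ t2(1) name_opair_name[OF n(7,8)] name_opair_name[OF n(5,6)] HS_env_name[OF e]])
          moreover have "t2 \<preceq> t" using leq_trans t2 t1 t by blast
          ultimately show "\<exists>s. s \<in>\<^sub>V P \<and> s \<preceq> t \<and> forces_mem s (opair_name c d) (e r)" using t2(1) by blast
        qed
        then show "forces_HS s ?e (Rel_fm 1 0 (r + 4))" unfolding forces_Rel_fm[OF s(1) e1]
          by (simp add: eval_nat_numeral)
      qed
    qed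
  qed
qed

text \<open>The semantic content of transitivity of the tree order, of closedness, and (in
  \<open>not_forces_maximal\<close>) of the absence of maximal elements below \<open>p\<close>.\<close>

lemma forces_Tree_fm_trans:
  assumes f: "forces_HS p e (Tree_fm T r)" and p: "p \<in>\<^sub>V P" and e: "HS_env e" and n: "x \<in> HS" "y \<in> HS" "z \<in> HS"
    and q: "q \<in>\<^sub>V P" "q \<preceq> p" and T: "forces_mem q x (e T)" "forces_mem q y (e T)" "forces_mem q z (e T)"
    and r: "forces_mem q (opair_name x y) (e r)" "forces_mem q (opair_name y z) (e r)"
  shows "forces_mem q (opair_name x z) (e r)"
proof -
  let ?\<phi> = "Rel_fm 2 1 (r + 3) \<^bold>\<and> Rel_fm 1 0 (r + 3) \<^bold>\<longrightarrow> Rel_fm 2 0 (r + 3)"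
  have "forces_HS p e (BAll T (BAll (T + 1) (BAll (T + 2) ?\<phi>)))"
    using f unfolding Tree_fm_def forces_HS.simps(4)[of _ _ "BAll T _"] by blast
  then have "forces_HS q (case_nat x e) (BAll (T + 1) (BAll (T + 2) ?\<phi>))"
    unfolding forces_BAll[OF p e] using n(1) q T(1) by blast
  then have "forces_HS q (case_nat y (case_nat x e)) (BAll (T + 2) ?\<phi>)"
    unfolding forces_BAll[OF q(1) HS_env_case[OF n(1) e]] using n(2) q(1) leq_refl[OF q(1)] T(2) by simp
  moreover have e2: "HS_env (case_nat y (case_nat x e))" by (intro HS_env_case n e)
  ultimately have "forces_HS q (case_nat z (case_nat y (case_nat x e))) ?\<phi>"
    unfolding forces_BAll[OF q(1) e2] using n(3) q(1) leq_refl[OF q(1)] T(3) by simp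
  moreover have e3: "HS_env (case_nat z (case_nat y (case_nat x e)))" by (intro HS_env_case n e)
  ultimately show ?thesis
    unfolding forces_Imp[OF q(1) e3] forces_HS.simps(4) using forces_Rel_fm[OF q(1) e3] q(1) leq_refl[OF q(1)] r
    by (auto simp: eval_nat_numeral)
qed

lemma forces_Closed_fmD:
  assumes f: "forces_HS p e (Closed_fm k T r)" and p: "p \<in>\<^sub>V P" and e: "HS_env e" and n: "a \<in> HS" "c \<in> HS"
    and q: "q \<in>\<^sub>V P" "q \<preceq> p" and a: "forces_mem q a (e k)"
    and c: "forces_HS q (case_nat c (case_nat a e)) (Chain_fm 0 1 (T + 2) (r + 2))"
  obtains s u where "s \<in>\<^sub>V P" "s \<preceq> q" "u \<in> HS" "forces_mem s u (e T)"
    "\<And>x y t. x \<in> HS \<Longrightarrow> y \<in> HS \<Longrightarrow> t \<in>\<^sub>V P \<Longrightarrow> t \<preceq> s \<Longrightarrow> forces_mem t (opair_name x y) c \<Longrightarrow>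
       \<exists>v. v \<in>\<^sub>V P \<and> v \<preceq> t \<and> (forces_eq v y u \<or> forces_mem v (opair_name y u) (e r))"
proof -
  let ?\<psi> = "Rel_fm 1 0 3 \<^bold>\<longrightarrow> Eq 0 2 \<^bold>\<or> Rel_fm 0 2 (r + 5)"
  have "forces_HS q (case_nat a e) (All (Chain_fm 0 1 (T + 2) (r + 2) \<^bold>\<longrightarrow> BEx (T + 2) (All (All ?\<psi>))))"
    using f unfolding Closed_fm_def forces_BAll[OF p e] using n(1) q a by blast
  then have "forces_HS q (case_nat c (case_nat a e)) (Chain_fm 0 1 (T + 2) (r + 2) \<^bold>\<longrightarrow> BEx (T + 2) (All (All ?\<psi>)))"
    unfolding forces_HS.simps(5) using n(2) by blast
  moreover have e2: "HS_env (case_nat c (case_nat a e))" by (intro HS_env_case n e)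
  ultimately have "forces_HS q (case_nat c (case_nat a e)) (BEx (T + 2) (All (All ?\<psi>)))"
    unfolding forces_Imp[OF q(1) e2] using c q(1) leq_refl[OF q(1)] by blast
  then obtain s u where s: "s \<in>\<^sub>V P" "s \<preceq> q" "u \<in> HS" "forces_mem s u (case_nat c (case_nat a e) (T + 2))"
    and \<psi>: "forces_HS s (case_nat u (case_nat c (case_nat a e))) (All (All ?\<psi>))"
    unfolding forces_BEx using q(1) leq_refl[OF q(1)] by blast
  have uT: "forces_mem s u (e T)" using s(4) by simp
  show ?thesis
  proof (rule that[OF s(1-3) uT])
    fix x y t assume xy: "x \<in> HS" "y \<in> HS" and t: "t \<in>\<^sub>V P" "t \<preceq> s" and m: "forces_mem t (opair_name x y) c"
    let ?e = "case_nat y (case_nat x (case_nat u (case_nat c (case_nat a e))))"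
    have e5: "HS_env ?e" by (intro HS_env_case n xy s(3) e)
    have "forces_HS s ?e ?\<psi>" using \<psi> xy unfolding forces_HS.simps(5) by blast
    moreover have "forces_HS t ?e (Rel_fm 1 0 3)" unfolding forces_Rel_fm[OF t(1) e5] using m by (simp add: eval_nat_numeral)
    ultimately have "forces_HS t ?e (Eq 0 2 \<^bold>\<or> Rel_fm 0 2 (r + 5))"
      unfolding forces_Imp[OF s(1) e5] using t by blast
    then obtain v where v: "v \<in>\<^sub>V P" "v \<preceq> t" "forces_HS v ?e (Eq 0 2) \<or> forces_HS v ?e (Rel_fm 0 2 (r + 5))"
      unfolding forces_Disj using t(1) leq_refl[OF t(1)] by blast
    from v(3) have "forces_eq v y u \<or> forces_mem v (opair_name y u) (e r)"
      unfolding forces_Rel_fm[OF v(1) e5] by (simp add: eval_nat_numeral)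
    with v show "\<exists>v. v \<in>\<^sub>V P \<and> v \<preceq> t \<and> (forces_eq v y u \<or> forces_mem v (opair_name y u) (e r))" by blast
  qed
qed

lemma not_forces_maximal:
  assumes no: "\<And>s. s \<in>\<^sub>V P \<Longrightarrow> s \<preceq> p \<Longrightarrow> \<not> forces_HS s e (BEx T (BAll (T + 1) (Neg (Rel_fm 1 0 (r + 2)))))"
    and p: "p \<in>\<^sub>V P" and e: "HS_env e" and u: "u \<in> HS" and q: "q \<in>\<^sub>V P" "q \<preceq> p" and m: "forces_mem q u (e T)"
  obtains s v where "s \<in>\<^sub>V P" "s \<preceq> q" "v \<in> HS" "forces_mem s v (e T)" "forces_mem s (opair_name u v) (e r)"
proof -
  let ?\<phi> = "BAll (T + 1) (Neg (Rel_fm 1 0 (r + 2)))"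
  have e1: "HS_env (case_nat u e)" by (rule HS_env_case[OF u e])
  have "\<not> forces_HS q (case_nat u e) ?\<phi>"
  proof
    assume f: "forces_HS q (case_nat u e) ?\<phi>"
    have "forces_HS q e (BEx T ?\<phi>)"
      by (rule forces_ExI[OF q(1) e u], unfold forces_HS.simps(4), rule conjI) (use m f in simp_all)
    then show False using no[OF q] by blast
  qed
  then obtain v s where v: "v \<in> HS" "s \<in>\<^sub>V P" "s \<preceq> q" "forces_mem s v (case_nat u e (T + 1))"
    "\<not> forces_HS s (case_nat v (case_nat u e)) (Neg (Rel_fm 1 0 (r + 2)))"
    unfolding forces_BAll[OF q(1) e1] by blast
  have e2: "HS_env (case_nat v (case_nat u e))" by (rule HS_env_case[OF v(1) e1])
  obtain t where t: "t \<in>\<^sub>V P" "t \<preceq> s" "forces_HS t (case_nat v (case_nat u e)) (Rel_fm 1 0 (r + 2))"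
    using v(5) unfolding forces_HS.simps(3) ball_elts by blast
  have "forces_mem t (opair_name u v) (e r)" using t(3) unfolding forces_Rel_fm[OF t(1) e2] by simp
  moreover have "forces_mem t v (e T)" using forces_mem_mono[OF v(4) t(2) v(2) t(1)] by simp
  moreover have "t \<preceq> q" using leq_trans t v q by blast
  ultimately show ?thesis using that t(1) v(1) by blast
qed

text \<open>One step of the construction of a chain. The sequence constructed so far has a hereditarily
  symmetric name, so densely below \<open>p\<close> there are an upper bound \<open>u\<close> of it and an element \<open>v\<close> above \<open>u\<close>;
  \<open>fullness\<close> turns these many \<open>v\<close> into a single name, to which \<open>p\<close> itself forces the sequence to
  extend.\<close>

lemma extend_chain:
  assumes p: "p \<in>\<^sub>V P" and e: "HS_env e" and a: "a \<in>\<^sub>V lam" "e k = check_name a"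
    and tree: "forces_HS p e (Tree_fm T r)" and closed: "forces_HS p e (Closed_fm k T r)"
    and nomax: "\<And>s. s \<in>\<^sub>V P \<Longrightarrow> s \<preceq> p \<Longrightarrow> \<not> forces_HS s e (BEx T (BAll (T + 1) (Neg (Rel_fm 1 0 (r + 2)))))"
    and i: "i \<in>\<^sub>V a" and x: "definable_fun1 x" and HS: "\<And>j. j \<in>\<^sub>V i \<Longrightarrow> x j \<in> HS"
    and xT: "\<And>j. j \<in>\<^sub>V i \<Longrightarrow> forces_mem p (x j) (e T)"
    and inc: "\<And>j l. j \<in>\<^sub>V i \<Longrightarrow> l \<in>\<^sub>V j \<Longrightarrow> forces_mem p (opair_name (x l) (x j)) (e r)"
  obtains y where "y \<in>\<^sub>V candidates (e T)" "forces_mem p y (e T)"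
    "\<And>j. j \<in>\<^sub>V i \<Longrightarrow> forces_mem p (opair_name (x j) y) (e r)"
proof -
  have il: "i \<in>\<^sub>V lam" by (rule lam_trans[OF a(1) i])
  note eT = HS_env_HS[OF e, of T] and er = HS_env_HS[OF e, of r]
  note nT = HS_name[OF eT] and nr = HS_name[OF er]
  define \<Psi> where "\<Psi> q y \<longleftrightarrow> forces_mem q y (e T) \<and> (\<forall>j\<in>elts i. forces_mem q (opair_name (x j) y) (e r))" for q y
  have \<Psi>_dfn: "definable2 \<Psi>" unfolding \<Psi>_def by (intro dfn definable_fun1_app[OF x])
  obtain L1 where L1: "L1 \<in>\<^sub>V Fl" "\<And>j. j \<in>\<^sub>V i \<Longrightarrow> supports L1 (x j)" using family_support[OF il x HS] by blast
  obtain LT where LT: "supports LT (e T)" using HS_supports[OF eT] by blast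
  obtain Lr where Lr: "supports Lr (e r)" using HS_supports[OF er] by blast
  obtain L2 where L2: "supports L2 (e T)" "supports L2 (e r)" "L2 \<in>\<^sub>V Fl" by (rule supports_Int[OF LT Lr])
  obtain L where L: "L \<in>\<^sub>V Fl" "\<And>\<pi>. \<pi> \<in>\<^sub>V L \<Longrightarrow> \<pi> \<in>\<^sub>V L1 \<and> \<pi> \<in>\<^sub>V L2" using Fl_Int_mem[OF L1(1) L2(3)] by blast
  have fixed: "name_act \<pi> (e T) = e T" "name_act \<pi> (e r) = e r" "\<And>j. j \<in>\<^sub>V i \<Longrightarrow> name_act \<pi> (x j) = x j" if "\<pi> \<in>\<^sub>V L" for \<pi>
    using L(2)[OF that] L1(2) L2 unfolding supports_def by blast+
  have nx: "name (x j)" if "j \<in>\<^sub>V i" for j using HS_name[OF HS[OF that]] .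
  have mono: "\<Psi> q y" if "\<Psi> p y" "q \<preceq> p" "p \<in>\<^sub>V P" "q \<in>\<^sub>V P" for p q y
    using that forces_mem_mono unfolding \<Psi>_def ball_elts by blast
  have act: "\<Psi> (ap \<pi> p) (name_act \<pi> y)" if \<pi>: "\<pi> \<in>\<^sub>V L" and p: "p \<in>\<^sub>V P" and y: "y \<in> HS" and \<Psi>: "\<Psi> p y" for \<pi> p y
    unfolding \<Psi>_def ball_elts
  proof (intro conjI allI impI)
    have \<pi>Gr: "\<pi> \<in>\<^sub>V Gr" by (rule Fl_Gr[OF L(1) \<pi>])
    have "forces_mem p y (e T)" using \<Psi> unfolding \<Psi>_def by blast
    then have "forces_mem (ap \<pi> p) (name_act \<pi> y) (name_act \<pi> (e T))"
      by (rule forces_mem_act[OF \<pi>Gr p HS_name[OF y] nT])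
    then show "forces_mem (ap \<pi> p) (name_act \<pi> y) (e T)" unfolding fixed(1)[OF \<pi>] .
    fix j assume j: "j \<in>\<^sub>V i"
    have "forces_mem p (opair_name (x j) y) (e r)" using \<Psi> j unfolding \<Psi>_def ball_elts by blast
    then have "forces_mem (ap \<pi> p) (name_act \<pi> (opair_name (x j) y)) (name_act \<pi> (e r))"
      by (rule forces_mem_act[OF \<pi>Gr p name_opair_name[OF nx[OF j] HS_name[OF y]] nr])
    then show "forces_mem (ap \<pi> p) (opair_name (x j) (name_act \<pi> y)) (e r)"
      unfolding fixed(2)[OF \<pi>] name_act_opair_name[OF \<pi>Gr nx[OF j] HS_name[OF y]] fixed(3)[OF \<pi> j] .
  qed
  have cong: "\<Psi> p z" if \<Psi>: "\<Psi> p y" and p: "p \<in>\<^sub>V P" and y: "y \<in> HS" and z: "z \<in> HS" and eq: "forces_eq p y z" for p y z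
    unfolding \<Psi>_def ball_elts
  proof (intro conjI allI impI)
    show "forces_mem p z (e T)"
      by (rule forces_mem_eq_left[OF _ eq p HS_name[OF y] HS_name[OF z] nT]) (use \<Psi> in \<open>unfold \<Psi>_def, blast\<close>)
    fix j assume j: "j \<in>\<^sub>V i"
    have "forces_eq p (opair_name (x j) y) (opair_name (x j) z)"
      by (intro forces_opair_cong p nx[OF j] HS_name[OF y] HS_name[OF z] eq forces_eq_refl)
    moreover have "forces_mem p (opair_name (x j) y) (e r)" using \<Psi> j unfolding \<Psi>_def ball_elts by blast
    ultimately show "forces_mem p (opair_name (x j) z) (e r)"
      by (rule forces_mem_eq_left[OF _ _ p name_opair_name[OF nx[OF j] HS_name[OF y]] name_opair_name[OF nx[OF j] HS_name[OF z]] nr, rotated])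
  qed
  have dense: "\<Psi> p y" if p: "p \<in>\<^sub>V P" and d: "\<And>q. q \<in>\<^sub>V P \<Longrightarrow> q \<preceq> p \<Longrightarrow> \<exists>s. s \<in>\<^sub>V P \<and> s \<preceq> q \<and> \<Psi> s y" for p y
    unfolding \<Psi>_def ball_elts
  proof (intro conjI allI impI)
    show "forces_mem p y (e T)" by (rule forces_mem_dense[OF p]) (use d in \<open>unfold \<Psi>_def, blast\<close>)
    show "forces_mem p (opair_name (x j) y) (e r)" if "j \<in>\<^sub>V i" for j
      by (rule forces_mem_dense[OF p]) (use d that in \<open>unfold \<Psi>_def ball_elts, blast\<close>)
  qed
  obtain y where y: "y \<in>\<^sub>V candidates (e T)" and full: "\<forall>p. p \<in>\<^sub>V P \<longrightarrow> (\<forall>q. q \<in>\<^sub>V P \<longrightarrow> q \<preceq> p \<longrightarrow>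
      (\<exists>s w. s \<in>\<^sub>V P \<and> s \<preceq> q \<and> appears w (e T) \<and> \<Psi> s w)) \<longrightarrow> \<Psi> p y"
  proof (rule fullness[OF eT L(1) \<Psi>_dfn])
    show "\<Psi> q x" if "\<Psi> p x" "q \<preceq> p" "p \<in>\<^sub>V P" "q \<in>\<^sub>V P" "x \<in> HS" for p q x by (rule mono[OF that(1-4)])
    show "\<Psi> (ap \<pi> p) (name_act \<pi> x)" if "\<pi> \<in>\<^sub>V L" "p \<in>\<^sub>V P" "x \<in> HS" "\<Psi> p x" for \<pi> p x by (rule act[OF that])
    show "\<Psi> p y" if "\<Psi> p x" "p \<in>\<^sub>V P" "x \<in> HS" "y \<in> HS" "forces_eq p x y" for p x y by (rule cong[OF that])
    show "\<Psi> p x" if "p \<in>\<^sub>V P" "x \<in> HS" "\<And>q. q \<in>\<^sub>V P \<Longrightarrow> q \<preceq> p \<Longrightarrow> \<exists>s. s \<in>\<^sub>V P \<and> s \<preceq> q \<and> \<Psi> s x" for p x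
      by (rule dense[OF that(1,3)])
  qed
  let ?c = "seq_name i x" and ?i = "check_name i"
  have cHS: "?c \<in> HS" by (rule seq_name_HS[OF il x HS])
  have iHS: "?i \<in> HS" by (rule check_lam_HS[OF il])
  have e2: "HS_env (case_nat ?c (case_nat ?i e))" by (intro HS_env_case cHS iHS e)
  have chain: "forces_HS p (case_nat ?c (case_nat ?i e)) (Chain_fm 0 1 (T + 2) (r + 2))"
    by (rule forces_Chain_fm_seq[OF p e2 il x HS]) (use xT inc in simp_all)
  have im: "forces_mem p ?i (e k)" unfolding a(2) by (rule check_name_mem[OF lam_transitive a(1) i p])
  have "\<Psi> p y"
  proof (rule full[THEN spec, THEN mp, OF p, THEN mp], intro allI impI)
    fix q assume q: "q \<in>\<^sub>V P" "q \<preceq> p"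
    have chain_q: "forces_HS q (case_nat ?c (case_nat ?i e)) (Chain_fm 0 1 (T + 2) (r + 2))"
      by (rule forces_HS_mono[OF chain q(2) p q(1) e2])
    obtain s u where s: "s \<in>\<^sub>V P" "s \<preceq> q" and u: "u \<in> HS" "forces_mem s u (e T)" and
      ub: "\<And>x y t. x \<in> HS \<Longrightarrow> y \<in> HS \<Longrightarrow> t \<in>\<^sub>V P \<Longrightarrow> t \<preceq> s \<Longrightarrow> forces_mem t (opair_name x y) ?c \<Longrightarrow>
       \<exists>v. v \<in>\<^sub>V P \<and> v \<preceq> t \<and> (forces_eq v y u \<or> forces_mem v (opair_name y u) (e r))"
      using forces_Closed_fmD[OF closed p e iHS cHS q forces_mem_mono[OF im q(2) p q(1)] chain_q] by blast
    have sp: "s \<preceq> p" using leq_trans s q p by blast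
    obtain t v where t: "t \<in>\<^sub>V P" "t \<preceq> s" and v: "v \<in> HS" "forces_mem t v (e T)" "forces_mem t (opair_name u v) (e r)"
      by (rule not_forces_maximal[OF nomax p e u(1) s(1) sp u(2)]) blast+
    have tp: "t \<preceq> p" using leq_trans t s sp p by blast
    have "forces_mem t (opair_name (x j) v) (e r)" if j: "j \<in>\<^sub>V i" for j
    proof (rule forces_mem_dense[OF t(1)])
      fix t' assume t': "t' \<in>\<^sub>V P" "t' \<preceq> t"
      have t's: "t' \<preceq> s" using leq_trans t' t s by blast
      have jHS: "check_name j \<in> HS" by (rule check_lam_HS[OF lam_trans[OF il j]])
      have "forces_mem t' (opair_name (check_name j) (x j)) ?c"
        by (rule forces_mem_seq_nameI[OF x il HS jHS t'(1) j forces_eq_refl[OF HS_name[OF jHS] t'(1)]])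
      then obtain w where w: "w \<in>\<^sub>V P" "w \<preceq> t'" "forces_eq w (x j) u \<or> forces_mem w (opair_name (x j) u) (e r)"
        using ub[OF jHS HS[OF j] t'(1) t's] by blast
      have wt: "w \<preceq> t" and ws: "w \<preceq> s" and wp: "w \<preceq> p" using leq_trans w t' t's t tp s p by blast+
      have uv: "forces_mem w (opair_name u v) (e r)" by (rule forces_mem_mono[OF v(3) wt t(1) w(1)])
      have "forces_mem w (opair_name (x j) v) (e r)" using w(3)
      proof
        assume eq: "forces_eq w (x j) u"
        note n = nx[OF j] HS_name[OF u(1)] HS_name[OF v(1)]
        have "forces_eq w (opair_name u v) (opair_name (x j) v)"
          by (intro forces_opair_cong w(1) n forces_eq_sym[OF eq w(1) n(1,2)] forces_eq_refl)
        then show ?thesis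
          by (rule forces_mem_eq_left[OF uv _ w(1) name_opair_name[OF n(2,3)] name_opair_name[OF n(1,3)] nr])
      next
        assume "forces_mem w (opair_name (x j) u) (e r)"
        then show ?thesis
          by (rule forces_Tree_fm_trans[OF tree p e HS[OF j] u(1) v(1) w(1) wp forces_mem_mono[OF xT[OF j] wp p w(1)]
                forces_mem_mono[OF u(2) ws s(1) w(1)] forces_mem_mono[OF v(2) wt t(1) w(1)] _ uv])
      qed
      with w show "\<exists>s. s \<in>\<^sub>V P \<and> s \<preceq> t' \<and> forces_mem s (opair_name (x j) v) (e r)" by blast
    qed
    then have \<Psi>v: "\<Psi> t v" unfolding \<Psi>_def ball_elts using v(2) by blast
    obtain t' l w where w: "t' \<in>\<^sub>V P" "t' \<preceq> t" "\<langle>l, w\<rangle> \<in>\<^sub>V e T" "forces_eq t' v w"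
      by (rule forces_memE[OF v(2) t(1) leq_refl[OF t(1)]])
    have wHS: "w \<in> HS" using HS_opair[OF eT w(3)] by blast
    have "\<Psi> t' w" by (rule cong[OF mono[OF \<Psi>v w(2) t(1) w(1)] w(1) v(1) wHS w(4)])
    moreover have "t' \<preceq> q" using leq_trans w t s q by blast
    ultimately show "\<exists>s w. s \<in>\<^sub>V P \<and> s \<preceq> q \<and> appears w (e T) \<and> \<Psi> s w" using w unfolding appears_def by blast
  qed
  then show ?thesis using that[OF y] unfolding \<Psi>_def ball_elts by blast
qed

text \<open>Recursion along \<open>a\<close> in the ground model: the \<open>i\<close>-th name is chosen from the set \<open>C i\<close> of the
  candidates that continue the sequence, which is nonempty by \<open>extend_chain\<close>.\<close>

lemma forces_chain:
  assumes p: "p \<in>\<^sub>V P" and e: "HS_env e" and a: "a \<in>\<^sub>V lam" "e k = check_name a"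
    and tree: "forces_HS p e (Tree_fm T r)" and closed: "forces_HS p e (Closed_fm k T r)"
    and nomax: "\<And>s. s \<in>\<^sub>V P \<Longrightarrow> s \<preceq> p \<Longrightarrow> \<not> forces_HS s e (BEx T (BAll (T + 1) (Neg (Rel_fm 1 0 (r + 2)))))"
  shows "forces_HS p e (Ex (Chain_fm 0 (k + 1) (T + 1) (r + 1)))"
proof -
  obtain ch where ch_dfn: "definable_fun1 ch"
    and ch: "\<And>A. elts A \<subseteq> elts (candidates (e T)) \<Longrightarrow> elts A \<noteq> {} \<Longrightarrow> ch A \<in>\<^sub>V A"
    using choice[of "candidates (e T)"] by blast
  define H where "H i g = ch (vset {y. y \<in>\<^sub>V candidates (e T) \<and> forces_mem p y (e T) \<and>
      (\<forall>j\<in>elts i. forces_mem p (opair_name (ap g j) y) (e r))})" for i g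
  have H_dfn: "definable_fun2 H" unfolding H_def by (intro dfn definable_fun1_app[OF ch_dfn])
  have mem_dfn: "definable2 (\<in>\<^sub>V)" by (intro dfn)
  obtain x where x_dfn: "definable_fun1 x" and
    x: "\<And>i. i \<in>\<^sub>V a \<Longrightarrow> x i = H i (graph x {j \<in> elts a. j \<in>\<^sub>V i})"
    by (rule recursion[OF wf_set_mem[of a] mem_dfn H_dfn]) blast
  define C where "C i = {y \<in> elts (candidates (e T)). forces_mem p y (e T) \<and>
      (\<forall>j\<in>elts i. forces_mem p (opair_name (x j) y) (e r))}" for i
  have C_set: "isset (C i)" for i unfolding C_def by (rule separation) (intro dfn definable_fun1_app[OF x_dfn])
  have tr: "j \<in>\<^sub>V a" if "i \<in>\<^sub>V a" "j \<in>\<^sub>V i" for i j using ordinal_trans[OF ordinal_mem[OF lam_ordinal a(1)] that] .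
  have x_eq: "x i = ch (vset (C i))" if i: "i \<in>\<^sub>V a" for i
  proof -
    have iss: "isset {j \<in> elts a. j \<in>\<^sub>V i}" by (rule separation) (intro dfn)
    have "ap (graph x {j \<in> elts a. j \<in>\<^sub>V i}) j = x j" if "j \<in>\<^sub>V i" for j
      using ap_graph[OF x_dfn iss] tr[OF i that] that by simp
    then have "{y. y \<in>\<^sub>V candidates (e T) \<and> forces_mem p y (e T) \<and>
      (\<forall>j\<in>elts i. forces_mem p (opair_name (ap (graph x {j \<in> elts a. j \<in>\<^sub>V i}) j) y) (e r))} = C i"
      unfolding C_def by auto
    then show ?thesis using x[OF i] unfolding H_def by (simp only:)
  qed
  define Good where "Good i \<longleftrightarrow> x i \<in>\<^sub>V candidates (e T) \<and> forces_mem p (x i) (e T) \<and>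
      (\<forall>j\<in>elts i. forces_mem p (opair_name (x j) (x i)) (e r))" for i
  have Good_dfn: "definable1 Good" unfolding Good_def by (intro dfn definable_fun1_app[OF x_dfn])
  have good: "Good i" if "i \<in>\<^sub>V a" for i
  proof (rule wf_set_induct[OF wf_set_mem Good_dfn that])
    fix i assume i: "i \<in>\<^sub>V a" and IH: "\<And>j. j \<in>\<^sub>V a \<Longrightarrow> j \<in>\<^sub>V i \<Longrightarrow> Good j"
    have IH': "Good j" if "j \<in>\<^sub>V i" for j using IH[OF tr[OF i that] that] .
    have HS: "x j \<in> HS" if "j \<in>\<^sub>V i" for j using IH'[OF that] unfolding Good_def mem_candidates by blast
    have xT: "forces_mem p (x j) (e T)" if "j \<in>\<^sub>V i" for j using IH'[OF that] unfolding Good_def by blast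
    have inc: "forces_mem p (opair_name (x l) (x j)) (e r)" if "j \<in>\<^sub>V i" "l \<in>\<^sub>V j" for j l
      using IH'[OF that(1)] that(2) unfolding Good_def ball_elts by blast
    obtain y where y: "y \<in>\<^sub>V candidates (e T)" "forces_mem p y (e T)"
      "\<And>j. j \<in>\<^sub>V i \<Longrightarrow> forces_mem p (opair_name (x j) y) (e r)"
      by (rule extend_chain[OF p e a tree closed nomax i x_dfn HS xT inc]) blast+
    have "y \<in> C i" unfolding C_def using y by simp
    then have "elts (vset (C i)) \<noteq> {}" unfolding elts_vset[OF C_set] by blast
    moreover have "C i \<subseteq> elts (candidates (e T))" unfolding C_def by blast
    then have "elts (vset (C i)) \<subseteq> elts (candidates (e T))" unfolding elts_vset[OF C_set] .
    ultimately have "x i \<in> elts (vset (C i))" unfolding x_eq[OF i] elts_iff by (intro ch)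
    then show "Good i" unfolding elts_vset[OF C_set] unfolding C_def Good_def by simp
  qed
  have HS: "x i \<in> HS" if "i \<in>\<^sub>V a" for i using good[OF that] unfolding Good_def mem_candidates by blast
  have fHS: "seq_name a x \<in> HS" by (rule seq_name_HS[OF a(1) x_dfn HS])
  show ?thesis
  proof (rule forces_ExI[OF p e fHS])
    show "forces_HS p (case_nat (seq_name a x) e) (Chain_fm 0 (k + 1) (T + 1) (r + 1))"
      by (rule forces_Chain_fm_seq[OF p HS_env_case[OF fHS e] a(1) x_dfn HS])
        (use good a(2) in \<open>simp_all add: Good_def\<close>)
  qed
qed

text \<open>Either some condition below \<open>q'\<close> forces that a maximal element exists, or none does, and then
  \<open>forces_chain\<close> applies to \<open>q'\<close>.\<close>

lemma forces_DC_fm: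
  assumes p: "p \<in>\<^sub>V P" and e: "HS_env e" and a: "a \<in>\<^sub>V lam" "e k = check_name a"
  shows "forces_HS p e (DC_fm k)"
  unfolding DC_fm_def forces_HS.simps(5)
proof (intro ballI)
  fix T r assume n: "T \<in> HS" "r \<in> HS"
  let ?e = "case_nat r (case_nat T e)"
  have e2: "HS_env ?e" by (intro HS_env_case n e)
  let ?chain = "Ex (Chain_fm 0 (k + 3) 2 1)" and ?max = "BEx 1 (BAll 2 (Neg (Rel_fm 1 0 2)))"
  show "forces_HS p ?e (Tree_fm 1 0 \<^bold>\<and> Closed_fm (k + 2) 1 0 \<^bold>\<longrightarrow> ?chain \<^bold>\<or> ?max)"
    unfolding forces_Imp[OF p e2]
  proof (intro allI impI)
    fix q assume q: "q \<in>\<^sub>V P" "q \<preceq> p" and h: "forces_HS q ?e (Tree_fm 1 0 \<^bold>\<and> Closed_fm (k + 2) 1 0)"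
    have tree: "forces_HS q ?e (Tree_fm 1 0)" and closed: "forces_HS q ?e (Closed_fm (k + 2) 1 0)"
      using h unfolding forces_HS.simps(4)[of _ _ "Tree_fm 1 0"] by blast+
    show "forces_HS q ?e (?chain \<^bold>\<or> ?max)" unfolding forces_Disj
    proof (intro allI impI)
      fix q' assume q': "q' \<in>\<^sub>V P" "q' \<preceq> q"
      show "\<exists>s. s \<in>\<^sub>V P \<and> s \<preceq> q' \<and> (forces_HS s ?e ?chain \<or> forces_HS s ?e ?max)"
      proof (cases "\<exists>s. s \<in>\<^sub>V P \<and> s \<preceq> q' \<and> forces_HS s ?e ?max")
        case False
        have ek: "?e (k + 2) = check_name a" using a(2) by simp
        have "forces_HS q' ?e (Ex (Chain_fm 0 (k + 2 + 1) (1 + 1) (0 + 1)))"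
        proof (rule forces_chain[OF q'(1) e2 a(1) ek])
          show "forces_HS q' ?e (Tree_fm 1 0)" by (rule forces_HS_mono[OF tree q'(2) q(1) q'(1) e2])
          show "forces_HS q' ?e (Closed_fm (k + 2) 1 0)" by (rule forces_HS_mono[OF closed q'(2) q(1) q'(1) e2])
          show "\<not> forces_HS s ?e (BEx 1 (BAll (1 + 1) (Neg (Rel_fm 1 0 (0 + 2)))))" if "s \<in>\<^sub>V P" "s \<preceq> q'" for s
            using False that unfolding one_add_one add_0 by blast
        qed
        moreover have "k + 2 + 1 = k + 3" "(1::nat) + 1 = 2" "(0::nat) + 1 = 1" by simp_all
        ultimately show ?thesis using q'(1) leq_refl by (metis (no_types))
      qed blast
    qed
  qed
qed

lemma lam_successor: obtains t where "transitive t" "lam \<in>\<^sub>V t"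
proof -
  define t where "t = vset (insert lam (elts lam))"
  have t: "x \<in>\<^sub>V t \<longleftrightarrow> x = lam \<or> x \<in>\<^sub>V lam" for x
    unfolding t_def by (simp add: mem_vset isset_insert isset_elts)
  have "transitive t" using lam_transitive unfolding transitive_def t by blast
  then show ?thesis using that t by blast
qed

lemma check_lam: "check lam = check_name lam" and check_lam_in_HS: "check lam \<in> HS"
proof -
  obtain t where t: "transitive t" "lam \<in>\<^sub>V t" by (rule lam_successor)
  show c: "check lam = check_name lam" by (rule check_check_name[OF t])
  show "check lam \<in> HS" unfolding c using check_name_HS[OF t] by blast
qed

text \<open>An element of the canonical name of \<open>lam\<close> is densely often decided to be the canonical
  name of some \<open>a \<in> lam\<close>.\<close>

theorem forces_DC_less:
  assumes p: "p \<in>\<^sub>V P" shows "forces_HS p (\<lambda>_. check lam) (DC_less_fm 0)"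
proof -
  obtain t where tt: "transitive t" and lt: "lam \<in>\<^sub>V t" by (rule lam_successor)
  note c = check_lam
  have cHS: "check_name lam \<in> HS" using check_lam_in_HS unfolding c .
  then have e: "HS_env (\<lambda>_. check_name lam)" unfolding HS_env_def by blast
  show ?thesis unfolding c DC_less_fm_def forces_BAll[OF p e]
  proof (intro allI impI)
    fix x q assume x: "x \<in> HS" and q: "q \<in>\<^sub>V P" "q \<preceq> p" and m: "forces_mem q x (check_name lam)"
    let ?e = "case_nat x (\<lambda>_. check_name lam)"
    have ex: "HS_env ?e" by (rule HS_env_case[OF x e])
    have "forces_HS q ?e (DC_fm 0)"
    proof (rule forces_HS_dense[OF q(1) ex])
      fix q' assume q': "q' \<in>\<^sub>V P" "q' \<preceq> q"
      obtain s a where s: "s \<in>\<^sub>V P" "s \<preceq> q'" "a \<in>\<^sub>V lam" "forces_eq s x (check_name a)"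
        using m q' unfolding forces_mem_check_name[OF tt lt HS_name[OF x] q(1)] by blast
      let ?a = "case_nat (check_name a) (\<lambda>_. check_name lam)"
      have aHS: "check_name a \<in> HS" by (rule check_lam_HS[OF s(3)])
      have ea: "HS_env ?a" by (rule HS_env_case[OF aHS e])
      have "forces_HS s ?a (DC_fm 0)" by (rule forces_DC_fm[OF s(1) ea s(3)]) simp
      then have "forces_HS s ?e (DC_fm 0)"
      proof (rule forces_HS_cong[OF _ s(1) ea ex])
        show "forces_eq s (?a i) (?e i)" for i
          using forces_eq_sym[OF s(4,1) HS_name[OF x] HS_name[OF aHS]] forces_eq_refl[OF HS_name[OF cHS] s(1)]
          by (cases i) simp_all
      qed
      with s show "\<exists>s. s \<in>\<^sub>V P \<and> s \<preceq> q' \<and> forces_HS s ?e (DC_fm 0)" by blast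
    qed
    then show "forces_HS q ?e (InfCard_fm 0 \<^bold>\<longrightarrow> DC_fm 0)"
      unfolding forces_Imp[OF q(1) ex] using forces_HS_mono q(1) ex by blast
  qed
qed

end


section \<open>The truth lemma\<close>

context symmetric_model
begin

text \<open>For each formula separately, forcing it is definable; this makes the sets of conditions
  that decide the formula available to genericity. The terms \<open>t i\<close> stand for the environment.\<close>

lemma definable_forces_HS:
  assumes "definable_term s" "\<And>i. definable_term (t i)"
  shows "definable (\<lambda>e. forces_HS (s e) (\<lambda>i. t i e) \<phi>)"
  using assms
proof (induction \<phi> arbitrary: s t)
  case (Mem i j)
  then show ?case unfolding forces_HS.simps by (intro dfn)
next
  case (Eq i j)
  then show ?case unfolding forces_HS.simps by (intro dfn)
next
  case (Neg \<phi>)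
  have "definable (\<lambda>e. forces_HS (e 0) (\<lambda>i. t i (\<lambda>k. e (Suc k))) \<phi>)"
    by (rule Neg.IH[OF definable_term_var definable_term_rename[OF Neg.prems(2)]])
  then show ?case unfolding forces_HS.simps
    by (intro dfn definable_term_rename[OF Neg.prems(1), of Suc])
next
  case (Conj \<phi> \<psi>)
  then show ?case unfolding forces_HS.simps by (intro dfn) blast+
next
  case (All \<phi>)
  define t' where "t' i = (case i of 0 \<Rightarrow> \<lambda>e. e 0 | Suc j \<Rightarrow> \<lambda>e. t j (\<lambda>k. e (Suc k)))"
    for i :: nat
  have "definable_term (t' i)" for i
    unfolding t'_def by (cases i) (simp_all add: definable_term_var definable_term_rename[OF All.prems(2)])
  then have "definable (\<lambda>e. forces_HS (s (\<lambda>k. e (Suc k))) (\<lambda>i. t' i e) \<phi>)"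
    by (intro All.IH[OF definable_term_rename[OF All.prems(1)]])
  moreover have "(\<lambda>i. t' i e) = case_nat (e 0) (\<lambda>i. t i (\<lambda>k. e (Suc k)))" for e
    unfolding t'_def by (rule ext) (simp split: nat.split)
  ultimately have d: "definable (\<lambda>e. forces_HS (s (\<lambda>k. e (Suc k))) (case_nat (e 0) (\<lambda>i. t i (\<lambda>k. e (Suc k)))) \<phi>)"
    by (simp only:)
  show ?case unfolding forces_HS.simps by (intro dfn d)
qed

lemma definable1_forces_HS: "definable1 (\<lambda>q. forces_HS q e \<phi>)"
  by (rule definable_forces_HS) (intro dfn)+

lemma definable2_forces_HS: "definable2 (\<lambda>q x. forces_HS q (case_nat x e) \<phi>)"
proof -
  define t :: "nat \<Rightarrow> (nat \<Rightarrow> 'v) \<Rightarrow> 'v"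
    where "t i = (case i of 0 \<Rightarrow> \<lambda>e. e 1 | Suc j \<Rightarrow> \<lambda>_. e j)" for i
  have "definable_term (t i)" for i
    unfolding t_def by (cases i) (simp_all add: definable_term_var definable_term_const)
  then have "definable (\<lambda>e. forces_HS (e 0) (\<lambda>i. t i e) \<phi>)" by (intro definable_forces_HS definable_term_var)
  moreover have "(\<lambda>i. t i e') = case_nat (e' 1) e" for e'
    unfolding t_def by (rule ext) (simp split: nat.split)
  ultimately show ?thesis by (simp only:)
qed

end


locale generic_extension = symmetric_model mem P le Gr Fl
  for mem :: "'v \<Rightarrow> 'v \<Rightarrow> bool" (infix "\<in>\<^sub>V" 50) and P le Gr Fl :: 'v +
  fixes G :: "'v set" and R :: "'w \<Rightarrow> 'w \<Rightarrow> bool" and val :: "'v \<Rightarrow> 'w"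
  assumes wf: "wfP mem" and generic: "generic G" and interpretation_by: "interpretation_by G R val"
begin

lemma G_cond: "p \<in> G \<Longrightarrow> p \<in>\<^sub>V P"
  and G_up: "p \<in> G \<Longrightarrow> p \<preceq> q \<Longrightarrow> q \<in>\<^sub>V P \<Longrightarrow> q \<in> G"
  and G_directed: "p \<in> G \<Longrightarrow> q \<in> G \<Longrightarrow> \<exists>r. r \<in> G \<and> r \<preceq> p \<and> r \<preceq> q"
  and G_nonempty: "\<exists>p. p \<in> G"
  using generic unfolding generic_def ball_elts by (blast intro: elts_iff[THEN iffD1])+

text \<open>Genericity is about sets that are dense everywhere; a set that is dense below \<open>p\<close>
  becomes one by adding the conditions incompatible with \<open>p\<close>.\<close>

lemma G_meets:
  assumes D: "definable1 D" and p: "p \<in> G"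
    and dense: "\<And>q. q \<in>\<^sub>V P \<Longrightarrow> q \<preceq> p \<Longrightarrow> \<exists>s. s \<in>\<^sub>V P \<and> s \<preceq> q \<and> D s"
  shows "\<exists>s. s \<in> G \<and> s \<preceq> p \<and> D s"
proof -
  note pP = G_cond[OF p]
  define E where "E = vset {s \<in> elts P. (s \<preceq> p \<and> D s) \<or> \<not> compatible s p}"
  have "isset {s \<in> elts P. (s \<preceq> p \<and> D s) \<or> \<not> compatible s p}"
    by (rule separation) (intro dfn definable1_app[OF D])
  from mem_vset[OF this] have E: "s \<in>\<^sub>V E \<longleftrightarrow> s \<in>\<^sub>V P \<and> ((s \<preceq> p \<and> D s) \<or> \<not> compatible s p)" for s
    unfolding E_def by simp
  have "\<exists>d. d \<in>\<^sub>V E \<and> d \<preceq> q" if q: "q \<in>\<^sub>V P" for q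
  proof (cases "compatible q p")
    case True
    then obtain r where r: "r \<in>\<^sub>V P" "r \<preceq> q" "r \<preceq> p" unfolding compatible_def bex_elts by blast
    obtain s where s: "s \<in>\<^sub>V P" "s \<preceq> r" "D s" using dense[OF r(1,3)] by blast
    then have "s \<preceq> p" "s \<preceq> q" using leq_trans r q pP by blast+
    with s show ?thesis unfolding E by blast
  next
    case False
    with q leq_refl show ?thesis unfolding E by blast
  qed
  then have "dense E" unfolding dense_def using E by auto
  then have "G \<inter> elts E \<noteq> {}" using generic unfolding generic_def by blast
  then obtain s where s: "s \<in> G" "s \<in>\<^sub>V E" by auto
  have "compatible s p" using G_directed[OF s(1) p] G_cond unfolding compatible_def bex_elts by blast
  with s show ?thesis unfolding E by blast
qed

lemma R_val: "name x \<Longrightarrow> R a (val x) \<longleftrightarrow> (\<exists>p y. p \<in> G \<and> \<langle>p, y\<rangle> \<in>\<^sub>V x \<and> a = val y)"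
  using interpretation_by unfolding interpretation_by_def by blast

lemma val_ext:
  assumes "name x" "name y" "\<And>a. R a (val x) \<longleftrightarrow> R a (val y)" shows "val x = val y"
proof -
  have "{a. R a (val x)} = {a. R a (val y)}" using assms(3) by blast
  then show ?thesis using interpretation_by assms(1,2) unfolding interpretation_by_def by blast
qed

lemma appears_wf_induct:
  assumes "\<And>x. (\<And>y. appears y x \<Longrightarrow> Q y) \<Longrightarrow> Q x" shows "Q x"
proof -
  have "tranclp mem y x" if yx: "appears y x" for y x
  proof -
    obtain p where p: "\<langle>p, y\<rangle> \<in>\<^sub>V x" using yx unfolding appears_def by blast
    have "y \<in>\<^sub>V upair p y" "upair p y \<in>\<^sub>V \<langle>p, y\<rangle>" unfolding opair_def mem_upair by simp_all
    with p show ?thesis by (meson tranclp.r_into_trancl tranclp.trancl_into_trancl)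
  qed
  moreover have "wfP (tranclp mem)" using wf by (rule wfp_tranclp)
  ultimately show ?thesis using assms by (metis (no_types, lifting) wfp_induct)
qed

lemma val_eqI: "name x \<Longrightarrow> name y \<Longrightarrow> p \<in> G \<Longrightarrow> forces_eq p x y \<Longrightarrow> val x = val y"
proof (induction x arbitrary: y p rule: appears_wf_induct)
  case (1 x)
  note nx = 1(2) and ny = 1(3) and p = 1(4) and xy = 1(5)
  note pP = G_cond[OF p]
  have step: "\<exists>s t w. s \<in> G \<and> t \<in> G \<and> \<langle>t, w\<rangle> \<in>\<^sub>V v \<and> forces_eq s z w"
    if uv: "forces_eq p u v" "name u" "name v" and z: "\<langle>r, z\<rangle> \<in>\<^sub>V u" "r \<in> G" for u v r z
  proof -
    obtain q where q: "q \<in> G" "q \<preceq> p" "q \<preceq> r" using G_directed[OF p z(2)] by blast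
    have m: "forces_mem q z v" by (rule forces_eqD[OF uv(1) pP uv(2,3) z(1) G_cond[OF q(1)] q(2,3)])
    have "\<exists>s. s \<in> G \<and> s \<preceq> q \<and> (\<exists>t w. \<langle>t, w\<rangle> \<in>\<^sub>V v \<and> s \<preceq> t \<and> forces_eq s z w)"
      by (rule G_meets[OF _ q(1)], intro dfn) (use m in \<open>unfold forces_mem_iff, blast\<close>)
    then show ?thesis using G_up name_cond[OF uv(3)] by blast
  qed
  show ?case
  proof (rule val_ext[OF nx ny], rule iffI)
    fix a assume "R a (val x)"
    then obtain r z where z: "r \<in> G" "\<langle>r, z\<rangle> \<in>\<^sub>V x" "a = val z" unfolding R_val[OF nx] by blast
    obtain s t w where s: "s \<in> G" "t \<in> G" "\<langle>t, w\<rangle> \<in>\<^sub>V y" "forces_eq s z w" using step[OF xy nx ny z(2,1)] by blast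
    have "val z = val w"
      by (rule 1(1)[OF _ name_name[OF nx z(2)] name_name[OF ny s(3)] s(1,4)]) (use z(2) in \<open>unfold appears_def, blast\<close>)
    then show "R a (val y)" unfolding R_val[OF ny] using s z(3) by blast
  next
    fix a assume "R a (val y)"
    then obtain r z where z: "r \<in> G" "\<langle>r, z\<rangle> \<in>\<^sub>V y" "a = val z" unfolding R_val[OF ny] by blast
    obtain s t w where s: "s \<in> G" "t \<in> G" "\<langle>t, w\<rangle> \<in>\<^sub>V x" "forces_eq s z w"
      using step[OF forces_eq_sym[OF xy pP nx ny] ny nx z(2,1)] by blast
    note n = name_name[OF ny z(2)] name_name[OF nx s(3)]
    have "val w = val z"
      by (rule 1(1)[OF _ n(2,1) s(1) forces_eq_sym[OF s(4) G_cond[OF s(1)] n]]) (use s(3) in \<open>unfold appears_def, blast\<close>)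
    then have "a = val w" using z(3) by simp
    then show "R a (val x)" unfolding R_val[OF nx] using s by blast
  qed
qed

text \<open>The conditions that force \<open>x = y\<close>, or force some element of one of them not to be in the
  other, are dense. One of these conditions is in the filter, and it cannot be of the second
  kind when the values agree.\<close>

lemma val_eqD: "name x \<Longrightarrow> name y \<Longrightarrow> val x = val y \<Longrightarrow> \<exists>p. p \<in> G \<and> forces_eq p x y"
proof (induction x arbitrary: y rule: appears_wf_induct)
  case (1 x)
  note nx = 1(2) and ny = 1(3) and eq = 1(4)
  define bad where "bad u v q \<longleftrightarrow> (\<exists>r z. \<langle>r, z\<rangle> \<in>\<^sub>V u \<and> q \<preceq> r \<and> (\<forall>s\<in>elts P. s \<preceq> q \<longrightarrow> \<not> forces_mem s z v))" for u v q
  have bad_dfn: "definable3 bad" unfolding bad_def by (intro dfn)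
  have badI: "\<exists>s. s \<in>\<^sub>V P \<and> s \<preceq> q' \<and> bad u v s"
    if nm: "name u" "\<langle>r, z\<rangle> \<in>\<^sub>V u" and q: "q \<in>\<^sub>V P" "q \<preceq> q'" "q \<preceq> r" "q' \<in>\<^sub>V P" and no: "\<not> forces_mem q z v" for u v r z q q'
  proof -
    obtain s where s: "s \<in>\<^sub>V P" "s \<preceq> q" "\<And>t. t \<in>\<^sub>V P \<Longrightarrow> t \<preceq> s \<Longrightarrow> \<not> forces_mem t z v"
      using no forces_mem_dense[OF q(1), of z v] by blast
    have "s \<preceq> r" "s \<preceq> q'" using leq_trans s q name_cond[OF nm] by blast+
    then show ?thesis unfolding bad_def using s nm by auto
  qed
  obtain p0 where p0: "p0 \<in> G" using G_nonempty by blast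
  have "\<exists>s. s \<in> G \<and> s \<preceq> p0 \<and> (forces_eq s x y \<or> bad x y s \<or> bad y x s)"
  proof (rule G_meets[OF _ p0])
    show "definable1 (\<lambda>s. forces_eq s x y \<or> bad x y s \<or> bad y x s)" by (intro dfn definable3_app[OF bad_dfn])
    fix q assume q: "q \<in>\<^sub>V P" "q \<preceq> p0"
    show "\<exists>s. s \<in>\<^sub>V P \<and> s \<preceq> q \<and> (forces_eq s x y \<or> bad x y s \<or> bad y x s)"
    proof (cases "forces_eq q x y")
      case True
      then show ?thesis using q leq_refl by blast
    next
      case False
      then have "(\<exists>r z s. \<langle>r, z\<rangle> \<in>\<^sub>V x \<and> s \<in>\<^sub>V P \<and> s \<preceq> q \<and> s \<preceq> r \<and> \<not> forces_mem s z y) \<or>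
          (\<exists>r z s. \<langle>r, z\<rangle> \<in>\<^sub>V y \<and> s \<in>\<^sub>V P \<and> s \<preceq> q \<and> s \<preceq> r \<and> \<not> forces_mem s z x)"
        using forces_eqI[OF q(1) nx ny] by blast
      then show ?thesis
      proof (elim disjE exE conjE)
        fix r z s assume "\<langle>r, z\<rangle> \<in>\<^sub>V x" "s \<in>\<^sub>V P" "s \<preceq> q" "s \<preceq> r" "\<not> forces_mem s z y"
        from badI[OF nx this(1-4) q(1) this(5)] show ?thesis by blast
      next
        fix r z s assume "\<langle>r, z\<rangle> \<in>\<^sub>V y" "s \<in>\<^sub>V P" "s \<preceq> q" "s \<preceq> r" "\<not> forces_mem s z x"
        from badI[OF ny this(1-4) q(1) this(5)] show ?thesis by blast
      qed
    qed
  qed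
  then obtain s where s: "s \<in> G" "forces_eq s x y \<or> bad x y s \<or> bad y x s" by blast
  \<comment> \<open>A condition in the filter that forces some \<open>z\<close> with value in \<open>u\<close> out of \<open>v\<close> contradicts \<open>val u = val v\<close>.\<close>
  have not_bad: "\<not> bad u v s" if uv: "name u" "name v" "val u = val v"
    and IH: "\<And>r z t w. \<langle>r, z\<rangle> \<in>\<^sub>V u \<Longrightarrow> \<langle>t, w\<rangle> \<in>\<^sub>V v \<Longrightarrow> val z = val w \<Longrightarrow> \<exists>p. p \<in> G \<and> forces_eq p z w" for u v
  proof
    assume "bad u v s"
    then obtain r z where z: "\<langle>r, z\<rangle> \<in>\<^sub>V u" "s \<preceq> r" "\<And>q. q \<in>\<^sub>V P \<Longrightarrow> q \<preceq> s \<Longrightarrow> \<not> forces_mem q z v"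
      unfolding bad_def ball_elts by blast
    have "r \<in> G" by (rule G_up[OF s(1) z(2) name_cond[OF uv(1) z(1)]])
    then have "R (val z) (val v)" using z(1) R_val[OF uv(1)] uv(3) by metis
    then obtain t w where w: "t \<in> G" "\<langle>t, w\<rangle> \<in>\<^sub>V v" "val z = val w" unfolding R_val[OF uv(2)] by blast
    obtain p where p: "p \<in> G" "forces_eq p z w" using IH[OF z(1) w(2,3)] by blast
    obtain q1 where q1: "q1 \<in> G" "q1 \<preceq> p" "q1 \<preceq> t" using G_directed[OF p(1) w(1)] by blast
    obtain q where q: "q \<in> G" "q \<preceq> q1" "q \<preceq> s" using G_directed[OF q1(1) s(1)] by blast
    note qP = G_cond[OF q(1)] and n = name_name[OF uv(1) z(1)] name_name[OF uv(2) w(2)]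
    have "q \<preceq> p" "q \<preceq> t" using leq_trans q q1 G_cond p w by blast+
    then have "forces_mem q w v" "forces_eq q z w"
      using forces_mem_opair[OF uv(2) w(2) qP] forces_eq_mono[OF p(2) _ G_cond[OF p(1)] qP n] by blast+
    then have "forces_mem q z v" using forces_mem_eq_left[OF _ forces_eq_sym[OF _ qP n] qP n(2,1) uv(2)] by blast
    then show False using z(3)[OF qP q(3)] by blast
  qed
  have "\<not> bad x y s"
  proof (rule not_bad[OF nx ny eq])
    fix r z t w assume z: "\<langle>r, z\<rangle> \<in>\<^sub>V x" and w: "\<langle>t, w\<rangle> \<in>\<^sub>V y" and "val z = val w"
    then show "\<exists>p. p \<in> G \<and> forces_eq p z w"
      using 1(1)[OF _ name_name[OF nx z] name_name[OF ny w]] unfolding appears_def by blast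
  qed
  moreover have "\<not> bad y x s"
  proof (rule not_bad[OF ny nx eq[symmetric]])
    fix r z t w assume z: "\<langle>r, z\<rangle> \<in>\<^sub>V y" and w: "\<langle>t, w\<rangle> \<in>\<^sub>V x" and e: "val z = val w"
    obtain p where p: "p \<in> G" "forces_eq p w z"
      using 1(1)[OF _ name_name[OF nx w] name_name[OF ny z] e[symmetric]] w unfolding appears_def by blast
    then show "\<exists>p. p \<in> G \<and> forces_eq p z w"
      using forces_eq_sym[OF p(2) G_cond[OF p(1)] name_name[OF nx w] name_name[OF ny z]] by blast
  qed
  ultimately show ?case using s by blast
qed

lemma val_eq_iff: "name x \<Longrightarrow> name y \<Longrightarrow> val x = val y \<longleftrightarrow> (\<exists>p. p \<in> G \<and> forces_eq p x y)"
  using val_eqI val_eqD by blast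

lemma val_mem_iff:
  assumes n: "name x" "name y" shows "R (val x) (val y) \<longleftrightarrow> (\<exists>p. p \<in> G \<and> forces_mem p x y)"
proof
  assume "R (val x) (val y)"
  then obtain t w where w: "t \<in> G" "\<langle>t, w\<rangle> \<in>\<^sub>V y" "val x = val w" unfolding R_val[OF n(2)] by blast
  note nw = name_name[OF n(2) w(2)]
  obtain p where p: "p \<in> G" "forces_eq p x w" using val_eqD[OF n(1) nw w(3)] by blast
  obtain q where q: "q \<in> G" "q \<preceq> p" "q \<preceq> t" using G_directed[OF p(1) w(1)] by blast
  note qP = G_cond[OF q(1)]
  have "forces_eq q x w" by (rule forces_eq_mono[OF p(2) q(2) G_cond[OF p(1)] qP n(1) nw])
  then have "forces_mem q x y"
    by (intro forces_mem_eq_left[OF forces_mem_opair[OF n(2) w(2) qP q(3)] _ qP nw n] forces_eq_sym[OF _ qP n(1) nw])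
  with q(1) show "\<exists>p. p \<in> G \<and> forces_mem p x y" by blast
next
  assume "\<exists>p. p \<in> G \<and> forces_mem p x y"
  then obtain p where p: "p \<in> G" "forces_mem p x y" by blast
  have "\<exists>s. s \<in> G \<and> s \<preceq> p \<and> (\<exists>t w. \<langle>t, w\<rangle> \<in>\<^sub>V y \<and> s \<preceq> t \<and> forces_eq s x w)"
    by (rule G_meets[OF _ p(1)], intro dfn) (use p(2) in \<open>unfold forces_mem_iff, blast\<close>)
  then obtain s t w where s: "s \<in> G" "\<langle>t, w\<rangle> \<in>\<^sub>V y" "s \<preceq> t" "forces_eq s x w" by blast
  have "t \<in> G" by (rule G_up[OF s(1,3) name_cond[OF n(2) s(2)]])
  moreover have "val x = val w" by (rule val_eqI[OF n(1) name_name[OF n(2) s(2)] s(1,4)])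
  ultimately show "R (val x) (val y)" unfolding R_val[OF n(2)] using s(2) by blast
qed

theorem truth:
  "HS_env e \<Longrightarrow> sat (val ` HS) R (\<lambda>i. val (e i)) \<phi> \<longleftrightarrow> (\<exists>p. p \<in> G \<and> forces_HS p e \<phi>)"
proof (induction \<phi> arbitrary: e)
  case (Mem i j)
  then show ?case using val_mem_iff HS_env_name by simp
next
  case (Eq i j)
  then show ?case using val_eq_iff HS_env_name by simp
next
  case (Neg \<phi>)
  note e = Neg.prems
  have "\<not> (\<exists>p. p \<in> G \<and> forces_HS p e \<phi>) \<longleftrightarrow> (\<exists>p. p \<in> G \<and> forces_HS p e (Neg \<phi>))"
  proof
    assume no: "\<not> (\<exists>p. p \<in> G \<and> forces_HS p e \<phi>)"
    obtain p0 where p0: "p0 \<in> G" using G_nonempty by blast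
    have "\<exists>s. s \<in> G \<and> s \<preceq> p0 \<and> (forces_HS s e \<phi> \<or> forces_HS s e (Neg \<phi>))"
    proof (rule G_meets[OF _ p0])
      show "definable1 (\<lambda>s. forces_HS s e \<phi> \<or> forces_HS s e (Neg \<phi>))"
        by (intro dfn definable1_app[OF definable1_forces_HS])
      fix q assume q: "q \<in>\<^sub>V P"
      show "\<exists>s. s \<in>\<^sub>V P \<and> s \<preceq> q \<and> (forces_HS s e \<phi> \<or> forces_HS s e (Neg \<phi>))"
        using q leq_refl unfolding forces_HS.simps(3) ball_elts by blast
    qed
    with no show "\<exists>p. p \<in> G \<and> forces_HS p e (Neg \<phi>)" by blast
  next
    assume "\<exists>p. p \<in> G \<and> forces_HS p e (Neg \<phi>)"
    then obtain p where p: "p \<in> G" "forces_HS p e (Neg \<phi>)" by blast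
    show "\<not> (\<exists>p. p \<in> G \<and> forces_HS p e \<phi>)"
    proof
      assume "\<exists>p. p \<in> G \<and> forces_HS p e \<phi>"
      then obtain q where q: "q \<in> G" "forces_HS q e \<phi>" by blast
      obtain r where r: "r \<in> G" "r \<preceq> p" "r \<preceq> q" using G_directed[OF p(1) q(1)] by blast
      have "forces_HS r e \<phi>" by (rule forces_HS_mono[OF q(2) r(3) G_cond[OF q(1)] G_cond[OF r(1)] e])
      then show False using p(2) G_cond[OF r(1)] r(2) unfolding forces_HS.simps(3) ball_elts by blast
    qed
  qed
  then show ?case unfolding sat.simps(3) Neg.IH[OF e] .
next
  case (Conj \<phi> \<psi>)
  note e = Conj.prems
  show ?case unfolding sat.simps(4) Conj.IH[OF e]
  proof
    assume "(\<exists>p. p \<in> G \<and> forces_HS p e \<phi>) \<and> (\<exists>p. p \<in> G \<and> forces_HS p e \<psi>)"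
    then obtain p q where p: "p \<in> G" "forces_HS p e \<phi>" and q: "q \<in> G" "forces_HS q e \<psi>" by blast
    obtain r where r: "r \<in> G" "r \<preceq> p" "r \<preceq> q" using G_directed[OF p(1) q(1)] by blast
    have "forces_HS r e \<phi>" "forces_HS r e \<psi>"
      using forces_HS_mono[OF p(2) r(2) G_cond[OF p(1)] G_cond[OF r(1)] e]
        forces_HS_mono[OF q(2) r(3) G_cond[OF q(1)] G_cond[OF r(1)] e] by blast+
    then show "\<exists>p. p \<in> G \<and> forces_HS p e (\<phi> \<^bold>\<and> \<psi>)" using r(1) by auto
  qed auto
next
  case (All \<phi>)
  note e = All.prems
  have cn: "case_nat (val x) (\<lambda>i. val (e i)) = (\<lambda>i. val (case_nat x e i))" for x
    by (rule ext) (simp split: nat.split)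
  have IH: "sat (val ` HS) R (case_nat (val x) (\<lambda>i. val (e i))) \<phi> \<longleftrightarrow> (\<exists>p. p \<in> G \<and> forces_HS p (case_nat x e) \<phi>)"
    if "x \<in> HS" for x unfolding cn by (rule All.IH[OF HS_env_case[OF that e]])
  have "(\<forall>x\<in>HS. \<exists>p. p \<in> G \<and> forces_HS p (case_nat x e) \<phi>) \<longleftrightarrow> (\<exists>p. p \<in> G \<and> forces_HS p e (All \<phi>))"
  proof
    assume all: "\<forall>x\<in>HS. \<exists>p. p \<in> G \<and> forces_HS p (case_nat x e) \<phi>"
    obtain p0 where p0: "p0 \<in> G" using G_nonempty by blast
    have "\<exists>s. s \<in> G \<and> s \<preceq> p0 \<and> (forces_HS s e (All \<phi>) \<or> (\<exists>x. x \<in> HS \<and> forces_HS s (case_nat x e) (Neg \<phi>)))"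
    proof (rule G_meets[OF _ p0])
      show "definable1 (\<lambda>s. forces_HS s e (All \<phi>) \<or> (\<exists>x. x \<in> HS \<and> forces_HS s (case_nat x e) (Neg \<phi>)))"
        by (intro dfn definable1_app[OF definable1_forces_HS] definable2_app[OF definable2_forces_HS])
      fix q assume q: "q \<in>\<^sub>V P"
      show "\<exists>s. s \<in>\<^sub>V P \<and> s \<preceq> q \<and> (forces_HS s e (All \<phi>) \<or> (\<exists>x. x \<in> HS \<and> forces_HS s (case_nat x e) (Neg \<phi>)))"
      proof (cases "forces_HS q e (All \<phi>)")
        case True
        then show ?thesis using q leq_refl by blast
      next
        case False
        then obtain x where x: "x \<in> HS" "\<not> forces_HS q (case_nat x e) \<phi>" unfolding forces_HS.simps(5) by blast
        then obtain s where s: "s \<in>\<^sub>V P" "s \<preceq> q" "\<And>t. t \<in>\<^sub>V P \<Longrightarrow> t \<preceq> s \<Longrightarrow> \<not> forces_HS t (case_nat x e) \<phi>"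
          using forces_HS_dense[OF q HS_env_case[OF x(1) e], of \<phi>] by blast
        then have "forces_HS s (case_nat x e) (Neg \<phi>)" by simp
        with s x show ?thesis by blast
      qed
    qed
    then obtain s where s: "s \<in> G" "forces_HS s e (All \<phi>) \<or> (\<exists>x. x \<in> HS \<and> forces_HS s (case_nat x e) (Neg \<phi>))"
      by blast
    have "\<not> forces_HS s (case_nat x e) (Neg \<phi>)" if x: "x \<in> HS" for x
    proof
      assume neg: "forces_HS s (case_nat x e) (Neg \<phi>)"
      obtain p where p: "p \<in> G" "forces_HS p (case_nat x e) \<phi>" using all x by blast
      obtain r where r: "r \<in> G" "r \<preceq> s" "r \<preceq> p" using G_directed[OF s(1) p(1)] by blast
      have "forces_HS r (case_nat x e) \<phi>"
        by (rule forces_HS_mono[OF p(2) r(3) G_cond[OF p(1)] G_cond[OF r(1)] HS_env_case[OF x e]])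
      then show False using neg G_cond[OF r(1)] r(2) unfolding forces_HS.simps(3) ball_elts by blast
    qed
    with s show "\<exists>p. p \<in> G \<and> forces_HS p e (All \<phi>)" by blast
  next
    assume "\<exists>p. p \<in> G \<and> forces_HS p e (All \<phi>)"
    then show "\<forall>x\<in>HS. \<exists>p. p \<in> G \<and> forces_HS p (case_nat x e) \<phi>" unfolding forces_HS.simps(5) by blast
  qed
  moreover have "sat (val ` HS) R (\<lambda>i. val (e i)) (All \<phi>) \<longleftrightarrow> (\<forall>x\<in>HS. \<exists>p. p \<in> G \<and> forces_HS p (case_nat x e) \<phi>)"
    using IH by simp
  ultimately show ?case by (simp only:)
qed

end


section \<open>Dependent choice in symmetric extensions\<close>

theorem lemma3p3:
  fixes mem :: "'v \<Rightarrow> 'v \<Rightarrow> bool" and P le Gr Fl lam :: 'v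
    and R :: "'w \<Rightarrow> 'w \<Rightarrow> bool" and val :: "'v \<Rightarrow> 'w" and G :: "'v set"
  assumes "set_universe.ZFC mem"
    and "set_universe.infinite_cardinal mem lam"
    and "forcing_data.symmetric_system mem P le Gr Fl"
    and "forcing_data.chain_condition mem P le lam"
    and "forcing_data.complete_filter mem Fl lam"
  shows "forcing_data.forced_HS mem P le Gr Fl (\<lambda>_. forcing_data.check mem P lam) (DC_less_fm 0) \<and>
    (wfP mem \<and> forcing_data.generic mem P le G \<and> forcing_data.interpretation_by mem P G R val \<longrightarrow>
      sat (val ` forcing_data.HS mem P Gr Fl) R (\<lambda>_. val (forcing_data.check mem P lam)) (DC_less_fm 0))"
proof -
  interpret zfc_model mem by unfold_locales (rule assms(1))
  interpret forcing_model mem P le Gr Fl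
    by unfold_locales (use assms(3) in \<open>simp add: forcing_data.symmetric_system_def\<close>)
  interpret symmetric_model mem P le Gr Fl by unfold_locales (rule assms(3))
  interpret dc_model mem P le Gr Fl lam by unfold_locales (rule assms)+
  have forced: "forced_HS (\<lambda>_. check lam) (DC_less_fm 0)" unfolding forced_HS_def using forces_DC_less by simp
  moreover have "sat (val ` HS) R (\<lambda>_. val (check lam)) (DC_less_fm 0)"
    if "wfP mem" "generic G" "interpretation_by G R val"
  proof -
    interpret generic_extension mem P le Gr Fl G R val by unfold_locales (rule that)+
    obtain p where p: "p \<in> G" using G_nonempty by blast
    have "HS_env (\<lambda>_. check lam)" unfolding HS_env_def using check_lam_in_HS by blast
    from truth[OF this, of "DC_less_fm 0"] show ?thesis using p forces_DC_less[OF G_cond[OF p]] by blast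
  qed
  ultimately show ?thesis by blast
qed

end
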